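(* Let $d\ge 1$ and $0\le s\le\lfloor d/2\rfloor$ be integers, put $r=d-2s$, and let $B>0$ be a real number. For real numbers $x_1,\dots,x_r,y_1,\dots,y_s,z_1,\dots,z_s$ let $R_j(X)=X^2-2y_jX+y_j^2+z_j^2$ $(j=1,\dots,s)$. Then $$\lambda_d(\mathcal H_d^*(s,B))=\frac{2^s}{r!\,s!}\int_{H_d(s,B)}|\Delta_r|\,\Delta_s\,\Delta_{r,s}\prod_{j=1}^{s}|z_j|\;dx_1\cdots dx_r\,dy_1dz_1\cdots dy_sdz_s ,$$ where $$\Delta_r=\prod_{1\le j<k\le r}(x_j-x_k),\qquad \Delta_s=\prod_{1\le j<k\le s}\mathrm{Res}(R_j(X),R_k(X)),\qquad \Delta_{r,s}=\prod_{j=1}^{r}\prod_{k=1}^{s}R_k(x_j).$$ Furthermore, $$\lambda_{d+1}(\mathcal H_d^+(s,B))=B^{d+1}\int_{0}^{1}u^d\,\lambda_d\!\left(\mathcal H_d^*\!\left(s,\tfrac1u\right)\right)du.$$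
   Context: A real polynomial $P(X)=p_dX^d+\dots+p_0\in\mathbb R[X]$ with $p_d\ne 0$ is said to have signature $s$ if, counting roots with multiplicity, it has exactly $s$ pairs of complex conjugate non-real roots (and hence exactly $r=d-2s$ real roots). For real $B>0$: - $\mathcal H_d(s,B)$ is the set of vectors $(p_0,\dots,p_d)\in\mathbb R^{d+1}$ with $p_d\neq 0$ and $|p_i|\le B$ for $0\le i\le d$, such that $p_dX^d+\dots+p_0$ has signature $s$. - $\mathcal H_d^*(s,B)=\{(p_0,\dots,p_{d-1})\in\mathbb R^d : (p_0,\dots,p_{d-1},1)\in\mathcal H_d(s,B)\}$. - $\mathcal H_d^+(s,B)=\{(p_0,\dots,p_d)\in\mathcal H_d(s,B) : p_d>0\}$. - $H_d(s,B)$ is the set of vectors $(x_1,\dots,x_r,y_1,\dots,y_s,z_1,\dots,z_s)\in\mathbb R^d$ with $z_j\ne 0$ for $j=1,\dots,s$ and $$-B\le S_j(x_1,\dots,x_r,y_1+iz_1,y_1-iz_1,\dots,y_s+iz_s,y_s-iz_s)\le B\qquad(1\le j\le d),$$ where $i=\sqrt{-1}$ and $S_j$ is the $j$-th elementary symmetric polynomial in $d$ variables. $\mathrm{Res}(P,Q)$ denotes the resultant of $P,Q\in\mathbb R[X]$, $\lambda_n$ denotes Lebesgue measure on $\mathbb R^n$, and empty products equal $1$.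
   Formalization: For B<1 the set H_d^*(s,B) is empty since the leading coefficient 1 exceeds B, so the first formula fails (d=1, s=0, B=1/2: 0 versus 1). It is proved for H_d^* when B≥1, and for all B>0 with only p_0,…,p_{d-1} bounded by B. *)

theory Defs
  imports
    "HOL-Analysis.Analysis"
    "HOL-Computational_Algebra.Computational_Algebra"
    "Subresultants.Resultant_Prelim"
begin

text \<open>
  Vectors of dimension \<open>n\<close> are functions \<open>v :: nat \<Rightarrow> real\<close> in \<open>extensional {..<n}\<close>
  (that is, \<open>undefined\<close> outside \<open>{..<n}\<close>), the points of the library's product spaces
  \<open>Pi\<^sub>M {..<n}\<close>. All indices start from 0.
\<close>

definition lebesgue_vec :: "nat \<Rightarrow> (nat \<Rightarrow> real) measure" where
  "lebesgue_vec n = completion (\<Pi>\<^sub>M i\<in>{..<n}. lborel)"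

definition poly_of_vec :: "nat \<Rightarrow> (nat \<Rightarrow> real) \<Rightarrow> real poly" where
  "poly_of_vec d p = (\<Sum>i\<le>d. monom (p i) i)"

text \<open>
  \<open>proots\<close> is the multiset of roots with multiplicity; the non-real ones are required to be
  made up of exactly \<open>s\<close> pairs \<open>w, cnj w\<close>.
\<close>

definition has_signature :: "real poly \<Rightarrow> nat \<Rightarrow> bool" where
  "has_signature P s \<longleftrightarrow> P \<noteq> 0 \<and>
     (\<exists>W. size W = s \<and>
          filter_mset (\<lambda>z. z \<notin> \<real>) (proots (map_poly complex_of_real P)) = W + image_mset cnj W)"

definition Hcoeff :: "nat \<Rightarrow> nat \<Rightarrow> real \<Rightarrow> (nat \<Rightarrow> real) set" where
  "Hcoeff d s B = {p \<in> extensional {..<d+1}.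
     p d \<noteq> 0 \<and> (\<forall>i\<le>d. \<bar>p i\<bar> \<le> B) \<and> has_signature (poly_of_vec d p) s}"

definition Hcoeff_star :: "nat \<Rightarrow> nat \<Rightarrow> real \<Rightarrow> (nat \<Rightarrow> real) set" where
  "Hcoeff_star d s B = {p \<in> extensional {..<d}. p(d := 1) \<in> Hcoeff d s B}"

definition Hcoeff_plus :: "nat \<Rightarrow> nat \<Rightarrow> real \<Rightarrow> (nat \<Rightarrow> real) set" where
  "Hcoeff_plus d s B = {p \<in> Hcoeff d s B. p d > 0}"

text \<open>
  In \<open>Hcoeff_star d s B\<close> the height bound also applies to the leading coefficient 1, so this set
  is empty for \<open>B < 1\<close>. The following variant bounds only the coefficients below the leading one;
  the two agree for \<open>B \<ge> 1\<close> (see the lemmas below).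
\<close>

definition Hcoeff_monic :: "nat \<Rightarrow> nat \<Rightarrow> real \<Rightarrow> (nat \<Rightarrow> real) set" where
  "Hcoeff_monic d s B = {p \<in> extensional {..<d}.
     (\<forall>i<d. \<bar>p i\<bar> \<le> B) \<and> has_signature (poly_of_vec d (p(d := 1))) s}"

lemma Hcoeff_star_eq_monic: "1 \<le> B \<Longrightarrow> Hcoeff_star d s B = Hcoeff_monic d s B"
  unfolding Hcoeff_star_def Hcoeff_monic_def Hcoeff_def
  by (auto simp: extensional_def le_less)

lemma Hcoeff_star_empty: "B < 1 \<Longrightarrow> Hcoeff_star d s B = {}"
  unfolding Hcoeff_star_def Hcoeff_def by auto

text \<open>The \<open>j\<close>-th elementary symmetric polynomial in \<open>length xs\<close> variables, evaluated at \<open>xs\<close>.\<close>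

definition elem_sym :: "nat \<Rightarrow> 'a::comm_ring_1 list \<Rightarrow> 'a" where
  "elem_sym j xs = (\<Sum>A | A \<subseteq> {..<length xs} \<and> card A = j. \<Prod>i\<in>A. xs ! i)"

text \<open>
  A vector \<open>v\<close> of dimension \<open>r + 2 * s\<close> stands for
  \<open>(x\<^sub>1,\<dots>,x\<^sub>r,y\<^sub>1,\<dots>,y\<^sub>s,z\<^sub>1,\<dots>,z\<^sub>s)\<close>.
\<close>

definition xc :: "(nat \<Rightarrow> real) \<Rightarrow> nat \<Rightarrow> real" where
  "xc v j = v j"

definition yc :: "nat \<Rightarrow> (nat \<Rightarrow> real) \<Rightarrow> nat \<Rightarrow> real" where
  "yc r v j = v (r + j)"

definition zc :: "nat \<Rightarrow> nat \<Rightarrow> (nat \<Rightarrow> real) \<Rightarrow> nat \<Rightarrow> real" where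
  "zc r s v j = v (r + s + j)"

definition root_list :: "nat \<Rightarrow> nat \<Rightarrow> (nat \<Rightarrow> real) \<Rightarrow> complex list" where
  "root_list r s v =
     map (\<lambda>j. complex_of_real (xc v j)) [0..<r] @
     concat (map (\<lambda>j. [Complex (yc r v j) (zc r s v j), Complex (yc r v j) (- zc r s v j)]) [0..<s])"

definition Hroots :: "nat \<Rightarrow> nat \<Rightarrow> real \<Rightarrow> (nat \<Rightarrow> real) set" where
  "Hroots d s B = {v \<in> extensional {..<d}.
     (\<forall>j<s. zc (d - 2 * s) s v j \<noteq> 0) \<and>
     (\<forall>j\<in>{1..d}. elem_sym j (root_list (d - 2 * s) s v) \<in> complex_of_real ` {-B..B})}"

definition Rpoly :: "nat \<Rightarrow> nat \<Rightarrow> (nat \<Rightarrow> real) \<Rightarrow> nat \<Rightarrow> real poly" where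
  "Rpoly r s v j = [: (yc r v j)\<^sup>2 + (zc r s v j)\<^sup>2, - 2 * yc r v j, 1 :]"

definition Delta_real :: "nat \<Rightarrow> (nat \<Rightarrow> real) \<Rightarrow> real" where
  "Delta_real r v = (\<Prod>k<r. \<Prod>j<k. xc v j - xc v k)"

definition Delta_cplx :: "nat \<Rightarrow> nat \<Rightarrow> (nat \<Rightarrow> real) \<Rightarrow> real" where
  "Delta_cplx r s v = (\<Prod>k<s. \<Prod>j<k. resultant (Rpoly r s v j) (Rpoly r s v k))"

definition Delta_mixed :: "nat \<Rightarrow> nat \<Rightarrow> (nat \<Rightarrow> real) \<Rightarrow> real" where
  "Delta_mixed r s v = (\<Prod>j<r. \<Prod>k<s. poly (Rpoly r s v k) (xc v j))"

end

theory Submission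
  imports Defs
begin

text \<open>
  The parametrisation of a monic polynomial by its roots is built up one factor at a time, because
  multiplication by a single factor reduces to a change of variables in dimension one or two.
  For fixed \<open>x\<close>, the map from \<open>Q\<close> to the coefficients of \<open>P = (X - x) Q\<close> other than the constant one
  is affine and unitriangular, hence measure preserving; once these coefficients are fixed, \<open>x\<close>
  determines the constant coefficient, with derivative \<open>\<plusminus>P'(x) = \<plusminus>Q(x)\<close>. In the same way, for
  \<open>P = R Q\<close> with \<open>R = X\<^sup>2 - 2yX + y\<^sup>2 + z\<^sup>2\<close> the pair \<open>(y, z)\<close> determines the two lowest coefficients,
  with Jacobian \<open>\<bar>P'(y + iz)\<bar>\<^sup>2 / \<bar>z\<bar> = 4 \<bar>z\<bar> \<bar>Q(y + iz)\<bar>\<^sup>2\<close>. The area formula counts the ways to split off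
  a factor: one for each real root in the first case, two for each pair of conjugate roots in the
  second. Induction on the number of factors yields the constant \<open>r! s! / 2\<^sup>s\<close> and, as Jacobian, the
  product of all the values \<open>\<bar>Q(x)\<bar>\<close>, \<open>\<bar>z\<bar>\<close> and \<open>\<bar>Q(y + iz)\<bar>\<^sup>2\<close>. Only polynomials with simple roots are counted;
  the others form a null set, since for fixed higher coefficients only finitely many constant
  coefficients produce a multiple root. The second formula follows by scaling out the leading
  coefficient.
\<close>

section \<open>An area formula with multiplicity\<close>

text \<open>The identity is proved for an arbitrary nonnegative weight on polynomials, not for a
  set: when a factor is split off, its Jacobian has to be absorbed into the weight of what remains.
  All integrals take values in [0, \<infinity>], so Tonelli and the area formula apply without
  integrability; finiteness is used only for the integral over u, and comes from the bounded
  coefficient box. The area formula asks for a constant number of preimages, so the weight has to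
  fix the number of real roots and to select polynomials with simple roots. Measurability of this
  selection is an obstacle of its own: simplicity is expressed by a lower bound along a dense
  sequence, and the number of real roots by sign changes at rational points. The power of 2 arises
  in the quadratic step: with b + 1 pairs there are 2 (b + 1) choices of y + iz, while P'(y + iz) =
  2iz Q(y + iz) produces 4 |z| where the integrand of the theorem has |z|. Each pair therefore
  contributes (b + 1) / 2.\<close>

lemma nn_integral_change_of_variables_inj:
  fixes f :: "real ^ 'n::{finite,wellorder} \<Rightarrow> real" and g :: "real ^ 'n::_ \<Rightarrow> real ^ 'n::_"
  assumes S: "S \<in> sets borel"
    and der: "\<And>x. x \<in> S \<Longrightarrow> (g has_derivative g' x) (at x)"
    and inj: "inj_on g S"
    and J: "\<And>x. x \<in> S \<Longrightarrow> \<bar>Determinants.det (matrix (g' x))\<bar> = J x"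
    and [measurable]: "J \<in> borel_measurable borel" "g \<in> borel_measurable borel" "f \<in> borel_measurable borel"
    and f: "\<And>y. 0 \<le> f y"
  shows "(\<integral>\<^sup>+x. ennreal (indicator S x * (J x * f (g x))) \<partial>lebesgue) =
         (\<integral>\<^sup>+y. ennreal (indicator (g ` S) y * f y) \<partial>lebesgue)"
proof -
  have SL: "S \<in> sets lebesgue" using S by simp
  note [measurable] = S
  have derS: "\<And>x. x \<in> S \<Longrightarrow> (g has_derivative g' x) (at x within S)"
    using der has_derivative_at_withinI by blast
  have "g differentiable_on S"
    using derS unfolding differentiable_on_def differentiable_def by blast
  \<comment> \<open>Only Lebesgue measurability of the image is at hand, hence
    \<open>lebesgue\<close> on both sides.\<close>
  then have gS: "g ` S \<in> sets lebesgue"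
    by (intro differentiable_image_in_sets_lebesgue SL) auto
  define h where "h x = indicator S x * (J x * f (g x))" for x
  define k where "k y = indicator (g ` S) y * f y" for y
  have J0: "x \<in> S \<Longrightarrow> 0 \<le> J x" for x using J[of x] by (metis abs_ge_zero)
  have h0: "0 \<le> h x" for x unfolding h_def using J0 f by (auto simp: indicator_def)
  have k0: "0 \<le> k y" for y unfolding k_def using f by (auto simp: indicator_def)
  have "h \<in> borel_measurable borel" unfolding h_def by measurable
  then have hm: "h \<in> borel_measurable lebesgue" by (simp add: measurable_completion)
  have fL: "f \<in> borel_measurable lebesgue" by (simp add: measurable_completion)
  have km: "k \<in> borel_measurable lebesgue" unfolding k_def
    using gS fL by measurable
  have vec: "(f absolutely_integrable_on T \<and> integral T f = b) \<longleftrightarrow> (f has_integral b) T"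
    if "\<And>x. x \<in> T \<Longrightarrow> 0 \<le> f x" for f :: "real ^ 'n::_ \<Rightarrow> real" and T b
    using that by (metis absolutely_integrable_on_iff_nonneg has_integral_integrable_integral)
  \<comment> \<open>The change of variables theorem is stated for vector-valued integrands; a real
    function is read as one with values in real^1.\<close>
  have lift: "(f absolutely_integrable_on T \<and> integral T f = b) \<longleftrightarrow>
     ((\<lambda>x. Finite_Cartesian_Product.vec (f x) :: real^1) absolutely_integrable_on T \<and>
       integral T (\<lambda>x. Finite_Cartesian_Product.vec (f x) :: real^1) = Finite_Cartesian_Product.vec b)"
    for f :: "real ^ 'n::_ \<Rightarrow> real" and T b
    by (auto simp: absolutely_integrable_on_1_iff integral_on_1_eq o_def)
  have scale: "c *\<^sub>R (Finite_Cartesian_Product.vec a :: real^1) = Finite_Cartesian_Product.vec (c * a)" for c a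
    by (simp add: Finite_Cartesian_Product.vec_eq_iff)
  have "((\<lambda>x. \<bar>Determinants.det (matrix (g' x))\<bar> * f (g x)) absolutely_integrable_on S \<and>
       integral S (\<lambda>x. \<bar>Determinants.det (matrix (g' x))\<bar> * f (g x)) = b) =
      (f absolutely_integrable_on (g ` S) \<and> integral (g ` S) f = b)" for b
    unfolding lift
    using has_absolute_integral_change_of_variables[OF SL derS inj,
        of "\<lambda>x. Finite_Cartesian_Product.vec (f x) :: real^1" "Finite_Cartesian_Product.vec b"]
    by (simp add: scale)
  then have eq1: "((\<lambda>x. \<bar>Determinants.det (matrix (g' x))\<bar> * f (g x)) has_integral b) S =
      (f has_integral b) (g ` S)" for b
    by (subst (asm) (1 2) vec) (auto simp: f)
  have "((\<lambda>x. \<bar>Determinants.det (matrix (g' x))\<bar> * f (g x)) has_integral b) S = (h has_integral b) UNIV" for b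
    by (subst has_integral_restrict_UNIV[symmetric], rule arg_cong[where f="\<lambda>f. (f has_integral b) UNIV"])
       (auto simp: h_def J fun_eq_iff)
  moreover have "(f has_integral b) (g ` S) = (k has_integral b) UNIV" for b
    by (subst has_integral_restrict_UNIV[symmetric], rule arg_cong[where f="\<lambda>f. (f has_integral b) UNIV"])
       (auto simp: k_def fun_eq_iff)
  ultimately have eq: "(h has_integral b) UNIV = (k has_integral b) UNIV" for b
    using eq1 by simp
  have "(\<integral>\<^sup>+x. ennreal (h x) \<partial>lebesgue) = ennreal b \<longleftrightarrow> (\<integral>\<^sup>+x. ennreal (k x) \<partial>lebesgue) = ennreal b" if "0 \<le> b" for b
    using eq[of b] has_integral_iff_nn_integral_lebesgue[of h b] has_integral_iff_nn_integral_lebesgue[of k b]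
      h0 k0 hm km that by blast
  \<comment> \<open>Agreement at every finite value settles the infinite case too: an integral equal
    to no finite number is infinite.\<close>
  then have "(\<integral>\<^sup>+x. ennreal (h x) \<partial>lebesgue) = (\<integral>\<^sup>+x. ennreal (k x) \<partial>lebesgue)"
    by (metis ennreal_cases)
  then show ?thesis by (simp add: h_def k_def)
qed

text \<open>Injectivity allows at most one preimage of y per piece, and disjointness puts every
  preimage in exactly one piece, so the pieces whose image contains y correspond to the preimages of
  y.\<close>

lemma suminf_indicator_images:
  fixes E :: "nat \<Rightarrow> 'a set"
  assumes disj: "disjoint_family E" and inj: "\<And>k. inj_on g (E k)"
    and fin: "finite {x \<in> (\<Union>k. E k). g x = y}"
  shows "(\<Sum>k. indicator (g ` E k) y :: ennreal) = of_nat (card {x \<in> (\<Union>k. E k). g x = y})"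
proof -
  define X where "X = {x \<in> (\<Union>k. E k). g x = y}"
  define \<kappa> where "\<kappa> x = (SOME k. x \<in> E k)" for x
  have \<kappa>: "x \<in> E (\<kappa> x)" if "x \<in> X" for x
    using that unfolding \<kappa>_def X_def by (metis (no_types, lifting) UN_iff mem_Collect_eq someI_ex)
  have \<kappa>_eq: "\<kappa> x = k" if "x \<in> X" "x \<in> E k" for x k
    using \<kappa>[OF that(1)] that(2) disj unfolding disjoint_family_on_def by blast
  have "inj_on \<kappa> X"
    by (rule inj_onI) (metis (mono_tags, lifting) X_def \<kappa> inj inj_onD mem_Collect_eq)
  moreover have ind: "indicator (g ` E k) y = (if k \<in> \<kappa> ` X then 1 else 0 :: ennreal)" for k
  proof -
    have "y \<in> g ` E k \<longleftrightarrow> k \<in> \<kappa> ` X"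
    proof
      assume "y \<in> g ` E k"
      then obtain x where "x \<in> E k" "g x = y" by blast
      then have "x \<in> X" by (auto simp: X_def)
      then show "k \<in> \<kappa> ` X" using \<kappa>_eq \<open>x \<in> E k\<close> by blast
    next
      assume "k \<in> \<kappa> ` X"
      then obtain x where "x \<in> X" "k = \<kappa> x" by blast
      then show "y \<in> g ` E k" using \<kappa>[of x] by (auto simp: X_def)
    qed
    then show ?thesis by (simp add: indicator_def)
  qed
  moreover have "finite (\<kappa> ` X)" using fin by (simp add: X_def)
  ultimately have "(\<Sum>k. indicator (g ` E k) y :: ennreal) = of_nat (card X)"
    by (subst suminf_finite[of "\<kappa> ` X"]) (auto simp: card_image)
  then show ?thesis by (simp add: X_def)
qed

text \<open>Entrywise continuity of the derivative at a is continuity in operator norm, because that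
  norm is at most the sum of the absolute entries. Together with a left inverse of the derivative at
  a this is what \<open>has_derivative_locally_injective\<close> asks for.\<close>

lemma locally_injective_of_continuous_Jacobian:
  fixes g :: "real ^ 'n \<Rightarrow> real ^ 'n"
  assumes S: "open S" "a \<in> S"
    and der: "\<And>x. x \<in> S \<Longrightarrow> (g has_derivative g' x) (at x)"
    and cont: "\<And>i j. continuous_on S (\<lambda>x. vec_nth (g' x (axis j 1)) i)"
    and det: "Determinants.det (matrix (g' a)) \<noteq> 0"
  obtains r where "r > 0" "ball a r \<subseteq> S" "inj_on g (ball a r)"
proof -
  have lin: "linear (g' x)" if "x \<in> S" for x
    using der[OF that] has_derivative_linear by blast
  have "invertible (matrix (g' a))" using det by (simp add: invertible_det_nz)
  then obtain B where B: "B ** matrix (g' a) = Finite_Cartesian_Product.mat 1" unfolding invertible_def by blast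
  have 1: "bounded_linear ((*v) B)" by (simp add: matrix_vector_mul_bounded_linear)
  have 2: "(*v) B \<circ> g' a = id"
  proof
    fix v
    have "g' a v = matrix (g' a) *v v" using lin[OF S(2)] by (simp add: matrix_works)
    then show "((*v) B \<circ> g' a) v = id v" by (simp add: matrix_vector_mul_assoc B)
  qed
  have 3: "\<exists>d>0. \<forall>x. dist a x < d \<longrightarrow> onorm (\<lambda>v. g' x v - g' a v) < e" if e: "e > 0" for e
  proof -
    let ?s = "\<lambda>x. \<Sum>i\<in>UNIV. \<Sum>j\<in>UNIV. \<bar>vec_nth (g' x (axis j 1)) i - vec_nth (g' a (axis j 1)) i\<bar>"
    have "continuous_on S ?s" by (intro continuous_intros cont)
    then have "isCont ?s a" using S continuous_on_eq_continuous_at by blast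
    then have "\<forall>\<^sub>F x in at a. ?s x < e"
      using e by (auto simp: isCont_def intro!: order_tendstoD(2)[of _ "?s a"])
    moreover have "\<forall>\<^sub>F x in at a. x \<in> S" using S by (simp add: eventually_at_in_open')
    ultimately have "\<forall>\<^sub>F x in at a. x \<in> S \<and> ?s x < e" by eventually_elim auto
    then obtain d where d: "d > 0" "\<And>x. x \<noteq> a \<Longrightarrow> dist x a < d \<Longrightarrow> x \<in> S \<and> ?s x < e"
      unfolding eventually_at by auto
    have "onorm (\<lambda>v. g' x v - g' a v) < e" if x: "dist a x < d" for x
    proof (cases "x = a")
      case True then show ?thesis using e by (simp add: onorm_zero)
    next
      case False
      then have xS: "x \<in> S" "?s x < e" using d(2)[of x] x by (auto simp: dist_commute)
      have "(\<lambda>v. g' x v - g' a v) = (*v) (matrix (g' x) - matrix (g' a))"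
        using lin[OF xS(1)] lin[OF S(2)] by (auto simp: fun_eq_iff matrix_works matrix_vector_mult_diff_rdistrib)
      then have "onorm (\<lambda>v. g' x v - g' a v) \<le> (\<Sum>i\<in>UNIV. \<Sum>j\<in>UNIV. \<bar>vec_nth (vec_nth (matrix (g' x) - matrix (g' a)) i) j\<bar>)"
        by (simp only: onorm_le_matrix_component_sum)
      also have "\<dots> = ?s x" by (simp add: matrix_def)
      finally show ?thesis using xS by simp
    qed
    then show ?thesis using d(1) by blast
  qed
  show thesis
    by (rule has_derivative_locally_injective[OF S(2,1) 1 2 der 3]) (use that in auto)
qed

text \<open>Points with J = 0 contribute nothing on the left and are not counted on the right. The
  other points are covered by balls on which g is injective; Lindelof makes the cover countable, and
  after disjointing it the injective case applies to each piece. The indicators of the images add up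
  to the number of preimages, which is n wherever f is nonzero.\<close>

proposition nn_integral_area_formula:
  fixes f :: "real ^ 'n::{finite,wellorder} \<Rightarrow> real" and g :: "real ^ 'n::_ \<Rightarrow> real ^ 'n::_"
  assumes S: "open S"
    and der: "\<And>x. x \<in> S \<Longrightarrow> (g has_derivative g' x) (at x)"
    and cont: "\<And>i j. continuous_on S (\<lambda>x. vec_nth (g' x (axis j 1)) i)"
    and J: "\<And>x. x \<in> S \<Longrightarrow> \<bar>Determinants.det (matrix (g' x))\<bar> = J x"
    and [measurable]: "J \<in> borel_measurable borel" "g \<in> borel_measurable borel" "f \<in> borel_measurable borel"
    and f: "\<And>y. 0 \<le> f y"
    and fin: "\<And>y. f y \<noteq> 0 \<Longrightarrow> finite {x \<in> S. J x \<noteq> 0 \<and> g x = y}"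
    and card: "\<And>y. f y \<noteq> 0 \<Longrightarrow> card {x \<in> S. J x \<noteq> 0 \<and> g x = y} = n"
  shows "(\<integral>\<^sup>+x. ennreal (indicator S x * (J x * f (g x))) \<partial>lborel) = of_nat n * (\<integral>\<^sup>+y. ennreal (f y) \<partial>lborel)"
proof -
  define T where "T = {x \<in> S. J x \<noteq> 0}"
  have [measurable]: "S \<in> sets borel" using S by simp
  have [measurable]: "T \<in> sets borel" unfolding T_def by measurable
  have "\<exists>r>0. ball a r \<subseteq> S \<and> inj_on g (ball a r)" if "a \<in> T" for a
    by (rule locally_injective_of_continuous_Jacobian[OF S _ der cont, of a])
       (use that J[of a] in \<open>auto simp: T_def\<close>)
  then obtain r where r: "\<And>a. a \<in> T \<Longrightarrow> r a > 0 \<and> ball a (r a) \<subseteq> S \<and> inj_on g (ball a (r a))"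
    by metis
  obtain \<F> where F: "\<F> \<subseteq> (\<lambda>a. ball a (r a)) ` T" "countable \<F>" "\<Union>\<F> = (\<Union>a\<in>T. ball a (r a))"
    by (rule Lindelof[of "(\<lambda>a. ball a (r a)) ` T"]) auto
  \<comment> \<open>The empty set is added so that there is something to enumerate even if T is
    empty.\<close>
  define A where "A = from_nat_into (insert {} \<F>)"
  have rA: "range A = insert {} \<F>" unfolding A_def
    using F(2) by (intro range_from_nat_into) auto
  have Ainj: "inj_on g (A k)" and Aop: "open (A k)" for k
  proof -
    have "A k \<in> insert {} \<F>" using rA by blast
    then have "A k = {} \<or> (\<exists>a\<in>T. A k = ball a (r a))" using F(1) by blast
    then show "inj_on g (A k)" "open (A k)" using r by auto
  qed
  define E where "E k = disjointed A k \<inter> T" for k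
  have [measurable]: "A k \<in> sets borel" for k using Aop by simp
  have [measurable]: "E k \<in> sets borel" for k unfolding E_def disjointed_def by measurable
  have disj: "disjoint_family E"
    using disjoint_family_disjointed[of A] unfolding E_def disjoint_family_on_def by blast
  have sub: "E k \<subseteq> A k" for k unfolding E_def disjointed_def by blast
  have Un: "(\<Union>k. E k) = T"
  proof -
    have "(\<Union>k. A k) = \<Union>\<F>" using rA by simp
    also have "T \<subseteq> \<Union>\<F>" unfolding F(3) using r by auto
    finally have "T \<subseteq> (\<Union>k. disjointed A k)" by (simp add: UN_disjointed_eq)
    then show ?thesis unfolding E_def by blast
  qed
  have inj: "inj_on g (E k)" for k using Ainj sub inj_on_subset by blast
  have gE: "g ` E k \<in> sets lebesgue" for k
  proof (rule differentiable_image_in_sets_lebesgue)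
    show "E k \<in> sets lebesgue" by simp
    have "E k \<subseteq> S" unfolding E_def T_def by blast
    then show "g differentiable_on E k"
      using der unfolding differentiable_on_def differentiable_def
      by (meson has_derivative_at_withinI subsetD)
  qed auto
  have fL: "f \<in> borel_measurable lebesgue" by (simp add: measurable_completion)
  have J0: "x \<in> S \<Longrightarrow> 0 \<le> J x" for x using J[of x] by (metis abs_ge_zero)
  have ind: "ennreal (indicator S x * (J x * f (g x))) = (\<Sum>k. ennreal (indicator (E k) x * (J x * f (g x))))" for x
  proof -
    have "ennreal (indicator (E k) x * (J x * f (g x))) = ennreal (J x * f (g x)) * indicator (E k) x" for k
      by (auto simp: indicator_def)
    then have "(\<Sum>k. ennreal (indicator (E k) x * (J x * f (g x)))) = ennreal (J x * f (g x)) * (\<Sum>k. indicator (E k) x)"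
      by simp
    also have "(\<Sum>k. indicator (E k) x :: ennreal) = indicator (\<Union>k. E k) x"
      by (rule suminf_indicator[OF disj])
    also have "ennreal (J x * f (g x)) * \<dots> = ennreal (indicator S x * (J x * f (g x)))"
      unfolding Un T_def by (auto simp: indicator_def)
    finally show ?thesis by simp
  qed
  have "(\<integral>\<^sup>+x. ennreal (indicator S x * (J x * f (g x))) \<partial>lborel) =
        (\<integral>\<^sup>+x. (\<Sum>k. ennreal (indicator (E k) x * (J x * f (g x)))) \<partial>lborel)"
    by (simp only: ind)
  also have "\<dots> = (\<Sum>k. \<integral>\<^sup>+x. ennreal (indicator (E k) x * (J x * f (g x))) \<partial>lborel)"
    by (rule nn_integral_suminf) measurable
  also have "\<dots> = (\<Sum>k. \<integral>\<^sup>+y. ennreal (indicator (g ` E k) y * f y) \<partial>lebesgue)"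
  proof (rule suminf_cong)
    fix k
    show "(\<integral>\<^sup>+x. ennreal (indicator (E k) x * (J x * f (g x))) \<partial>lborel) =
        (\<integral>\<^sup>+y. ennreal (indicator (g ` E k) y * f y) \<partial>lebesgue)"
      unfolding nn_integral_completion[of lborel "\<lambda>x. ennreal (indicator (E k) x * (J x * f (g x)))", symmetric]
      by (rule nn_integral_change_of_variables_inj[OF \<open>E k \<in> sets borel\<close>])
         (use der J inj f in \<open>auto simp: E_def T_def\<close>)
  qed
  also have "\<dots> = (\<integral>\<^sup>+y. (\<Sum>k. ennreal (indicator (g ` E k) y * f y)) \<partial>lebesgue)"
    using gE fL by (intro nn_integral_suminf[symmetric] measurable_compose[OF _ measurable_ennreal]
        borel_measurable_times borel_measurable_indicator) auto
  also have "\<dots> = (\<integral>\<^sup>+y. of_nat n * ennreal (f y) \<partial>lebesgue)"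
  proof (rule nn_integral_cong)
    fix y
    have "ennreal (indicator (g ` E k) y * f y) = indicator (g ` E k) y * ennreal (f y)" for k
      by (auto simp: indicator_def)
    then have "(\<Sum>k. ennreal (indicator (g ` E k) y * f y)) = (\<Sum>k. indicator (g ` E k) y) * ennreal (f y)"
      by simp
    moreover have "(\<Sum>k. indicator (g ` E k) y :: ennreal) = of_nat n" if "f y \<noteq> 0"
    proof -
      have "{x \<in> (\<Union>k. E k). g x = y} = {x \<in> S. J x \<noteq> 0 \<and> g x = y}" unfolding Un T_def by auto
      then show ?thesis
        using suminf_indicator_images[OF disj inj, of y] fin[OF that] card[OF that] by simp
    qed
    ultimately show "(\<Sum>k. ennreal (indicator (g ` E k) y * f y)) = of_nat n * ennreal (f y)"
      by (cases "f y = 0") auto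
  qed
  also have "\<dots> = (\<integral>\<^sup>+y. of_nat n * ennreal (f y) \<partial>lborel)"
    by (rule nn_integral_completion)
  also have "\<dots> = of_nat n * (\<integral>\<^sup>+y. ennreal (f y) \<partial>lborel)"
    by (rule nn_integral_cmult) measurable
  finally show ?thesis .
qed

section \<open>The area formula in one and two real variables\<close>

lemma Basis_real_1: "(Basis :: (real^1) set) = {axis 1 1}"
  by (auto simp: Basis_vec_def)

lemma Basis_real_2: "(Basis :: (real^2) set) = {axis 1 1, axis 2 1}"
  by (auto simp: Basis_vec_def UNIV_2)

lemma measurable_vec_nth[measurable]: "(\<lambda>x :: real^'n. vec_nth x i) \<in> borel_measurable borel"
  by (intro borel_measurable_continuous_onI continuous_intros)

text \<open>The area formula lives on real^n, while all later integrals are iterated real ones. The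
  two measures agree because they agree on boxes.\<close>

lemma nn_integral_lborel_vec1:
  assumes [measurable]: "f \<in> borel_measurable borel"
  shows "(\<integral>\<^sup>+x. f x \<partial>(lborel :: (real^1) measure)) = (\<integral>\<^sup>+x. f (Finite_Cartesian_Product.vec x) \<partial>lborel)"
proof -
  have m[measurable]: "(Finite_Cartesian_Product.vec :: real \<Rightarrow> real^1) \<in> borel_measurable borel"
    by (intro borel_measurable_continuous_onI linear_continuous_on linear_conv_bounded_linear[THEN iffD1] linear_vec)
  have eq: "(lborel :: (real^1) measure) = distr lborel borel Finite_Cartesian_Product.vec"
  proof (rule lborel_eqI)
    fix l u :: "real^1"
    assume lu: "\<And>b. b \<in> Basis \<Longrightarrow> l \<bullet> b \<le> u \<bullet> b"
    then have "vec_nth l 1 \<le> vec_nth u 1" by (auto simp: Basis_real_1 inner_axis)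
    moreover have "(Finite_Cartesian_Product.vec :: real \<Rightarrow> real^1) -` box l u = box (vec_nth l 1) (vec_nth u 1)"
      by (auto simp: mem_box Basis_real_1 inner_axis)
    ultimately show "emeasure (distr lborel borel Finite_Cartesian_Product.vec) (box l u) = (\<Prod>b\<in>Basis. (u - l) \<bullet> b)"
      by (subst emeasure_distr) (auto simp: Basis_real_1 inner_axis inner_diff_left)
  qed simp
  show ?thesis unfolding eq by (subst nn_integral_distr) auto
qed

lemma nn_integral_lborel_vec2:
  assumes [measurable]: "f \<in> borel_measurable borel"
  shows "(\<integral>\<^sup>+x. f x \<partial>(lborel :: (real^2) measure)) =
    (\<integral>\<^sup>+a. \<integral>\<^sup>+b. f (a *\<^sub>R axis 1 1 + b *\<^sub>R axis 2 1) \<partial>lborel \<partial>lborel)"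
proof -
  let ?h = "\<lambda>(a, b). a *\<^sub>R axis 1 1 + b *\<^sub>R axis 2 1 :: real^2"
  have m: "?h \<in> borel_measurable borel"
    unfolding case_prod_beta by (intro borel_measurable_continuous_onI continuous_intros)
  then have m[measurable]: "?h \<in> borel_measurable (lborel \<Otimes>\<^sub>M lborel)"
    by (simp add: lborel_prod)
  have [simp]: "axis 1 1 \<noteq> (axis 2 1 :: real^2)"
    by (simp add: axis_eq_axis)
  have nth: "vec_nth (axis 1 1 :: real^2) 1 = (1 :: real)" "vec_nth (axis 1 1 :: real^2) 2 = (0 :: real)"
    "vec_nth (axis 2 1 :: real^2) 1 = (0 :: real)" "vec_nth (axis 2 1 :: real^2) 2 = (1 :: real)"
    by (auto simp: axis_def)
  have eq: "(lborel :: (real^2) measure) = distr (lborel \<Otimes>\<^sub>M lborel) borel ?h"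
  proof (rule lborel_eqI)
    fix l u :: "real^2"
    assume lu: "\<And>b. b \<in> Basis \<Longrightarrow> l \<bullet> b \<le> u \<bullet> b"
    then have le: "vec_nth l 1 \<le> vec_nth u 1" "vec_nth l 2 \<le> vec_nth u 2"
      using lu[of "axis 1 1"] lu[of "axis 2 1"] by (auto simp: Basis_real_2 inner_axis)
    have vi: "?h -` box l u = box (vec_nth l 1) (vec_nth u 1) \<times> box (vec_nth l 2) (vec_nth u 2)"
      by (auto simp: mem_box Basis_real_2 inner_axis nth)
    have "emeasure (distr (lborel \<Otimes>\<^sub>M lborel) borel ?h) (box l u)
        = emeasure (lborel \<Otimes>\<^sub>M lborel) (box (vec_nth l 1) (vec_nth u 1) \<times> box (vec_nth l 2) (vec_nth u 2))"
      by (subst emeasure_distr[OF m]) (auto simp: vi space_pair_measure)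
    also have "\<dots> = ennreal (vec_nth u 1 - vec_nth l 1) * ennreal (vec_nth u 2 - vec_nth l 2)"
      using le by (subst lborel.emeasure_pair_measure_Times) auto
    also have "\<dots> = (\<Prod>b\<in>Basis. (u - l) \<bullet> b)"
      using le by (auto simp: Basis_real_2 inner_axis inner_diff_left ennreal_mult)
    finally show "emeasure (distr (lborel \<Otimes>\<^sub>M lborel) borel ?h) (box l u) = (\<Prod>b\<in>Basis. (u - l) \<bullet> b)" .
  qed simp
  have "(\<integral>\<^sup>+x. f x \<partial>(lborel :: (real^2) measure)) = (\<integral>\<^sup>+x. f (?h x) \<partial>(lborel \<Otimes>\<^sub>M lborel))"
    unfolding eq by (subst nn_integral_distr) auto
  also have "\<dots> = (\<integral>\<^sup>+a. \<integral>\<^sup>+b. f (?h (a, b)) \<partial>lborel \<partial>lborel)"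
    by (rule lborel.nn_integral_fst[symmetric]) measurable
  finally show ?thesis by simp
qed

lemma nn_integral_area_formula_real:
  fixes f g g' :: "real \<Rightarrow> real"
  assumes der: "\<And>x. (g has_real_derivative g' x) (at x)"
    and cont: "continuous_on UNIV g'"
    and [measurable]: "f \<in> borel_measurable borel"
    and f: "\<And>y. 0 \<le> f y"
    and fin: "\<And>t. f t \<noteq> 0 \<Longrightarrow> finite {x. g' x \<noteq> 0 \<and> g x = t}"
    and card: "\<And>t. f t \<noteq> 0 \<Longrightarrow> card {x. g' x \<noteq> 0 \<and> g x = t} = n"
  shows "(\<integral>\<^sup>+x. ennreal (\<bar>g' x\<bar> * f (g x)) \<partial>lborel) = of_nat n * (\<integral>\<^sup>+t. ennreal (f t) \<partial>lborel)"
proof -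
  let ?v = "Finite_Cartesian_Product.vec :: real \<Rightarrow> real^1"
  define G where "G x = ?v (g (vec_nth x 1))" for x :: "real^1"
  define G' where "G' x = (\<lambda>h :: real^1. ?v (g' (vec_nth x 1) * vec_nth h 1))" for x :: "real^1"
  define J where "J x = \<bar>g' (vec_nth x 1)\<bar>" for x :: "real^1"
  define F where "F y = f (vec_nth y 1)" for y :: "real^1"
  have blv: "bounded_linear ?v" by (intro linear_conv_bounded_linear[THEN iffD1] linear_vec)
  have cg: "continuous_on UNIV g"
    using der by (meson DERIV_isCont continuous_at_imp_continuous_on)
  note [measurable] = borel_measurable_continuous_onI[OF cont] borel_measurable_continuous_onI[OF cg]
    borel_measurable_continuous_onI[OF linear_continuous_on[OF blv]]
  have inj: "inj ?v" by (rule injI) (simp add: Finite_Cartesian_Product.vec_eq_iff)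
  have pre: "{x \<in> UNIV. J x \<noteq> 0 \<and> G x = y} = ?v ` {x. g' x \<noteq> 0 \<and> g x = vec_nth y 1}" for y
  proof -
    have "x = ?v (vec_nth x 1)" for x by (simp add: Finite_Cartesian_Product.vec_eq_iff)
    then show ?thesis
      by (auto simp: J_def G_def Finite_Cartesian_Product.vec_eq_iff image_iff)
  qed
  have "(\<integral>\<^sup>+x. ennreal (indicator UNIV x * (J x * F (G x))) \<partial>lborel) = of_nat n * (\<integral>\<^sup>+y. ennreal (F y) \<partial>lborel)"
  proof (rule nn_integral_area_formula[where g' = G'])
    fix x :: "real^1"
    have "((\<lambda>x. g (vec_nth x 1)) has_derivative (\<lambda>h. g' (vec_nth x 1) * vec_nth h 1)) (at x)"
      using has_derivative_compose[OF bounded_linear_imp_has_derivative[OF bounded_linear_vec_nth[of "1::1"]],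
          of g "\<lambda>h. g' (vec_nth x 1) * h" x UNIV] der[of "vec_nth x 1"]
      by (simp add: has_field_derivative_def)
    from bounded_linear.has_derivative[OF blv this]
    show "(G has_derivative G' x) (at x)" unfolding G_def G'_def .
    show "\<bar>Determinants.det (matrix (G' x))\<bar> = J x"
      by (simp add: det_1 matrix_def G'_def J_def)
  next
    show "continuous_on UNIV (\<lambda>x. vec_nth (G' x (axis j 1)) i)" for i j :: 1
      unfolding G'_def
      by (simp, intro continuous_intros continuous_on_compose2[OF cont]) auto
    show "J \<in> borel_measurable borel" unfolding J_def by measurable
    show "G \<in> borel_measurable borel" unfolding G_def by measurable
    show "F \<in> borel_measurable borel" unfolding F_def by measurable
    show "0 \<le> F y" for y unfolding F_def by (rule f)
    show "finite {x \<in> UNIV. J x \<noteq> 0 \<and> G x = y}" if "F y \<noteq> 0" for y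
      unfolding pre using that fin by (auto simp: F_def)
    show "card {x \<in> UNIV. J x \<noteq> 0 \<and> G x = y} = n" if "F y \<noteq> 0" for y
      unfolding pre using that card inj by (subst card_image) (auto simp: F_def inj_on_def)
  qed simp
  then show ?thesis
    by (subst (asm) (1 2) nn_integral_lborel_vec1) (auto simp: J_def F_def G_def)
qed

text \<open>
  The map sends \<open>w\<close> to the unique real \<open>(a, b)\<close> with \<open>g w + a * w + b = 0\<close>. Differentiating that
  relation gives \<open>da * w + db = - (g' w + a) * dw\<close>, which explains the Jacobian.
\<close>

lemma nn_integral_area_formula_complex:
  fixes f :: "real \<Rightarrow> real \<Rightarrow> real" and g g' :: "complex \<Rightarrow> complex"
  assumes der: "\<And>w. (g has_field_derivative g' w) (at w)"
    and cont: "continuous_on UNIV g'"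
    and [measurable]: "case_prod f \<in> borel_measurable (borel \<Otimes>\<^sub>M borel)"
    and f: "\<And>a b. 0 \<le> f a b"
    and fin: "\<And>a b. f a b \<noteq> 0 \<Longrightarrow>
        finite {w. Im w \<noteq> 0 \<and> g' w + of_real a \<noteq> 0 \<and> g w + of_real a * w + of_real b = 0}"
    and card: "\<And>a b. f a b \<noteq> 0 \<Longrightarrow>
        card {w. Im w \<noteq> 0 \<and> g' w + of_real a \<noteq> 0 \<and> g w + of_real a * w + of_real b = 0} = n"
  defines "A \<equiv> \<lambda>w. - Im (g w) / Im w"
    and "B \<equiv> \<lambda>w. - Re (g w) + Re w * Im (g w) / Im w"
  shows "(\<integral>\<^sup>+y. \<integral>\<^sup>+z. ennreal ((cmod (g' (Complex y z) + of_real (A (Complex y z))))\<^sup>2 / \<bar>z\<bar>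
            * f (A (Complex y z)) (B (Complex y z))) \<partial>lborel \<partial>lborel)
       = of_nat n * (\<integral>\<^sup>+a. \<integral>\<^sup>+b. ennreal (f a b) \<partial>lborel \<partial>lborel)"
proof -
  define C where "C x = Complex (vec_nth x 1) (vec_nth x 2)" for x :: "real^2"
  have C_alt: "C = (\<lambda>x. of_real (vec_nth x 1) + \<i> * of_real (vec_nth x 2))"
    by (auto simp: C_def complex_eq_iff)
  have dC: "(C has_derivative C) (at x)" for x
    unfolding C_alt
    by (auto intro!: derivative_eq_intros bounded_linear_imp_has_derivative[OF bounded_linear_vec_nth])
  define S where "S = {x :: real^2. vec_nth x 2 \<noteq> 0}"
  define G where "G x = A (C x) *\<^sub>R axis 1 1 + B (C x) *\<^sub>R (axis 2 1 :: real^2)" for x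
  define a' where "a' x h = - Im (g' (C x) * C h) / vec_nth x 2 + Im (g (C x)) * vec_nth h 2 / (vec_nth x 2)\<^sup>2" for x h
  define b' where "b' x h = - Re (g' (C x) * C h) + (vec_nth h 1 * Im (g (C x)) + vec_nth x 1 * Im (g' (C x) * C h)) / vec_nth x 2
      - vec_nth x 1 * Im (g (C x)) * vec_nth h 2 / (vec_nth x 2)\<^sup>2" for x h
  define G' where "G' x = (\<lambda>h. a' x h *\<^sub>R axis 1 1 + b' x h *\<^sub>R (axis 2 1 :: real^2))" for x
  define J where "J x = (cmod (g' (C x) + of_real (A (C x))))\<^sup>2 / \<bar>vec_nth x 2\<bar>" for x
  define F where "F y = f (vec_nth y 1) (vec_nth y 2)" for y :: "real^2"
  have cg: "continuous_on UNIV g"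
    using der by (meson DERIV_isCont continuous_at_imp_continuous_on)
  have cC: "continuous_on X C" for X unfolding C_alt by (intro continuous_intros)
  have cgC: "continuous_on X (\<lambda>x. g (C x))" and cg'C: "continuous_on X (\<lambda>x. g' (C x))" for X
    by (auto intro!: continuous_on_compose2[OF cg] continuous_on_compose2[OF cont] cC)
  note [measurable] = borel_measurable_continuous_onI[OF cgC] borel_measurable_continuous_onI[OF cg'C]
    borel_measurable_continuous_onI[OF cC]
  have [simp]: "(1::2) \<noteq> 2" "(2::2) \<noteq> 1" by auto
  have C_nth[simp]: "Re (C x) = vec_nth x 1" "Im (C x) = vec_nth x 2" for x by (auto simp: C_def)
  have G_nth[simp]: "vec_nth (G x) 1 = A (C x)" "vec_nth (G x) 2 = B (C x)" for x
    by (auto simp: G_def axis_def)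
  have [measurable]: "(\<lambda>x. A (C x)) \<in> borel_measurable borel" "(\<lambda>x. B (C x)) \<in> borel_measurable borel"
    unfolding A_def B_def C_nth by measurable
  have injC: "inj C"
    by (rule injI) (metis (mono_tags) C_nth Finite_Cartesian_Product.vec_eq_iff exhaust_2)
  have surjC: "\<exists>x. w = C x" for w
    by (rule exI[of _ "Re w *\<^sub>R axis 1 1 + Im w *\<^sub>R axis 2 1"]) (auto simp: complex_eq_iff axis_def)
  have AB: "A w = a \<and> B w = b \<longleftrightarrow> g w + of_real a * w + of_real b = 0" if "Im w \<noteq> 0" for w a b
  proof -
    have 1: "A w = a \<longleftrightarrow> Im (g w) + a * Im w = 0" using that by (auto simp: A_def field_simps)
    have 2: "B w = - Re (g w) - a * Re w" if "Im (g w) + a * Im w = 0"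
    proof -
      have "Im (g w) = - a * Im w" using that by linarith
      then show ?thesis using \<open>Im w \<noteq> 0\<close> by (simp add: B_def)
    qed
    have "g w + of_real a * w + of_real b = 0 \<longleftrightarrow> Re (g w) + a * Re w + b = 0 \<and> Im (g w) + a * Im w = 0"
      by (simp add: complex_eq_iff)
    moreover have "B w = b \<longleftrightarrow> Re (g w) + a * Re w + b = 0" if "Im (g w) + a * Im w = 0"
      unfolding 2[OF that] by linarith
    ultimately show ?thesis using 1 by blast
  qed
  \<comment> \<open>Under C, the preimages of (a, b) with nonzero Jacobian are the nonreal roots of
    g w + a w + b at which the derivative g' w + a does not vanish.\<close>
  have pre: "C ` {x \<in> S. J x \<noteq> 0 \<and> G x = y} =
     {w. Im w \<noteq> 0 \<and> g' w + of_real (vec_nth y 1) \<noteq> 0 \<and> g w + of_real (vec_nth y 1) * w + of_real (vec_nth y 2) = 0}" for y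
  proof -
    have *: "x \<in> S \<and> J x \<noteq> 0 \<and> G x = y \<longleftrightarrow> Im (C x) \<noteq> 0 \<and> g' (C x) + of_real (vec_nth y 1) \<noteq> 0 \<and>
        g (C x) + of_real (vec_nth y 1) * C x + of_real (vec_nth y 2) = 0" for x
    proof (cases "x \<in> S")
      case True
      then have i: "Im (C x) \<noteq> 0" by (simp add: S_def)
      have "G x = y \<longleftrightarrow> A (C x) = vec_nth y 1 \<and> B (C x) = vec_nth y 2"
        by (simp add: Finite_Cartesian_Product.vec_eq_iff forall_2)
      moreover have "J x \<noteq> 0 \<longleftrightarrow> g' (C x) + of_real (A (C x)) \<noteq> 0" using i by (simp add: J_def)
      ultimately show ?thesis using AB[OF i] True i by auto
    qed (simp add: S_def)
    show ?thesis
    proof (rule Set.set_eqI)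
      fix w
      obtain x where w: "w = C x" using surjC by blast
      show "w \<in> C ` {x \<in> S. J x \<noteq> 0 \<and> G x = y} \<longleftrightarrow> w \<in> {w. Im w \<noteq> 0 \<and> g' w + of_real (vec_nth y 1) \<noteq> 0 \<and>
          g w + of_real (vec_nth y 1) * w + of_real (vec_nth y 2) = 0}"
        unfolding w inj_image_mem_iff[OF injC] mem_Collect_eq by (rule *)
    qed
  qed
  have area: "(\<integral>\<^sup>+x. ennreal (indicator S x * (J x * F (G x))) \<partial>lborel) = of_nat n * (\<integral>\<^sup>+y. ennreal (F y) \<partial>lborel)"
  proof (rule nn_integral_area_formula[where g' = G'])
    show "open S" unfolding S_def
      by (intro open_Collect_neq continuous_intros)
  next
    fix x assume "x \<in> S"
    then have z: "vec_nth x 2 \<noteq> 0" by (simp add: S_def)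
    have dg: "((\<lambda>x. g (C x)) has_derivative (\<lambda>h. g' (C x) * C h)) (at x)"
      using has_derivative_compose[OF dC, of g "\<lambda>h. g' (C x) * h" x] der[of "C x"]
      by (simp add: has_field_derivative_def)
    note dn = bounded_linear_imp_has_derivative[OF bounded_linear_vec_nth]
    have dA: "((\<lambda>x. A (C x)) has_derivative a' x) (at x)"
      unfolding A_def a'_def C_nth using z
      by (auto intro!: derivative_eq_intros dg dn simp: fun_eq_iff field_simps power2_eq_square)
    have dB: "((\<lambda>x. B (C x)) has_derivative b' x) (at x)"
      unfolding B_def b'_def C_nth using z
      by (auto intro!: derivative_eq_intros dg dn simp: fun_eq_iff field_simps power2_eq_square)
    show "(G has_derivative G' x) (at x)"
      unfolding G_def G'_def by (auto intro!: derivative_eq_intros dA dB)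
    have "Determinants.det (matrix (G' x)) = a' x (axis 1 1) * b' x (axis 2 1) - a' x (axis 2 1) * b' x (axis 1 1)"
      by (simp add: det_2 matrix_def G'_def axis_def)
    also have "\<dots> = - (cmod (g' (C x) + of_real (A (C x))))\<^sup>2 / vec_nth x 2"
    proof -
      have C12: "C (axis 1 1) = 1" "C (axis 2 1) = \<i>" by (auto simp: complex_eq_iff axis_def)
      obtain p q where pq: "g' (C x) = Complex p q" by (cases "g' (C x)")
      obtain u v where uv: "g (C x) = Complex u v" by (cases "g (C x)")
      \<comment> \<open>Writing r for 1 / Im w turns the determinant identity into an identity of
        polynomials.\<close>
      define r where "r = inverse (vec_nth x 2)"
      have e: "a' x (axis 1 1) = - q * r" "a' x (axis 2 1) = - p * r + v * r * r"
        "b' x (axis 1 1) = - p + (v + vec_nth x 1 * q) * r" "b' x (axis 2 1) = q + vec_nth x 1 * p * r - vec_nth x 1 * v * r * r"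
        unfolding a'_def b'_def C12 C_nth pq uv
        by (simp_all add: axis_def divide_inverse power2_eq_square inverse_mult_distrib r_def)
      have n: "(cmod (g' (C x) + of_real (A (C x))))\<^sup>2 = (p - v * r)\<^sup>2 + q\<^sup>2"
      proof -
        have "A (C x) = - v * r" unfolding A_def C_nth uv by (simp add: divide_inverse r_def)
        then show ?thesis unfolding pq cmod_power2 by simp
      qed
      show ?thesis
        unfolding e n divide_inverse r_def[symmetric] by (simp add: power2_eq_square algebra_simps)
    qed
    finally show "\<bar>Determinants.det (matrix (G' x))\<bar> = J x"
      by (simp add: J_def abs_divide)
  next
    have z: "\<forall>x\<in>S. vec_nth x 2 \<noteq> 0" by (simp add: S_def)
    show "continuous_on S (\<lambda>x. vec_nth (G' x (axis j 1)) i)" for i j :: 2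
      unfolding G'_def a'_def b'_def using z
      by (auto intro!: continuous_intros cgC cg'C)
    show "J \<in> borel_measurable borel" unfolding J_def by measurable
    show "G \<in> borel_measurable borel" unfolding G_def by measurable
    show "F \<in> borel_measurable borel" unfolding F_def by measurable
    show "0 \<le> F y" for y unfolding F_def by (rule f)
    show "finite {x \<in> S. J x \<noteq> 0 \<and> G x = y}" if "F y \<noteq> 0" for y
      by (rule finite_imageD[of C]) (use that fin injC in \<open>auto simp: F_def pre intro: inj_on_subset\<close>)
    show "card {x \<in> S. J x \<noteq> 0 \<and> G x = y} = n" if "F y \<noteq> 0" for y
      using card_image[of C "{x \<in> S. J x \<noteq> 0 \<and> G x = y}"] that card injC
      by (auto simp: F_def pre inj_on_subset)
  qed
  \<comment> \<open>Off S the imaginary part is 0, and x / 0 = 0 makes J vanish there as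
    well.\<close>
  have ind: "indicator S x * (J x * F (G x)) = J x * F (G x)" for x
    by (auto simp: S_def J_def indicator_def)
  have [measurable]: "J \<in> borel_measurable borel" unfolding J_def by measurable
  have [measurable]: "G \<in> borel_measurable borel" unfolding G_def by measurable
  have [measurable]: "F \<in> borel_measurable borel" unfolding F_def by measurable
  have "(\<integral>\<^sup>+a. \<integral>\<^sup>+b. ennreal (J (a *\<^sub>R axis 1 1 + b *\<^sub>R axis 2 1) * F (G (a *\<^sub>R axis 1 1 + b *\<^sub>R axis 2 1))) \<partial>lborel \<partial>lborel)
    = of_nat n * (\<integral>\<^sup>+a. \<integral>\<^sup>+b. ennreal (F (a *\<^sub>R axis 1 1 + b *\<^sub>R axis 2 1)) \<partial>lborel \<partial>lborel)"
    using area unfolding ind by (subst (asm) (1 2) nn_integral_lborel_vec2) measurable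
  moreover have "C (a *\<^sub>R axis 1 1 + b *\<^sub>R axis 2 1) = Complex a b" for a b
    by (simp add: complex_eq_iff axis_def)
  ultimately show ?thesis
    by (simp add: J_def F_def axis_def)
qed

section \<open>Multiplying a monic polynomial by a factor\<close>

abbreviation lborel_vec :: "nat set \<Rightarrow> (nat \<Rightarrow> real) measure" where
  "lborel_vec I \<equiv> \<Pi>\<^sub>M i\<in>I. lborel"

lemma product_sigma_finite_lborel: "product_sigma_finite (\<lambda>_. lborel)"
  by unfold_locales

lemmas nn_integral_lborel_vec_insert =
  product_sigma_finite.product_nn_integral_insert[OF product_sigma_finite_lborel]
lemmas nn_integral_lborel_vec_insert_rev =
  product_sigma_finite.product_nn_integral_insert_rev[OF product_sigma_finite_lborel]

lemma sigma_finite_lborel_vec: "finite I \<Longrightarrow> sigma_finite_measure (lborel_vec I)"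
  by (rule product_sigma_finite.sigma_finite[OF product_sigma_finite_lborel])

lemma nn_integral_lborel_vec_lessThan_Suc:
  assumes "f \<in> borel_measurable (lborel_vec {..<Suc m})"
  shows "integral\<^sup>N (lborel_vec {..<Suc m}) f = (\<integral>\<^sup>+v. \<integral>\<^sup>+t. f (v(m := t)) \<partial>lborel \<partial>lborel_vec {..<m})"
  using assms unfolding lessThan_Suc by (intro nn_integral_lborel_vec_insert) auto

lemma nn_integral_lborel_translate:
  fixes c :: real
  assumes "f \<in> borel_measurable borel"
  shows "(\<integral>\<^sup>+y. f (y + c) \<partial>lborel) = (\<integral>\<^sup>+y. f y \<partial>lborel)"
  using nn_integral_real_affine[OF assms, of 1 c] by (simp add: add.commute)

lemma measurable_lborel_vec_upd:
  assumes "f \<in> borel_measurable (lborel_vec {..<Suc m})"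
  shows "(\<lambda>(v, t). f (v(m := t))) \<in> borel_measurable (lborel_vec {..<m} \<Otimes>\<^sub>M lborel)"
proof -
  have "(\<lambda>(v, t). v(m := t)) \<in> lborel_vec {..<m} \<Otimes>\<^sub>M lborel \<rightarrow>\<^sub>M lborel_vec {..<Suc m}"
    unfolding lessThan_Suc by (rule measurable_add_dim)
  from measurable_compose[OF this assms] show ?thesis by (simp add: case_prod_beta)
qed

text \<open>The last coordinate is moved by an amount that depends only on the earlier ones.
  Integrating over it first, translation invariance removes the shift, and the other coordinates
  present the same situation in one dimension less.\<close>

lemma nn_integral_triangular_shear:
  fixes \<phi> :: "nat \<Rightarrow> (nat \<Rightarrow> real) \<Rightarrow> real"
  assumes dep: "\<And>i v w. (\<And>j. j < i \<Longrightarrow> v j = w j) \<Longrightarrow> \<phi> i v = \<phi> i w"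
    and meas: "\<And>i k. i \<le> k \<Longrightarrow> \<phi> i \<in> borel_measurable (lborel_vec {..<k})"
    and h: "h \<in> borel_measurable (lborel_vec {..<m})"
  shows "(\<integral>\<^sup>+v. h (\<lambda>i\<in>{..<m}. v i + \<phi> i v) \<partial>lborel_vec {..<m}) = integral\<^sup>N (lborel_vec {..<m}) h"
  using h
proof (induction m arbitrary: h)
  case 0
  show ?case by (simp add: PiM_empty nn_integral_count_space_finite restrict_def)
next
  case (Suc m)
  define T where "T k v = (\<lambda>i\<in>{..<k}. v i + \<phi> i v)" for k v
  have T[measurable]: "T k \<in> lborel_vec {..<k} \<rightarrow>\<^sub>M lborel_vec {..<k}" for k
    unfolding T_def
  proof (rule measurable_restrict)
    fix i assume i: "i \<in> {..<k}"
    then have [measurable]: "\<phi> i \<in> borel_measurable (lborel_vec {..<k})" by (intro meas) auto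
    show "(\<lambda>v. v i + \<phi> i v) \<in> lborel_vec {..<k} \<rightarrow>\<^sub>M lborel" using i by measurable
  qed
  note hm = measurable_lborel_vec_upd[OF Suc.prems]
  have T_upd: "T (Suc m) (v(m := t)) = (T m v)(m := t + \<phi> m v)" for v t
    unfolding T_def by (auto simp: fun_eq_iff restrict_def intro!: dep)
  have "(\<integral>\<^sup>+v. h (T (Suc m) v) \<partial>lborel_vec {..<Suc m}) =
      (\<integral>\<^sup>+v. \<integral>\<^sup>+t. h ((T m v)(m := t + \<phi> m v)) \<partial>lborel \<partial>lborel_vec {..<m})"
    using Suc.prems by (subst nn_integral_lborel_vec_lessThan_Suc) (auto simp: T_upd intro: measurable_compose[OF T])
  also have "\<dots> = (\<integral>\<^sup>+v. \<integral>\<^sup>+t. h ((T m v)(m := t)) \<partial>lborel \<partial>lborel_vec {..<m})"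
  proof (rule nn_integral_cong)
    fix v assume "v \<in> space (lborel_vec {..<m})"
    then have "T m v \<in> space (lborel_vec {..<m})" by (rule measurable_space[OF T])
    then have "(\<lambda>t. h ((T m v)(m := t))) \<in> borel_measurable lborel"
      using measurable_Pair2[OF hm, of "T m v"] by (simp add: fun_upd_def)
    then show "(\<integral>\<^sup>+t. h ((T m v)(m := t + \<phi> m v)) \<partial>lborel) = (\<integral>\<^sup>+t. h ((T m v)(m := t)) \<partial>lborel)"
      by (intro nn_integral_lborel_translate[where f = "\<lambda>t. h ((T m v)(m := t))"]) simp
  qed
  also have "\<dots> = (\<integral>\<^sup>+v. \<integral>\<^sup>+t. h (v(m := t)) \<partial>lborel \<partial>lborel_vec {..<m})"
    unfolding T_def using hm
    by (intro Suc.IH lborel.borel_measurable_nn_integral)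
  also have "\<dots> = integral\<^sup>N (lborel_vec {..<Suc m}) h"
    using Suc.prems by (rule nn_integral_lborel_vec_lessThan_Suc[symmetric])
  finally show ?case unfolding T_def .
qed

text \<open>Coefficients are listed from the top, so that multiplication by a monic polynomial is triangular.\<close>

definition monic_poly :: "nat \<Rightarrow> (nat \<Rightarrow> real) \<Rightarrow> real poly" where
  "monic_poly d v = monom 1 d + (\<Sum>i<d. monom (v i) (d - 1 - i))"

lemma coeff_monic_poly:
  "coeff (monic_poly d v) j = (if j < d then v (d - 1 - j) else if j = d then 1 else 0)"
proof -
  have "(\<Sum>i<d. coeff (monom (v i) (d - 1 - i)) j) = (\<Sum>i<d. if i = d - 1 - j \<and> j < d then v i else 0)"
    by (rule sum.cong) auto
  also have "\<dots> = (if j < d then v (d - 1 - j) else 0)"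
    by (cases "j < d") auto
  finally show ?thesis by (auto simp: monic_poly_def coeff_sum)
qed

lemma degree_monic_poly[simp]: "degree (monic_poly d v) = d"
  by (intro antisym degree_le le_degree) (auto simp: coeff_monic_poly)

lemma lead_coeff_monic_poly[simp]: "coeff (monic_poly d v) d = 1"
  by (simp add: coeff_monic_poly)

lemma monic_poly_nonzero[simp]: "monic_poly d v \<noteq> 0"
  using lead_coeff_monic_poly[of d v] by (metis coeff_0 zero_neq_one)

lemma monic_poly_cong: "(\<And>i. i < d \<Longrightarrow> v i = w i) \<Longrightarrow> monic_poly d v = monic_poly d w"
  by (simp add: monic_poly_def)

lemma monic_poly_Suc: "monic_poly (Suc m) v = pCons (v m) (monic_poly m v)"
  by (intro poly_eqI) (auto simp: coeff_monic_poly coeff_pCons split: nat.splits)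

lemma monic_poly_Suc_upd: "monic_poly (Suc m) (v(m := t)) = pCons t (monic_poly m v)"
  unfolding monic_poly_Suc by (auto intro!: monic_poly_cong)

lemma monic_poly_coeffs:
  assumes "degree p = d" "lead_coeff p = 1"
  shows "monic_poly d (\<lambda>i\<in>{..<d}. coeff p (d - 1 - i)) = p"
  using assms by (intro poly_eqI) (auto simp: coeff_monic_poly coeff_eq_0)

text \<open>This is v_(i-k), extended by v_(-1) = 1 for the leading coefficient and by 0 before it:
  the coefficient k places above the one with index i when coefficients are listed from the
  top.\<close>

definition lag :: "nat \<Rightarrow> (nat \<Rightarrow> real) \<Rightarrow> nat \<Rightarrow> real" where
  "lag k v i = (if i \<ge> k then v (i - k) else if i + 1 = k then 1 else 0)"

lemma lag_cong: "k > 0 \<Longrightarrow> (\<And>j. j < i \<Longrightarrow> v j = w j) \<Longrightarrow> lag k v i = lag k w i"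
  by (simp add: lag_def)

lemma measurable_lag:
  assumes "k > 0" "i \<le> m"
  shows "(\<lambda>v. lag k v i) \<in> borel_measurable (lborel_vec {..<m})"
proof (cases "i \<ge> k")
  case True
  then have "i - k \<in> {..<m}" using assms by auto
  then show ?thesis using True unfolding lag_def by measurable
qed (auto simp: lag_def)

text \<open>The coefficients of (X - x) Q other than the leading and the constant one, where v lists
  the coefficients of Q.\<close>

definition shear1 :: "nat \<Rightarrow> real \<Rightarrow> (nat \<Rightarrow> real) \<Rightarrow> nat \<Rightarrow> real" where
  "shear1 m x v = (\<lambda>i\<in>{..<m}. v i + (- x * lag 1 v i))"

text \<open>Likewise for (X^2 - 2yX + y^2 + z^2) Q, with the two lowest coefficients left
  out.\<close>

definition shear2 :: "nat \<Rightarrow> real \<Rightarrow> real \<Rightarrow> (nat \<Rightarrow> real) \<Rightarrow> nat \<Rightarrow> real" where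
  "shear2 m y z v = (\<lambda>i\<in>{..<m}. v i + (- 2 * y * lag 1 v i + (y\<^sup>2 + z\<^sup>2) * lag 2 v i))"

lemma linear_times_monic_poly:
  obtains t where "[:-x, 1:] * monic_poly m v = pCons t (monic_poly m (shear1 m x v))"
proof
  show "[:-x, 1:] * monic_poly m v = pCons (- x * coeff (monic_poly m v) 0) (monic_poly m (shear1 m x v))"
    by (intro poly_eqI)
       (auto simp: coeff_pCons coeff_monic_poly shear1_def lag_def algebra_simps Suc_diff_Suc split: nat.splits)
qed

lemma quadratic_times_monic_poly:
  obtains a b where "[:y\<^sup>2 + z\<^sup>2, -2 * y, 1:] * monic_poly m v = pCons b (pCons a (monic_poly m (shear2 m y z v)))"
proof
  let ?p = "monic_poly m v" and ?n = "y\<^sup>2 + z\<^sup>2"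
  show "[:?n, -2 * y, 1:] * ?p =
      pCons (?n * coeff ?p 0) (pCons (?n * coeff ?p 1 - 2 * y * coeff ?p 0) (monic_poly m (shear2 m y z v)))"
  proof (rule poly_eqI)
    fix j
    consider "j = 0" | "j = 1" | k where "j = Suc (Suc k)" by (metis One_nat_def not0_implies_Suc)
    then show "coeff ([:?n, -2 * y, 1:] * ?p) j = coeff (pCons (?n * coeff ?p 0)
      (pCons (?n * coeff ?p 1 - 2 * y * coeff ?p 0) (monic_poly m (shear2 m y z v)))) j"
    proof cases
      case (3 k)
      have L: "coeff ([:?n, -2 * y, 1:] * ?p) j = ?n * coeff ?p (k + 2) - 2 * y * coeff ?p (k + 1) + coeff ?p k"
        by (simp add: 3)
      \<comment> \<open>The cases mark where the three shifted copies of the polynomial reach the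
        leading coefficient and pass beyond it.\<close>
      consider "k + 2 < m" | "k + 2 = m" | "k + 1 = m" | "k \<ge> m" by linarith
      then show ?thesis unfolding L unfolding 3
        by cases (auto simp: coeff_monic_poly shear2_def lag_def algebra_simps eval_nat_numeral Suc_diff_Suc)
    qed (simp_all add: coeff_pCons)
  qed
qed

lemma nn_integral_shear1:
  assumes "h \<in> borel_measurable (lborel_vec {..<m})"
  shows "(\<integral>\<^sup>+v. h (shear1 m x v) \<partial>lborel_vec {..<m}) = integral\<^sup>N (lborel_vec {..<m}) h"
  unfolding shear1_def
proof (rule nn_integral_triangular_shear[where \<phi> = "\<lambda>i v. - x * lag 1 v i", OF _ _ assms])
  fix i and v w :: "nat \<Rightarrow> real" assume "\<And>j. j < i \<Longrightarrow> v j = w j"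
  then show "- x * lag 1 v i = - x * lag 1 w i" using lag_cong[of 1 i v w] by simp
next
  fix i k :: nat assume "i \<le> k"
  then show "(\<lambda>v. - x * lag 1 v i) \<in> borel_measurable (lborel_vec {..<k})"
    by (intro borel_measurable_times borel_measurable_const measurable_lag) auto
qed

lemma nn_integral_shear2:
  assumes "h \<in> borel_measurable (lborel_vec {..<m})"
  shows "(\<integral>\<^sup>+v. h (shear2 m y z v) \<partial>lborel_vec {..<m}) = integral\<^sup>N (lborel_vec {..<m}) h"
  unfolding shear2_def
proof (rule nn_integral_triangular_shear[where \<phi> = "\<lambda>i v. - 2 * y * lag 1 v i + (y\<^sup>2 + z\<^sup>2) * lag 2 v i", OF _ _ assms])
  fix i and v w :: "nat \<Rightarrow> real" assume "\<And>j. j < i \<Longrightarrow> v j = w j"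
  then show "- 2 * y * lag 1 v i + (y\<^sup>2 + z\<^sup>2) * lag 2 v i = - 2 * y * lag 1 w i + (y\<^sup>2 + z\<^sup>2) * lag 2 w i"
    using lag_cong[of 1 i v w] lag_cong[of 2 i v w] by simp
next
  fix i k :: nat assume "i \<le> k"
  then show "(\<lambda>v. - 2 * y * lag 1 v i + (y\<^sup>2 + z\<^sup>2) * lag 2 v i) \<in> borel_measurable (lborel_vec {..<k})"
    by (intro borel_measurable_times borel_measurable_add borel_measurable_const measurable_lag) auto
qed

section \<open>Measurability in the coefficients\<close>

lemma measurable_coeff_monic_poly[measurable]:
  "(\<lambda>v. coeff (monic_poly d v) j) \<in> borel_measurable (lborel_vec {..<d})"
proof (cases "j < d")
  case True
  then have "d - 1 - j \<in> {..<d}" by auto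
  then show ?thesis using True unfolding coeff_monic_poly by measurable
qed (auto simp: coeff_monic_poly)

text \<open>Polynomials carry no sigma-algebra here: a function of monic polynomials counts as
  measurable if it is so in the coefficient vector, and this transports it to every family of monic
  polynomials of degree d with measurable coefficients.\<close>

lemma measurable_poly_fun:
  assumes f: "(\<lambda>v. f (monic_poly d v)) \<in> measurable (lborel_vec {..<d}) N"
    and p: "\<And>j. (\<lambda>\<omega>. coeff (p \<omega>) j) \<in> borel_measurable M"
    and "\<And>\<omega>. \<omega> \<in> space M \<Longrightarrow> degree (p \<omega>) = d" "\<And>\<omega>. \<omega> \<in> space M \<Longrightarrow> lead_coeff (p \<omega>) = 1"
  shows "(\<lambda>\<omega>. f (p \<omega>)) \<in> measurable M N"
proof -
  have "(\<lambda>\<omega>. \<lambda>i\<in>{..<d}. coeff (p \<omega>) (d - 1 - i)) \<in> measurable M (lborel_vec {..<d})"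
    by (rule measurable_restrict) (use p in simp)
  from measurable_compose[OF this f]
  show ?thesis by (rule measurable_cong[THEN iffD1, rotated]) (intro arg_cong[where f = f] monic_poly_coeffs assms)
qed

lemma measurable_coeff_pCons:
  assumes "a \<in> borel_measurable M" "\<And>j. (\<lambda>\<omega>. coeff (p \<omega>) j) \<in> borel_measurable M"
  shows "(\<lambda>\<omega>. coeff (pCons (a \<omega>) (p \<omega>)) j :: real) \<in> borel_measurable M"
  using assms by (cases j) auto

lemma measurable_coeff_mult:
  assumes "\<And>j. (\<lambda>\<omega>. coeff (p \<omega>) j) \<in> borel_measurable M" "\<And>j. (\<lambda>\<omega>. coeff (q \<omega>) j) \<in> borel_measurable M"
  shows "(\<lambda>\<omega>. coeff (p \<omega> * q \<omega>) j :: real) \<in> borel_measurable M"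
  unfolding coeff_mult using assms by measurable

lemma measurable_coeff_prod:
  assumes "\<And>i j. i \<in> I \<Longrightarrow> (\<lambda>\<omega>. coeff (p i \<omega>) j) \<in> borel_measurable M"
  shows "(\<lambda>\<omega>. coeff (\<Prod>i\<in>I. p i \<omega>) j :: real) \<in> borel_measurable M"
  using assms
proof (induction I arbitrary: j rule: infinite_finite_induct)
  case (insert i I)
  then show ?case by (simp add: measurable_coeff_mult)
qed (auto simp: coeff_1)

lemma poly_altdef_le: "degree p \<le> d \<Longrightarrow> poly p x = (\<Sum>i\<le>d. coeff p i * x ^ i)" for p :: "'a::comm_semiring_1 poly"
  by (simp add: poly_altdef sum.mono_neutral_left[of "{..d}" "{..degree p}"] coeff_eq_0)

lemma measurable_poly_bounded:
  assumes "\<And>j. (\<lambda>\<omega>. coeff (p \<omega>) j) \<in> borel_measurable M" "x \<in> borel_measurable M"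
    and "\<And>\<omega>. degree (p \<omega>) \<le> d"
  shows "(\<lambda>\<omega>. poly (p \<omega>) (x \<omega>) :: real) \<in> borel_measurable M"
  unfolding poly_altdef_le[OF assms(3)] using assms(1,2) by measurable

abbreviation ceval :: "real poly \<Rightarrow> complex \<Rightarrow> complex" where
  "ceval p \<equiv> poly (map_poly complex_of_real p)"

lemma ceval_pderiv: "ceval (pderiv p) = poly (pderiv (map_poly complex_of_real p))"
  by (simp add: of_real_hom.map_poly_pderiv)

lemma ceval_pCons: "ceval (pCons a p) w = of_real a + w * ceval p w"
  by (simp only: of_real_hom.map_poly_pCons_hom poly_pCons)

lemma ceval_cnj: "ceval p (cnj w) = cnj (ceval p w)"
  by (induction p) (auto simp: ceval_pCons)

lemma map_poly_of_real_mult: "map_poly complex_of_real (p * q) = map_poly of_real p * map_poly of_real q"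
  by (intro poly_eqI) (simp add: coeff_mult)

lemma ceval_mult: "ceval (p * q) w = ceval p w * ceval q w"
  by (simp add: map_poly_of_real_mult)

lemma ceval_quadratic_self: "ceval [:y\<^sup>2 + z\<^sup>2, -2 * y, 1:] (Complex y z) = 0"
  by (simp add: ceval_pCons complex_eq_iff power2_eq_square algebra_simps)

lemma measurable_ceval_bounded:
  assumes "\<And>j. (\<lambda>\<omega>. coeff (p \<omega>) j) \<in> borel_measurable M" "x \<in> borel_measurable M"
    and "\<And>\<omega>. degree (p \<omega>) \<le> d"
  shows "(\<lambda>\<omega>. ceval (p \<omega>) (x \<omega>)) \<in> borel_measurable M"
proof -
  have [measurable]: "complex_of_real \<in> borel_measurable borel"
    by (intro borel_measurable_continuous_onI continuous_intros)
  have "degree (map_poly complex_of_real (p \<omega>)) \<le> d" for \<omega> using assms(3) by simp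
  then show ?thesis
    unfolding poly_altdef_le[OF \<open>\<And>\<omega>. degree (map_poly complex_of_real (p \<omega>)) \<le> d\<close>] of_real_hom.coeff_map_poly_hom
    using assms(1,2) by measurable
qed

section \<open>Splitting off one linear or quadratic factor\<close>

proposition nn_integral_linear_times_monic_poly:
  fixes f :: "real poly \<Rightarrow> real"
  assumes f: "\<And>p. 0 \<le> f p"
    and fm: "(\<lambda>v. f (monic_poly (Suc m) v)) \<in> borel_measurable (lborel_vec {..<Suc m})"
    and card: "\<And>p. degree p = Suc m \<Longrightarrow> lead_coeff p = 1 \<Longrightarrow> f p \<noteq> 0 \<Longrightarrow>
      card {x. poly (pderiv p) x \<noteq> 0 \<and> poly p x = 0} = n"
  shows "(\<integral>\<^sup>+x. \<integral>\<^sup>+v. ennreal (\<bar>poly (monic_poly m v) x\<bar> * f ([:-x, 1:] * monic_poly m v)) \<partial>lborel_vec {..<m} \<partial>lborel)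
    = of_nat n * (\<integral>\<^sup>+v. ennreal (f (monic_poly (Suc m) v)) \<partial>lborel_vec {..<Suc m})"
proof -
  \<comment> \<open>The constant coefficient that makes x a root, once the higher coefficients w are
    given.\<close>
  define t where "t x w = - x * poly (monic_poly m w) x" for x w
  define P where "P x w = pCons (t x w) (monic_poly m w)" for x w
  define K where "K x w = ennreal (\<bar>poly (pderiv (P x w)) x\<bar> * f (P x w))" for x w
  have coeff_m: "(\<lambda>\<omega>. coeff (monic_poly m (W \<omega>)) j) \<in> borel_measurable M"
    if "W \<in> M \<rightarrow>\<^sub>M lborel_vec {..<m}" for M j and W :: "'a \<Rightarrow> nat \<Rightarrow> real"
    using measurable_compose[OF that measurable_coeff_monic_poly] .
  have fpc: "(\<lambda>\<omega>. f (pCons (T \<omega>) (monic_poly m (W \<omega>)))) \<in> borel_measurable M"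
    if "W \<in> M \<rightarrow>\<^sub>M lborel_vec {..<m}" "T \<in> borel_measurable M" for M T and W :: "'a \<Rightarrow> nat \<Rightarrow> real"
    by (rule measurable_poly_fun[OF fm]) (use that in \<open>auto intro: measurable_coeff_pCons coeff_m\<close>)
  have K_meas: "(\<lambda>\<omega>. K (X \<omega>) (W \<omega>)) \<in> borel_measurable M"
    if [measurable]: "X \<in> borel_measurable M" "W \<in> M \<rightarrow>\<^sub>M lborel_vec {..<m}"
    for M X and W :: "'a \<Rightarrow> nat \<Rightarrow> real"
  proof -
    have [measurable]: "(\<lambda>\<omega>. t (X \<omega>) (W \<omega>)) \<in> borel_measurable M"
      unfolding t_def by (intro borel_measurable_times measurable_poly_bounded[where d = m] coeff_m) auto
    have [measurable]: "(\<lambda>\<omega>. f (P (X \<omega>) (W \<omega>))) \<in> borel_measurable M"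
      unfolding P_def by (rule fpc) measurable
    have "(\<lambda>\<omega>. coeff (pderiv (P (X \<omega>) (W \<omega>))) j) \<in> borel_measurable M" for j
      unfolding P_def coeff_pderiv
      by (intro borel_measurable_times borel_measurable_const measurable_coeff_pCons coeff_m) measurable
    then have [measurable]: "(\<lambda>\<omega>. poly (pderiv (P (X \<omega>) (W \<omega>))) (X \<omega>)) \<in> borel_measurable M"
      by (rule measurable_poly_bounded[where d = "Suc m"]) (auto simp: P_def degree_pderiv)
    show ?thesis unfolding K_def by measurable
  qed
  have psf: "pair_sigma_finite lborel (lborel_vec {..<m})"
    by (simp add: pair_sigma_finite_def sigma_finite_lborel_vec lborel.sigma_finite_measure_axioms)
  have K2: "(\<lambda>(x, w). K x w) \<in> borel_measurable (lborel \<Otimes>\<^sub>M lborel_vec {..<m})"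
    using K_meas[of fst "lborel \<Otimes>\<^sub>M lborel_vec {..<m}" snd] by (simp add: case_prod_beta')
  have eq: "ennreal (\<bar>poly (monic_poly m v) x\<bar> * f ([:-x, 1:] * monic_poly m v)) = K x (shear1 m x v)" for x v
  proof -
    obtain c where c: "[:-x, 1:] * monic_poly m v = pCons c (monic_poly m (shear1 m x v))"
      by (rule linear_times_monic_poly)
    have "poly (pCons c (monic_poly m (shear1 m x v))) x = 0" unfolding c[symmetric] by simp
    then have "c = t x (shear1 m x v)" by (simp add: t_def)
    then have P: "[:-x, 1:] * monic_poly m v = P x (shear1 m x v)" using c by (simp add: P_def)
    \<comment> \<open>For P = (X - x) Q one has P' = Q + (X - x) Q', so the Jacobian Q(x) is P'(x),
      a function of x and w.\<close>
    have "poly (pderiv ([:-x, 1:] * monic_poly m v)) x = poly (monic_poly m v) x"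
      unfolding pderiv_mult by (simp add: pderiv_pCons)
    then show ?thesis unfolding K_def P by simp
  qed
  have "(\<integral>\<^sup>+x. \<integral>\<^sup>+v. K x (shear1 m x v) \<partial>lborel_vec {..<m} \<partial>lborel) = (\<integral>\<^sup>+x. \<integral>\<^sup>+w. K x w \<partial>lborel_vec {..<m} \<partial>lborel)"
    by (intro nn_integral_cong nn_integral_shear1 K_meas) auto
  also have "\<dots> = (\<integral>\<^sup>+w. \<integral>\<^sup>+x. K x w \<partial>lborel \<partial>lborel_vec {..<m})"
    by (rule pair_sigma_finite.Fubini'[OF psf, symmetric]) (rule K2)
  also have "\<dots> = (\<integral>\<^sup>+w. of_nat n * (\<integral>\<^sup>+s. ennreal (f (pCons s (monic_poly m w))) \<partial>lborel) \<partial>lborel_vec {..<m})"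
  proof (rule nn_integral_cong)
    fix w assume w: "w \<in> space (lborel_vec {..<m})"
    let ?q = "monic_poly m w"
    \<comment> \<open>P' does not depend on the constant coefficient. Hence - P'(x) is the
      derivative of \<open>t x w\<close> in x, and the preimages of s at which it is nonzero are the
      simple real roots of \<open>pCons s ?q\<close>.\<close>
    have pd: "pderiv (pCons s ?q) = pderiv (pCons 0 ?q)" for s by (simp add: pderiv_pCons)
    have set_eq: "{x. - poly (pderiv (pCons 0 ?q)) x \<noteq> 0 \<and> t x w = s} =
      {x. poly (pderiv (pCons s ?q)) x \<noteq> 0 \<and> poly (pCons s ?q) x = 0}" for s
      unfolding pd[of s] by (auto simp: t_def)
    have "(\<integral>\<^sup>+x. ennreal (\<bar>- poly (pderiv (pCons 0 ?q)) x\<bar> * f (pCons (t x w) ?q)) \<partial>lborel) =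
        of_nat n * (\<integral>\<^sup>+s. ennreal (f (pCons s ?q)) \<partial>lborel)"
    proof (rule nn_integral_area_formula_real[where g = "\<lambda>x. t x w" and f = "\<lambda>s. f (pCons s ?q)"])
      fix x
      have "t = (\<lambda>x w. - poly (pCons 0 (monic_poly m w)) x)" by (simp add: t_def fun_eq_iff)
      then show "((\<lambda>x. t x w) has_real_derivative - poly (pderiv (pCons 0 ?q)) x) (at x)"
        by (simp only:) (intro DERIV_minus poly_DERIV)
    next
      show "continuous_on UNIV (\<lambda>x. - poly (pderiv (pCons 0 ?q)) x)" by (intro continuous_intros)
      show "(\<lambda>s. f (pCons s ?q)) \<in> borel_measurable borel"
        by (rule fpc[of "\<lambda>_. w"]) (use w in auto)
      show "0 \<le> f (pCons s ?q)" for s by (rule f)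
      fix s assume s: "f (pCons s ?q) \<noteq> 0"
      show "finite {x. - poly (pderiv (pCons 0 ?q)) x \<noteq> 0 \<and> t x w = s}"
        unfolding set_eq using poly_roots_finite[of "pCons s ?q"] by (auto intro: rev_finite_subset)
      show "card {x. - poly (pderiv (pCons 0 ?q)) x \<noteq> 0 \<and> t x w = s} = n"
        unfolding set_eq by (rule card) (use s in auto)
    qed
    then show "(\<integral>\<^sup>+x. K x w \<partial>lborel) = of_nat n * (\<integral>\<^sup>+s. ennreal (f (pCons s ?q)) \<partial>lborel)"
      by (simp add: K_def P_def pd[of "t _ w"])
  qed
  also have "\<dots> = of_nat n * (\<integral>\<^sup>+w. \<integral>\<^sup>+s. ennreal (f (pCons s (monic_poly m w))) \<partial>lborel \<partial>lborel_vec {..<m})"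
  proof (rule nn_integral_cmult, rule lborel.borel_measurable_nn_integral)
    show "(\<lambda>(w, s). ennreal (f (pCons s (monic_poly m w)))) \<in> borel_measurable (lborel_vec {..<m} \<Otimes>\<^sub>M lborel)"
      using fpc[of fst "lborel_vec {..<m} \<Otimes>\<^sub>M lborel" snd] by (simp add: case_prod_beta')
  qed
  also have "(\<integral>\<^sup>+w. \<integral>\<^sup>+s. ennreal (f (pCons s (monic_poly m w))) \<partial>lborel \<partial>lborel_vec {..<m}) =
      (\<integral>\<^sup>+v. ennreal (f (monic_poly (Suc m) v)) \<partial>lborel_vec {..<Suc m})"
    by (subst nn_integral_lborel_vec_lessThan_Suc) (use fm in \<open>auto simp: monic_poly_Suc_upd\<close>)
  finally show ?thesis unfolding eq .
qed

proposition nn_integral_quadratic_times_monic_poly: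
  fixes f :: "real poly \<Rightarrow> real"
  assumes f: "\<And>p. 0 \<le> f p"
    and fm: "(\<lambda>v. f (monic_poly (Suc (Suc m)) v)) \<in> borel_measurable (lborel_vec {..<Suc (Suc m)})"
    and card: "\<And>p. degree p = Suc (Suc m) \<Longrightarrow> lead_coeff p = 1 \<Longrightarrow> f p \<noteq> 0 \<Longrightarrow>
      card {w. Im w \<noteq> 0 \<and> ceval (pderiv p) w \<noteq> 0 \<and> ceval p w = 0} = n"
  shows "(\<integral>\<^sup>+y. \<integral>\<^sup>+z. \<integral>\<^sup>+v. ennreal (4 * \<bar>z\<bar> * (cmod (ceval (monic_poly m v) (Complex y z)))\<^sup>2 *
        f ([:y\<^sup>2 + z\<^sup>2, -2 * y, 1:] * monic_poly m v)) \<partial>lborel_vec {..<m} \<partial>lborel \<partial>lborel)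
    = of_nat n * (\<integral>\<^sup>+v. ennreal (f (monic_poly (Suc (Suc m)) v)) \<partial>lborel_vec {..<Suc (Suc m)})"
proof -
  define g where "g w = ceval (pCons 0 (pCons 0 (monic_poly m w)))" for w
  define A where "A w W = - Im (g w W) / Im W" for w W
  define B where "B w W = - Re (g w W) + Re W * Im (g w W) / Im W" for w W
  define P where "P y z w = pCons (B w (Complex y z)) (pCons (A w (Complex y z)) (monic_poly m w))" for y z w
  define K where "K y z w = ennreal ((cmod (ceval (pderiv (P y z w)) (Complex y z)))\<^sup>2 / \<bar>z\<bar> * f (P y z w))" for y z w
  have coeff_m: "(\<lambda>\<omega>. coeff (monic_poly m (W \<omega>)) j) \<in> borel_measurable M"
    if "W \<in> M \<rightarrow>\<^sub>M lborel_vec {..<m}" for M j and W :: "'a \<Rightarrow> nat \<Rightarrow> real"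
    using measurable_compose[OF that measurable_coeff_monic_poly] .
  have fpc: "(\<lambda>\<omega>. f (pCons (S \<omega>) (pCons (T \<omega>) (monic_poly m (W \<omega>))))) \<in> borel_measurable M"
    if "W \<in> M \<rightarrow>\<^sub>M lborel_vec {..<m}" "T \<in> borel_measurable M" "S \<in> borel_measurable M"
    for M S T and W :: "'a \<Rightarrow> nat \<Rightarrow> real"
    by (rule measurable_poly_fun[OF fm]) (use that in \<open>auto intro!: measurable_coeff_pCons coeff_m\<close>)
  have K_meas: "(\<lambda>\<omega>. K (Y \<omega>) (Z \<omega>) (W \<omega>)) \<in> borel_measurable M"
    if [measurable]: "Y \<in> borel_measurable M" "Z \<in> borel_measurable M" "W \<in> M \<rightarrow>\<^sub>M lborel_vec {..<m}"
    for M Y Z and W :: "'a \<Rightarrow> nat \<Rightarrow> real"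
  proof -
    have [measurable]: "complex_of_real \<in> borel_measurable borel"
      by (intro borel_measurable_continuous_onI continuous_intros)
    have [measurable]: "(\<lambda>\<omega>. Complex (Y \<omega>) (Z \<omega>)) \<in> borel_measurable M"
      using that(1,2) by (simp add: borel_measurable_complex_iff)
    have [measurable]: "(\<lambda>\<omega>. g (W \<omega>) (Complex (Y \<omega>) (Z \<omega>))) \<in> borel_measurable M"
      unfolding g_def by (intro measurable_ceval_bounded[where d = "Suc (Suc m)"] measurable_coeff_pCons coeff_m) auto
    have [measurable]: "(\<lambda>\<omega>. A (W \<omega>) (Complex (Y \<omega>) (Z \<omega>))) \<in> borel_measurable M"
      "(\<lambda>\<omega>. B (W \<omega>) (Complex (Y \<omega>) (Z \<omega>))) \<in> borel_measurable M"
      unfolding A_def B_def by measurable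
    have [measurable]: "(\<lambda>\<omega>. f (P (Y \<omega>) (Z \<omega>) (W \<omega>))) \<in> borel_measurable M"
      unfolding P_def by (rule fpc) measurable
    have "(\<lambda>\<omega>. coeff (pderiv (P (Y \<omega>) (Z \<omega>) (W \<omega>))) j) \<in> borel_measurable M" for j
      unfolding P_def coeff_pderiv
      by (intro borel_measurable_times borel_measurable_const measurable_coeff_pCons coeff_m) measurable
    then have [measurable]: "(\<lambda>\<omega>. ceval (pderiv (P (Y \<omega>) (Z \<omega>) (W \<omega>))) (Complex (Y \<omega>) (Z \<omega>))) \<in> borel_measurable M"
      by (rule measurable_ceval_bounded[where d = "Suc (Suc m)"]) (auto simp: P_def degree_pderiv)
    show ?thesis unfolding K_def by measurable
  qed
  \<comment> \<open>For z = 0 both sides vanish, the right one because division by 0 yields 0.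
    Otherwise the real and imaginary parts of P(y + iz) = 0 recover a and b from w.\<close>
  have eq: "ennreal (4 * \<bar>z\<bar> * (cmod (ceval (monic_poly m v) (Complex y z)))\<^sup>2 *
        f ([:y\<^sup>2 + z\<^sup>2, -2 * y, 1:] * monic_poly m v)) = K y z (shear2 m y z v)" for y z v
  proof (cases "z = 0")
    case False
    let ?w = "shear2 m y z v" and ?W = "Complex y z" and ?R = "[:y\<^sup>2 + z\<^sup>2, -2 * y, 1:]"
    obtain a b where ab: "?R * monic_poly m v = pCons b (pCons a (monic_poly m ?w))"
      by (rule quadratic_times_monic_poly)
    have "ceval (pCons b (pCons a (monic_poly m ?w))) ?W = 0"
      unfolding ab[symmetric] ceval_mult ceval_quadratic_self by simp
    then have "of_real b + ?W * of_real a + g ?w ?W = 0"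
      by (simp add: g_def ceval_pCons algebra_simps)
    then have re: "b + y * a + Re (g ?w ?W) = 0" and im: "z * a + Im (g ?w ?W) = 0"
      by (simp_all add: complex_eq_iff)
    have a: "a = A ?w ?W" using im False by (simp add: A_def field_simps)
    have "Im (g ?w ?W) = - a * z" using im by (simp add: algebra_simps)
    then have "B ?w ?W = - Re (g ?w ?W) - y * a" using False by (simp add: B_def)
    then have b: "b = B ?w ?W" using re by linarith
    have P: "?R * monic_poly m v = P y z ?w" using ab a b by (simp add: P_def)
    \<comment> \<open>R vanishes at y + iz and R' equals 2iz there, so |P'|^2 / |z| = 4 |z|
      |Q|^2.\<close>
    have "ceval (pderiv (?R * monic_poly m v)) ?W = ceval (pderiv ?R) ?W * ceval (monic_poly m v) ?W"
      unfolding pderiv_mult of_real_hom.map_poly_hom_add poly_add ceval_mult ceval_quadratic_self by simp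
    also have "ceval (pderiv ?R) ?W = \<i> * of_real (2 * z)"
      by (simp add: pderiv_pCons ceval_pCons complex_eq_iff)
    finally have "(cmod (ceval (pderiv (P y z ?w)) ?W))\<^sup>2 = 4 * z\<^sup>2 * (cmod (ceval (monic_poly m v) ?W))\<^sup>2"
      unfolding P by (simp add: norm_mult power_mult_distrib)
    then have "(cmod (ceval (pderiv (P y z ?w)) ?W))\<^sup>2 / \<bar>z\<bar> = 4 * \<bar>z\<bar> * (cmod (ceval (monic_poly m v) ?W))\<^sup>2"
      using False by (simp add: power2_eq_square field_simps abs_mult_self_eq)
    then show ?thesis unfolding K_def P by simp
  qed (simp add: K_def)
  have psf: "pair_sigma_finite lborel (lborel_vec {..<m})"
    by (simp add: pair_sigma_finite_def sigma_finite_lborel_vec lborel.sigma_finite_measure_axioms)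
  \<comment> \<open>The higher coefficients w have to move outside z and then outside y, so that (y,
    z) is integrated while they are fixed.\<close>
  have swap: "(\<integral>\<^sup>+z. \<integral>\<^sup>+w. K y z w \<partial>lborel_vec {..<m} \<partial>lborel) = (\<integral>\<^sup>+w. \<integral>\<^sup>+z. K y z w \<partial>lborel \<partial>lborel_vec {..<m})" for y
  proof (rule pair_sigma_finite.Fubini'[OF psf, symmetric])
    show "(\<lambda>(z, w). K y z w) \<in> borel_measurable (lborel \<Otimes>\<^sub>M lborel_vec {..<m})"
      using K_meas[of "\<lambda>_. y" "lborel \<Otimes>\<^sub>M lborel_vec {..<m}" fst snd] by (simp add: case_prod_beta')
  qed
  have "(\<integral>\<^sup>+y. \<integral>\<^sup>+z. \<integral>\<^sup>+v. K y z (shear2 m y z v) \<partial>lborel_vec {..<m} \<partial>lborel \<partial>lborel) =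
      (\<integral>\<^sup>+y. \<integral>\<^sup>+z. \<integral>\<^sup>+w. K y z w \<partial>lborel_vec {..<m} \<partial>lborel \<partial>lborel)"
    by (intro nn_integral_cong nn_integral_shear2 K_meas) auto
  also have "\<dots> = (\<integral>\<^sup>+w. \<integral>\<^sup>+y. \<integral>\<^sup>+z. K y z w \<partial>lborel \<partial>lborel \<partial>lborel_vec {..<m})"
    unfolding swap
  proof (rule pair_sigma_finite.Fubini'[OF psf, symmetric])
    have "(\<lambda>(x, z). K (fst x) z (snd x)) \<in> borel_measurable ((lborel \<Otimes>\<^sub>M lborel_vec {..<m}) \<Otimes>\<^sub>M lborel)"
      using K_meas[of "\<lambda>(x, z). fst x" "(lborel \<Otimes>\<^sub>M lborel_vec {..<m}) \<Otimes>\<^sub>M lborel" snd "\<lambda>(x, z). snd x"]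
      by (simp add: case_prod_beta')
    from lborel.borel_measurable_nn_integral[OF this]
    show "(\<lambda>(y, w). \<integral>\<^sup>+z. K y z w \<partial>lborel) \<in> borel_measurable (lborel \<Otimes>\<^sub>M lborel_vec {..<m})"
      by (simp add: case_prod_beta')
  qed
  also have "\<dots> = (\<integral>\<^sup>+w. of_nat n * (\<integral>\<^sup>+a. \<integral>\<^sup>+b. ennreal (f (pCons b (pCons a (monic_poly m w)))) \<partial>lborel \<partial>lborel) \<partial>lborel_vec {..<m})"
  proof (rule nn_integral_cong)
    fix w assume w: "w \<in> space (lborel_vec {..<m})"
    let ?q = "monic_poly m w"
    define g' where "g' = ceval (pderiv (pCons 0 (pCons 0 ?q)))"
    \<comment> \<open>Of the two lowest coefficients only a reaches P', as an additive
      constant.\<close>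
    have pd: "ceval (pderiv (pCons b (pCons a ?q))) W = g' W + of_real a" for a b W
      unfolding g'_def by (simp add: pderiv_pCons of_real_hom.map_poly_hom_add ceval_pCons)
    have gq: "ceval (pCons b (pCons a ?q)) W = g w W + of_real a * W + of_real b" for a b W
      by (simp add: g_def ceval_pCons algebra_simps)
    have card': "finite {W. Im W \<noteq> 0 \<and> g' W + of_real a \<noteq> 0 \<and> g w W + of_real a * W + of_real b = 0} \<and>
        card {W. Im W \<noteq> 0 \<and> g' W + of_real a \<noteq> 0 \<and> g w W + of_real a * W + of_real b = 0} = n"
      if "f (pCons b (pCons a ?q)) \<noteq> 0" for a b
    proof -
      let ?p = "pCons b (pCons a ?q)"
      have "map_poly complex_of_real ?p \<noteq> 0" by simp
      then have "finite {W. Im W \<noteq> 0 \<and> ceval (pderiv ?p) W \<noteq> 0 \<and> ceval ?p W = 0}"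
        using poly_roots_finite[of "map_poly complex_of_real ?p"] by (auto intro: rev_finite_subset)
      moreover have "card {W. Im W \<noteq> 0 \<and> ceval (pderiv ?p) W \<noteq> 0 \<and> ceval ?p W = 0} = n"
        by (rule card) (use that in auto)
      ultimately show ?thesis unfolding pd gq by simp
    qed
    have "(\<integral>\<^sup>+y. \<integral>\<^sup>+z. ennreal ((cmod (g' (Complex y z) + of_real (- Im (g w (Complex y z)) / Im (Complex y z))))\<^sup>2 / \<bar>z\<bar>
            * f (pCons (- Re (g w (Complex y z)) + Re (Complex y z) * Im (g w (Complex y z)) / Im (Complex y z))
                  (pCons (- Im (g w (Complex y z)) / Im (Complex y z)) ?q))) \<partial>lborel \<partial>lborel) =
        of_nat n * (\<integral>\<^sup>+a. \<integral>\<^sup>+b. ennreal (f (pCons b (pCons a ?q))) \<partial>lborel \<partial>lborel)"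
    proof (rule nn_integral_area_formula_complex[where f = "\<lambda>a b. f (pCons b (pCons a ?q))"])
      show "(g w has_field_derivative g' W) (at W)" for W
        unfolding g_def g'_def ceval_pderiv by (rule poly_DERIV)
      show "continuous_on UNIV g'" unfolding g'_def by (intro continuous_intros)
      show "(\<lambda>(a, b). f (pCons b (pCons a ?q))) \<in> borel_measurable (borel \<Otimes>\<^sub>M borel)"
        unfolding case_prod_beta by (rule fpc[of "\<lambda>_. w"]) (use w in auto)
      show "0 \<le> f (pCons b (pCons a ?q))" for a b by (rule f)
    qed (use card' in blast)+
    then show "(\<integral>\<^sup>+y. \<integral>\<^sup>+z. K y z w \<partial>lborel \<partial>lborel) = of_nat n * (\<integral>\<^sup>+a. \<integral>\<^sup>+b. ennreal (f (pCons b (pCons a ?q))) \<partial>lborel \<partial>lborel)"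
      unfolding K_def P_def pd by (simp add: A_def B_def)
  qed
  also have "\<dots> = of_nat n * (\<integral>\<^sup>+w. \<integral>\<^sup>+a. \<integral>\<^sup>+b. ennreal (f (pCons b (pCons a (monic_poly m w)))) \<partial>lborel \<partial>lborel \<partial>lborel_vec {..<m})"
  proof (rule nn_integral_cmult)
    have "(\<lambda>(x, b). ennreal (f (pCons b (pCons (snd x) (monic_poly m (fst x))))))
        \<in> borel_measurable ((lborel_vec {..<m} \<Otimes>\<^sub>M lborel) \<Otimes>\<^sub>M lborel)"
      using fpc[of "\<lambda>(x, z). fst x" "(lborel_vec {..<m} \<Otimes>\<^sub>M lborel) \<Otimes>\<^sub>M lborel" "\<lambda>(x, z). snd x" snd]
      by (simp add: case_prod_beta')
    from lborel.borel_measurable_nn_integral[OF this]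
    have "(\<lambda>(w, a). \<integral>\<^sup>+b. ennreal (f (pCons b (pCons a (monic_poly m w)))) \<partial>lborel)
        \<in> borel_measurable (lborel_vec {..<m} \<Otimes>\<^sub>M lborel)"
      by (simp add: case_prod_beta')
    then show "(\<lambda>w. \<integral>\<^sup>+a. \<integral>\<^sup>+b. ennreal (f (pCons b (pCons a (monic_poly m w)))) \<partial>lborel \<partial>lborel)
        \<in> borel_measurable (lborel_vec {..<m})"
      by (rule lborel.borel_measurable_nn_integral)
  qed
  also have "(\<integral>\<^sup>+w. \<integral>\<^sup>+a. \<integral>\<^sup>+b. ennreal (f (pCons b (pCons a (monic_poly m w)))) \<partial>lborel \<partial>lborel \<partial>lborel_vec {..<m}) =
      (\<integral>\<^sup>+v. ennreal (f (monic_poly (Suc (Suc m)) v)) \<partial>lborel_vec {..<Suc (Suc m)})"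
  proof -
    have fm': "(\<lambda>v. ennreal (f (monic_poly (Suc (Suc m)) v))) \<in> borel_measurable (lborel_vec {..<Suc (Suc m)})"
      using fm by measurable
    show ?thesis
      apply (subst nn_integral_lborel_vec_lessThan_Suc[OF fm'])
      apply (subst nn_integral_lborel_vec_lessThan_Suc)
       apply (rule lborel.borel_measurable_nn_integral)
       apply (use measurable_lborel_vec_upd[OF fm'] in simp)
      apply (simp add: monic_poly_Suc_upd)
      done
  qed
  finally show ?thesis unfolding eq .
qed

section \<open>Polynomials with simple roots\<close>

definition simple_roots :: "real poly \<Rightarrow> bool" where
  "simple_roots p \<longleftrightarrow> (\<forall>w. ceval p w = 0 \<longrightarrow> ceval (pderiv p) w \<noteq> 0)"

text \<open>The signature is recorded by the number of real roots, the quantity that sign changes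
  detect; for simple roots the degree then gives the number of nonreal ones.\<close>

definition simple_sig :: "nat \<Rightarrow> real poly \<Rightarrow> bool" where
  "simple_sig a p \<longleftrightarrow> simple_roots p \<and> card {x. poly p x = 0} = a"

lemma simple_roots_real: "simple_roots p \<Longrightarrow> poly p x = 0 \<Longrightarrow> poly (pderiv p) x \<noteq> 0"
  unfolding simple_roots_def by (drule spec[of _ "of_real x"]) (simp add: of_real_hom.poly_map_poly)

text \<open>At a root of p the derivative of p q is p' q, so a common root of p and q is a multiple
  root of the product.\<close>

lemma simple_roots_mult:
  "simple_roots (p * q) \<longleftrightarrow> simple_roots p \<and> simple_roots q \<and> (\<forall>w. ceval p w = 0 \<longrightarrow> ceval q w \<noteq> 0)"
proof -
  have "ceval (pderiv (p * q)) w = ceval p w * ceval (pderiv q) w + ceval q w * ceval (pderiv p) w" for w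
    unfolding pderiv_mult of_real_hom.map_poly_hom_add poly_add ceval_mult ..
  then show ?thesis unfolding simple_roots_def by (auto simp: ceval_mult)
qed

lemma simple_roots_linear_mult: "simple_roots ([:-x, 1:] * q) \<longleftrightarrow> simple_roots q \<and> poly q x \<noteq> 0"
proof -
  have root: "ceval [:-x, 1:] w = 0 \<longleftrightarrow> w = of_real x" for w
    by (simp add: ceval_pCons)
  have "simple_roots [:-x, 1:]" by (simp add: simple_roots_def pderiv_pCons ceval_pCons)
  then show ?thesis
    unfolding simple_roots_mult root by (simp add: of_real_hom.poly_map_poly)
qed

lemma ceval_quadratic: "ceval [:y\<^sup>2 + z\<^sup>2, -2 * y, 1:] w = (w - Complex y z) * (w - cnj (Complex y z))"
  by (simp add: ceval_pCons complex_eq_iff power2_eq_square algebra_simps)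

lemma ceval_pderiv_quadratic: "ceval (pderiv [:y\<^sup>2 + z\<^sup>2, -2 * y, 1:]) w = 2 * (w - of_real y)"
  by (simp add: pderiv_pCons ceval_pCons algebra_simps)

lemma simple_roots_quadratic_mult:
  assumes "z \<noteq> 0"
  shows "simple_roots ([:y\<^sup>2 + z\<^sup>2, -2 * y, 1:] * q) \<longleftrightarrow> simple_roots q \<and> ceval q (Complex y z) \<noteq> 0"
proof -
  have "simple_roots [:y\<^sup>2 + z\<^sup>2, -2 * y, 1:]"
    using assms unfolding simple_roots_def ceval_quadratic ceval_pderiv_quadratic
    by (auto simp: complex_eq_iff)
  moreover have "ceval q (cnj (Complex y z)) = 0 \<longleftrightarrow> ceval q (Complex y z) = 0"
    unfolding ceval_cnj by simp
  ultimately show ?thesis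
    unfolding simple_roots_mult ceval_quadratic by auto
qed

lemma simple_sig_linear_mult:
  assumes "q \<noteq> 0"
  shows "simple_sig (Suc a) ([:-x, 1:] * q) \<longleftrightarrow> simple_sig a q \<and> poly q x \<noteq> 0"
proof (cases "poly q x = 0")
  case False
  have roots: "{t. poly ([:-x, 1:] * q) t = 0} = insert x {t. poly q t = 0}" by auto
  show ?thesis
    unfolding simple_sig_def simple_roots_linear_mult roots
    using False poly_roots_finite[OF assms] by (auto simp: card_insert_if)
next
  case True
  then show ?thesis unfolding simple_sig_def simple_roots_linear_mult by blast
qed

lemma simple_sig_quadratic_mult:
  assumes "z \<noteq> 0"
  shows "simple_sig a ([:y\<^sup>2 + z\<^sup>2, -2 * y, 1:] * q) \<longleftrightarrow> simple_sig a q \<and> ceval q (Complex y z) \<noteq> 0"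
proof -
  have "poly [:y\<^sup>2 + z\<^sup>2, -2 * y, 1:] t \<noteq> 0" for t
  proof -
    have "poly [:y\<^sup>2 + z\<^sup>2, -2 * y, 1:] t = (t - y)\<^sup>2 + z\<^sup>2" by (simp add: power2_eq_square algebra_simps)
    moreover have "(t - y)\<^sup>2 + z\<^sup>2 > 0" using assms by (simp add: sum_power2_gt_zero_iff)
    ultimately show ?thesis by linarith
  qed
  then have "{t. poly ([:y\<^sup>2 + z\<^sup>2, -2 * y, 1:] * q) t = 0} = {t. poly q t = 0}"
    unfolding poly_mult by simp
  then show ?thesis unfolding simple_sig_def simple_roots_quadratic_mult[OF assms] by auto
qed

lemma real_roots_of_real: "of_real ` {x. poly p x = 0} = {w. Im w = 0 \<and> ceval p w = 0}"
proof -
  have "w \<in> of_real ` {x. poly p x = 0}" if "Im w = 0" "ceval p w = 0" for w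
  proof -
    have "w = of_real (Re w)" using that(1) by (simp add: complex_eq_iff)
    then show ?thesis using that(2)
      by (metis (mono_tags) image_eqI mem_Collect_eq of_real_eq_0_iff of_real_hom.poly_map_poly)
  qed
  then show ?thesis by (auto simp: of_real_hom.poly_map_poly)
qed

lemma simple_roots_proots:
  assumes "simple_roots p" "p \<noteq> 0"
  shows "proots (map_poly complex_of_real p) = mset_set {w. ceval p w = 0}"
proof -
  have nz: "map_poly complex_of_real p \<noteq> 0" using assms by simp
  then have fin: "finite {w. ceval p w = 0}" by (rule poly_roots_finite)
  have "rsquarefree (map_poly complex_of_real p)"
    using assms(1) unfolding rsquarefree_roots simple_roots_def ceval_pderiv by blast
  then have "count (proots (map_poly complex_of_real p)) w = count (mset_set {w. ceval p w = 0}) w" for w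
    using fin nz by (cases "ceval p w = 0") (simp_all add: rsquarefree_root_order order_0I)
  then show ?thesis by (rule multiset_eqI)
qed

lemma card_simple_roots:
  assumes "simple_roots p" "p \<noteq> 0"
  shows "card {w. ceval p w = 0} = degree p"
proof -
  have "degree p = size (proots (map_poly complex_of_real p))" by (simp add: size_proots_complex)
  then show ?thesis by (simp add: simple_roots_proots[OF assms])
qed

lemma card_nonreal_roots:
  assumes "simple_sig a p" "p \<noteq> 0"
  shows "a + card {w. Im w \<noteq> 0 \<and> ceval p w = 0} = degree p"
proof -
  have fin: "finite {w. ceval p w = 0}" using assms(2) by (intro poly_roots_finite) simp
  have "card {w. Im w = 0 \<and> ceval p w = 0} = a"
    unfolding real_roots_of_real[symmetric] using assms(1)
    by (subst card_image) (auto simp: simple_sig_def inj_on_def)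
  moreover have "card {w. Im w = 0 \<and> ceval p w = 0} + card {w. Im w \<noteq> 0 \<and> ceval p w = 0} = card {w. ceval p w = 0}"
    by (subst card_Un_disjoint[symmetric]) (auto intro!: arg_cong[where f = card] finite_subset[OF _ fin])
  ultimately show ?thesis
    using card_simple_roots[of p] assms by (simp add: simple_sig_def)
qed

text \<open>With simple roots the nonreal ones form a set, the union of its part U in the upper half
  plane and the conjugates of U. Every W admissible in \<open>has_signature\<close> has half the
  size of that set, so s is found by counting, and U itself serves as W.\<close>

lemma has_signature_simple_roots:
  assumes "simple_roots p" "p \<noteq> 0" "degree p = a + 2 * s"
  shows "has_signature p s \<longleftrightarrow> simple_sig a p"
proof -
  let ?N = "{w. Im w \<noteq> 0 \<and> ceval p w = 0}" and ?U = "{w. Im w > 0 \<and> ceval p w = 0}"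
  have fin: "finite {w. ceval p w = 0}" using assms(2) by (intro poly_roots_finite) simp
  have finU: "finite ?U" and finN: "finite ?N" by (auto intro: finite_subset[OF _ fin])
  have "filter_mset (\<lambda>w. w \<notin> \<real>) (proots (map_poly complex_of_real p)) = mset_set ?N"
    unfolding simple_roots_proots[OF assms(1,2)] by (subst filter_mset_mset_set[OF fin]) (auto simp: complex_is_Real_iff intro: arg_cong[where f = mset_set] Collect_cong)
  then have hs: "has_signature p s \<longleftrightarrow> (\<exists>W. size W = s \<and> mset_set ?N = W + image_mset cnj W)"
    using assms(2) by (simp add: has_signature_def)
  have N: "mset_set ?N = mset_set ?U + image_mset cnj (mset_set ?U)"
  proof -
    have "image_mset cnj (mset_set ?U) = mset_set (cnj ` ?U)"
      by (rule image_mset_mset_set) (auto simp: inj_on_def)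
    moreover have "?N = ?U \<union> cnj ` ?U"
    proof -
      have "w \<in> cnj ` ?U" if "Im w < 0" "ceval p w = 0" for w
        using that by (intro image_eqI[of _ _ "cnj w"]) (auto simp: ceval_cnj)
      then show ?thesis by (auto simp: ceval_cnj neq_iff)
    qed
    moreover have "mset_set (?U \<union> cnj ` ?U) = mset_set ?U + mset_set (cnj ` ?U)"
      using finU by (intro mset_set_Union) auto
    ultimately show ?thesis by simp
  qed
  have card_N: "card ?N = 2 * card ?U"
    using arg_cong[OF N, of size] by simp
  have sig: "simple_sig (card {x. poly p x = 0}) p" using assms(1) by (simp add: simple_sig_def)
  note eq = card_nonreal_roots[OF sig assms(2)]
  show ?thesis
  proof
    assume "has_signature p s"
    then obtain W where W: "size W = s" "mset_set ?N = W + image_mset cnj W" using hs by blast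
    have "card ?N = 2 * s" using arg_cong[OF W(2), of size] W(1) by simp
    then show "simple_sig a p" using eq assms sig by simp
  next
    assume "simple_sig a p"
    then have "card ?U = s" using eq assms(3) card_N by (simp add: simple_sig_def)
    then show "has_signature p s" unfolding hs using N by (intro exI[of _ "mset_set ?U"]) simp
  qed
qed

section \<open>Measurability of simple roots and of the number of real roots\<close>

text \<open>Simple roots mean that g = |p| + |p'| has no complex zero. For nonconstant p, |p| is at
  least 1 outside a disc, so compactness gives g a positive lower bound; by continuity a bound along
  the dense sequence u holds everywhere. The condition becomes countable, hence measurable in the
  coefficients.\<close>

lemma simple_roots_iff_bounded_below:
  assumes "\<And>w e. e > 0 \<Longrightarrow> \<exists>k. dist (u k) w < e" and "p \<noteq> 0"
  shows "simple_roots p \<longleftrightarrow> (\<exists>n. \<forall>k. 1 / real (Suc n) \<le> cmod (ceval p (u k)) + cmod (ceval (pderiv p) (u k)))"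
proof
  define g where "g w = cmod (ceval p w) + cmod (ceval (pderiv p) w)" for w
  have cg: "continuous_on X g" for X unfolding g_def by (intro continuous_intros)
  {
    assume sr: "simple_roots p"
    then have pos: "g w > 0" for w
      unfolding simple_roots_def g_def by (metis add_pos_nonneg add_nonneg_pos norm_ge_zero zero_less_norm_iff)
    have "\<exists>e>0. \<forall>w. e \<le> g w"
    proof (cases p)
      case (pCons c q)
      show ?thesis
      proof (cases "q = 0")
        case True
        then have "g w = \<bar>c\<bar>" "c \<noteq> 0" for w using pCons assms(2) by (auto simp: g_def ceval_pCons pderiv_pCons)
        then show ?thesis by (intro exI[of _ "\<bar>c\<bar>"]) auto
      next
        case False
        then obtain r where r: "\<And>w. r \<le> cmod w \<Longrightarrow> 1 \<le> cmod (poly (pCons (of_real c) (map_poly of_real q)) w)"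
          using poly_infinity[of "map_poly complex_of_real q" 1 "of_real c"] by auto
        have "cball 0 \<bar>r\<bar> \<noteq> ({} :: complex set)" by simp
        then obtain w0 where w0: "\<And>w. w \<in> cball 0 \<bar>r\<bar> \<Longrightarrow> g w0 \<le> g w"
          using continuous_attains_inf[OF compact_cball _ cg] by blast
        have "min 1 (g w0) \<le> g w" for w
        proof (cases "cmod w \<le> \<bar>r\<bar>")
          case True
          then show ?thesis using w0[of w] by simp
        next
          case False
          then have "1 \<le> cmod (ceval p w)" using r[of w] pCons by (simp only: of_real_hom.map_poly_pCons_hom)
          then have "1 \<le> g w" unfolding g_def by (simp add: add_increasing2)
          then show ?thesis by simp
        qed
        then show ?thesis using pos[of w0] by (intro exI[of _ "min 1 (g w0)"]) auto
      qed
    qed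
    then obtain e where e: "e > 0" "\<And>w. e \<le> g w" by blast
    then obtain n where "1 / real (Suc n) < e" by (metis inverse_eq_divide reals_Archimedean)
    then show "\<exists>n. \<forall>k. 1 / real (Suc n) \<le> cmod (ceval p (u k)) + cmod (ceval (pderiv p) (u k))"
      using e unfolding g_def by (meson less_le_trans order_less_imp_le)
  }
  {
    assume "\<exists>n. \<forall>k. 1 / real (Suc n) \<le> cmod (ceval p (u k)) + cmod (ceval (pderiv p) (u k))"
    then obtain n where n: "\<And>k. 1 / real (Suc n) \<le> g (u k)" unfolding g_def by blast
    have "g w \<noteq> 0" for w
    proof
      assume "g w = 0"
      have "isCont g w" using cg[of UNIV] by (simp add: continuous_on_eq_continuous_at)
      then obtain e where e: "e > 0" "\<And>x. dist x w < e \<Longrightarrow> dist (g x) (g w) < 1 / real (Suc n)"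
        unfolding continuous_at_eps_delta by (metis of_nat_0_less_iff zero_less_Suc zero_less_divide_1_iff)
      obtain k where "dist (u k) w < e" using assms(1)[OF e(1)] by blast
      then have "\<bar>g (u k)\<bar> < 1 / real (Suc n)" using e(2) \<open>g w = 0\<close> by (fastforce simp: dist_real_def)
      then show False using n[of k] by linarith
    qed
    then show "simple_roots p" unfolding simple_roots_def g_def by (metis add.right_neutral norm_zero)
  }
qed

lemma measurable_simple_roots:
  "Measurable.pred (lborel_vec {..<d}) (\<lambda>v. simple_roots (monic_poly d v))"
proof -
  obtain D :: "complex set" where D: "countable D" "\<And>X. open X \<Longrightarrow> X \<noteq> {} \<Longrightarrow> \<exists>w\<in>D. w \<in> X"
    using countable_dense_setE by blast
  have "D \<noteq> {}" using D(2)[of UNIV] by auto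
  then obtain u :: "nat \<Rightarrow> complex" where u: "range u = D"
    using D(1) range_from_nat_into by metis
  have dense: "\<exists>k. dist (u k) w < e" if "e > 0" for w e
  proof -
    have "ball w e \<noteq> {}" using that by simp
    then obtain x where "x \<in> D" "x \<in> ball w e" using D(2)[OF open_ball] by blast
    then show ?thesis using u by (auto simp: dist_commute)
  qed
  have [measurable]: "(\<lambda>v. ceval (monic_poly d v) (u k)) \<in> borel_measurable (lborel_vec {..<d})"
    "(\<lambda>v. ceval (pderiv (monic_poly d v)) (u k)) \<in> borel_measurable (lborel_vec {..<d})" for k
    by (rule measurable_ceval_bounded[where d = d];
        auto simp: coeff_pderiv degree_pderiv intro!: borel_measurable_times measurable_coeff_monic_poly)+
  have eq: "simple_roots (monic_poly d v) \<longleftrightarrow> (\<exists>n. \<forall>k. 1 / real (Suc n) \<le>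
      cmod (ceval (monic_poly d v) (u k)) + cmod (ceval (pderiv (monic_poly d v)) (u k)))" for v
    by (rule simple_roots_iff_bounded_below[OF dense]) auto
  show ?thesis unfolding eq by measurable
qed

definition separated_intervals :: "(rat \<times> rat) list \<Rightarrow> bool" where
  "separated_intervals F \<longleftrightarrow> distinct F \<and> (\<forall>I\<in>set F. fst I < snd I) \<and>
     (\<forall>I\<in>set F. \<forall>J\<in>set F. I \<noteq> J \<longrightarrow> snd I \<le> fst J \<or> snd J \<le> fst I)"

text \<open>The lists range over a countable set and each condition is measurable in the
  coefficients; for simple roots this says that there are at least k real roots.\<close>

definition sign_changes :: "nat \<Rightarrow> real poly \<Rightarrow> bool" where
  "sign_changes k p \<longleftrightarrow> (\<exists>F. separated_intervals F \<and> length F = k \<and>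
     (\<forall>I\<in>set F. poly p (of_rat (fst I)) * poly p (of_rat (snd I)) < 0))"

text \<open>Write p = (X - t) q. Then q(t) = p'(t) is nonzero, so q keeps its sign near t while X -
  t changes sign.\<close>

lemma sign_change_at_simple_root:
  fixes p :: "real poly"
  assumes "poly p t = 0" "poly (pderiv p) t \<noteq> 0"
  obtains e where "e > 0" "\<And>a b. t - e < a \<Longrightarrow> a < t \<Longrightarrow> t < b \<Longrightarrow> b < t + e \<Longrightarrow> poly p a * poly p b < 0"
proof -
  obtain q where q: "p = [:-t, 1:] * q" using assms(1) by (auto simp: poly_eq_0_iff_dvd)
  have "poly (pderiv p) t = poly q t" unfolding q pderiv_mult by (simp add: pderiv_pCons)
  then have qt: "poly q t * poly q t > 0" using assms(2) by (metis not_square_less_zero linorder_neqE_linordered_idom mult_eq_0_iff)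
  have "((\<lambda>x. poly q x * poly q t) \<longlongrightarrow> poly q t * poly q t) (at t)"
    by (intro tendsto_intros poly_isCont[unfolded isCont_def])
  then have "\<forall>\<^sub>F x in at t. poly q x * poly q t > 0" using qt by (rule order_tendstoD)
  then obtain e where e: "e > 0" "\<And>x. x \<noteq> t \<Longrightarrow> dist x t < e \<Longrightarrow> poly q x * poly q t > 0"
    unfolding eventually_at by auto
  have "poly p a * poly p b < 0" if ab: "t - e < a" "a < t" "t < b" "b < t + e" for a b
  proof -
    have "poly q a * poly q t > 0" "poly q b * poly q t > 0" using ab by (auto intro!: e simp: dist_real_def)
    then have qq: "poly q a * poly q b > 0" by (auto simp: zero_less_mult_iff)
    have "poly p a * poly p b = ((a - t) * (b - t)) * (poly q a * poly q b)" by (simp add: q algebra_simps)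
    moreover have "(a - t) * (b - t) < 0" using ab by (simp add: mult_less_0_iff)
    ultimately show ?thesis using qq by (simp only: mult_neg_pos)
  qed
  with e(1) show thesis by (rule that)
qed

text \<open>Each interval contains a root by the intermediate value theorem, and separated intervals
  give distinct roots. Conversely every simple root is a sign change and can be enclosed by rational
  endpoints close to it.\<close>

lemma sign_changes_iff:
  assumes "simple_roots p" "p \<noteq> 0"
  shows "sign_changes k p \<longleftrightarrow> k \<le> card {x. poly p x = 0}"
proof
  have fin: "finite {x. poly p x = 0}" using assms(2) by (rule poly_roots_finite)
  {
    assume "sign_changes k p"
    then obtain F where F: "separated_intervals F" "length F = k"
      "\<And>I. I \<in> set F \<Longrightarrow> poly p (of_rat (fst I)) * poly p (of_rat (snd I)) < 0"
      unfolding sign_changes_def by blast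
    have "\<exists>x. of_rat (fst I) < x \<and> x < of_rat (snd I) \<and> poly p x = 0" if "I \<in> set F" for I
      using poly_IVT[OF _ F(3)[OF that]] F(1) that unfolding separated_intervals_def by (auto simp: of_rat_less)
    then obtain \<rho> where \<rho>: "\<And>I. I \<in> set F \<Longrightarrow> of_rat (fst I) < \<rho> I \<and> \<rho> I < of_rat (snd I) \<and> poly p (\<rho> I) = 0"
      by metis
    have "inj_on \<rho> (set F)"
    proof (rule inj_onI, rule ccontr)
      fix I J assume IJ: "I \<in> set F" "J \<in> set F" "\<rho> I = \<rho> J" "I \<noteq> J"
      then have "snd I \<le> fst J \<or> snd J \<le> fst I" using F(1) unfolding separated_intervals_def by blast
      then have "(of_rat (snd I) :: real) \<le> of_rat (fst J) \<or> (of_rat (snd J) :: real) \<le> of_rat (fst I)"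
        by (simp add: of_rat_less_eq)
      then show False using \<rho>[OF IJ(1)] \<rho>[OF IJ(2)] IJ(3) by auto
    qed
    then have "card (set F) \<le> card {x. poly p x = 0}" using \<rho> fin by (intro card_inj_on_le[of \<rho>]) auto
    then show "k \<le> card {x. poly p x = 0}"
      using F(1,2) by (simp add: separated_intervals_def distinct_card)
  }
  {
    assume "k \<le> card {x. poly p x = 0}"
    then obtain X where X: "X \<subseteq> {x. poly p x = 0}" "card X = k"
      by (metis obtain_subset_with_card_n)
    \<comment> \<open>\<open>\<delta> t\<close> bounds from below the distance of t to every other
      root; staying within \<open>\<delta> t / 2\<close> keeps the intervals of different roots
      apart.\<close>
    have "\<forall>t. \<exists>\<delta>. \<delta> > 0 \<and> (\<forall>u\<in>{x. poly p x = 0}. u \<noteq> t \<longrightarrow> \<delta> \<le> dist t u)"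
      using finite_set_avoid[OF fin] by blast
    then obtain \<delta> where "\<forall>t. \<delta> t > 0 \<and> (\<forall>u\<in>{x. poly p x = 0}. u \<noteq> t \<longrightarrow> \<delta> t \<le> dist t u)"
      unfolding choice_iff by blast
    then have \<delta>: "\<And>t. \<delta> t > 0" "\<And>t u. poly p u = 0 \<Longrightarrow> u \<noteq> t \<Longrightarrow> \<delta> t \<le> dist t u"
      by auto
    have ex: "\<exists>I :: rat \<times> rat. t - \<delta> t / 2 < of_rat (fst I) \<and> of_rat (fst I) < t \<and> t < of_rat (snd I) \<and> of_rat (snd I) < t + \<delta> t / 2 \<and>
        poly p (of_rat (fst I)) * poly p (of_rat (snd I)) < 0" if "t \<in> X" for t
    proof -
      have t: "poly p t = 0" using that X(1) by auto
      obtain e where e: "e > 0" "\<And>a b. t - e < a \<Longrightarrow> a < t \<Longrightarrow> t < b \<Longrightarrow> b < t + e \<Longrightarrow> poly p a * poly p b < 0"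
        using sign_change_at_simple_root[OF t simple_roots_real[OF assms(1) t]] by blast
      obtain a where a: "max (t - e) (t - \<delta> t / 2) < of_rat a" "of_rat a < t"
        using of_rat_dense[of "max (t - e) (t - \<delta> t / 2)" t] e(1) \<delta>(1)[of t] by auto
      obtain b where b: "t < of_rat b" "of_rat b < min (t + e) (t + \<delta> t / 2)"
        using of_rat_dense[of t "min (t + e) (t + \<delta> t / 2)"] e(1) \<delta>(1)[of t] by auto
      show ?thesis using a b e(2)[of "of_rat a" "of_rat b"] by (intro exI[of _ "(a, b)"]) auto
    qed
    then obtain I :: "real \<Rightarrow> rat \<times> rat" where I: "\<And>t. t \<in> X \<Longrightarrow> t - \<delta> t / 2 < of_rat (fst (I t)) \<and> of_rat (fst (I t)) < t \<and>
        t < of_rat (snd (I t)) \<and> of_rat (snd (I t)) < t + \<delta> t / 2 \<and>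
        poly p (of_rat (fst (I t))) * poly p (of_rat (snd (I t))) < 0"
      by metis
    have sep: "snd (I t) \<le> fst (I u)" if "t \<in> X" "u \<in> X" "t < u" for t u
    proof -
      have "\<delta> t \<le> u - t" "\<delta> u \<le> u - t"
        using \<delta>(2)[of u t] \<delta>(2)[of t u] that X(1) by (auto simp: dist_real_def)
      then have "(of_rat (snd (I t)) :: real) \<le> of_rat (fst (I u))"
        using I[OF that(1)] I[OF that(2)] by argo
      then show ?thesis by (simp add: of_rat_less_eq)
    qed
    have lt: "fst (I t) < snd (I t)" if "t \<in> X" for t
    proof -
      have "(of_rat (fst (I t)) :: real) < of_rat (snd (I t))" using I[OF that] by linarith
      then show ?thesis by (simp add: of_rat_less)
    qed
    have inj: "inj_on I X"
      by (rule inj_onI) (metis lt sep leD linorder_neqE_linordered_idom)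
    have "finite X" using fin X(1) by (rule finite_subset[rotated])
    then obtain F where F: "set F = I ` X" "distinct F" using finite_distinct_list by (metis finite_imageI)
    have "length F = k" using F inj X(2) by (metis card_image distinct_card)
    moreover have "separated_intervals F"
    proof -
      have "snd (I t) \<le> fst (I u) \<or> snd (I u) \<le> fst (I t)" if "t \<in> X" "u \<in> X" "I t \<noteq> I u" for t u
        using sep that by (metis linorder_neqE_linordered_idom)
      then show ?thesis unfolding separated_intervals_def F(1) using F(2) lt by blast
    qed
    moreover have "\<forall>J\<in>set F. poly p (of_rat (fst J)) * poly p (of_rat (snd J)) < 0"
      unfolding F(1) using I by auto
    ultimately show "sign_changes k p" unfolding sign_changes_def by (intro exI[of _ F] conjI)
  }
qed

lemma simple_sig_iff_sign_changes:
  assumes "p \<noteq> 0"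
  shows "simple_sig a p \<longleftrightarrow> simple_roots p \<and> sign_changes a p \<and> \<not> sign_changes (Suc a) p"
  using sign_changes_iff[OF _ assms, of a] sign_changes_iff[OF _ assms, of "Suc a"]
  unfolding simple_sig_def by (cases "simple_roots p") auto

lemma measurable_simple_sig:
  "Measurable.pred (lborel_vec {..<d}) (\<lambda>v. simple_sig a (monic_poly d v))"
proof -
  have poly[measurable]: "(\<lambda>v. poly (monic_poly d v) x) \<in> borel_measurable (lborel_vec {..<d})" for x
    by (rule measurable_poly_bounded[where d = d]) (auto intro: measurable_coeff_monic_poly)
  have [measurable]: "Measurable.pred (lborel_vec {..<d}) (\<lambda>v. sign_changes k (monic_poly d v))" for k
    unfolding sign_changes_def by measurable
  note [measurable] = measurable_simple_roots
  show ?thesis unfolding simple_sig_iff_sign_changes[OF monic_poly_nonzero] by measurable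
qed

text \<open>The derivative does not see the constant coefficient: a multiple root is among the
  finitely many zeros of a fixed derivative, and it determines the constant coefficient.\<close>

lemma AE_simple_roots: "AE v in lborel_vec {..<d}. simple_roots (monic_poly d v)"
proof (cases d)
  case 0
  then have "monic_poly d v = 1" for v by (simp add: monic_poly_def)
  then show ?thesis by (simp add: simple_roots_def)
next
  case (Suc m)
  let ?N = "\<lambda>v. indicator {v. \<not> simple_roots (monic_poly d v)} v :: ennreal"
  have meas: "?N \<in> borel_measurable (lborel_vec {..<Suc m})"
    using measurable_simple_roots[of d] Suc by (simp add: indicator_def[abs_def])
  have zero: "(\<integral>\<^sup>+t. ?N (v(m := t)) \<partial>lborel) = 0" for v
  proof -
    let ?q = "monic_poly m v" and ?X = "{w. ceval (pderiv (pCons 0 (monic_poly m v))) w = 0}"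
    have "degree (pCons 0 ?q) \<noteq> 0" by simp
    then have "pderiv (pCons 0 ?q) \<noteq> 0" by (metis pderiv_eq_0_iff)
    then have "finite ?X" by (intro poly_roots_finite) simp
    \<comment> \<open>The constant coefficient is real, so it equals - Re (w * ceval ?q w) whenever
      w is a root.\<close>
    then have fin: "finite ((\<lambda>w. - Re (w * ceval ?q w)) ` ?X)" by simp
    have sub: "t \<in> (\<lambda>w. - Re (w * ceval ?q w)) ` ?X" if ns: "\<not> simple_roots (pCons t ?q)" for t
    proof -
      obtain w where w: "ceval (pCons t ?q) w = 0" "ceval (pderiv (pCons t ?q)) w = 0"
        using ns unfolding simple_roots_def by blast
      have "pderiv (pCons t ?q) = pderiv (pCons 0 ?q)" by (simp add: pderiv_pCons)
      then have "w \<in> ?X" using w(2) by simp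
      moreover have "t = - Re (w * ceval ?q w)" using w(1) unfolding ceval_pCons by (simp add: complex_eq_iff)
      ultimately show ?thesis by blast
    qed
    have "AE t in lborel. t \<notin> (\<lambda>w. - Re (w * ceval ?q w)) ` ?X"
      using fin by (intro AE_not_in countable_imp_null_set_lborel countable_finite)
    then have "AE t in lborel. ?N (v(m := t)) = 0"
      unfolding Suc monic_poly_Suc_upd using sub by (auto elim!: eventually_mono simp: indicator_def Suc monic_poly_Suc_upd)
    then show ?thesis by (simp add: nn_integral_0_iff_AE nn_integral_cong_AE[of _ "\<lambda>_. 0"])
  qed
  have "integral\<^sup>N (lborel_vec {..<Suc m}) ?N = 0"
    unfolding nn_integral_lborel_vec_lessThan_Suc[OF meas] zero by simp
  then have "AE v in lborel_vec {..<Suc m}. ?N v = 0" using meas by (simp add: nn_integral_0_iff_AE)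
  then show ?thesis unfolding Suc by (auto elim!: eventually_mono simp: indicator_def Suc split: if_splits)
qed

section \<open>Integration over roots and over coefficients\<close>

text \<open>Laplace expansion along the first row, in a form that simplification can iterate from
  the 4 by 4 Sylvester matrix down to the empty one.\<close>

lemma det_mat_Suc:
  fixes f :: "nat \<times> nat \<Rightarrow> 'a::comm_ring_1"
  shows "Determinant.det (Matrix.mat (Suc n) (Suc n) f) =
    (\<Sum>j<Suc n. f (0, j) * ((- 1) ^ j *
       Determinant.det (Matrix.mat n n (\<lambda>(i, k). f (Suc i, if k < j then k else Suc k)))))"
proof -
  have "mat_delete (Matrix.mat (Suc n) (Suc n) f) 0 j =
      Matrix.mat n n (\<lambda>(i, k). f (Suc i, if k < j then k else Suc k))" if "j < Suc n" for j
    by (rule eq_matI) (auto simp: mat_delete_def)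
  then show ?thesis
    by (subst laplace_expansion_row[of _ "Suc n" 0]) (auto simp: cofactor_def intro!: sum.cong)
qed

lemma resultant_monic_quadratics:
  fixes a b c d :: real
  shows "resultant [:b, a, 1:] [:d, c, 1:] = (b - d)\<^sup>2 + (a - c) * (a * d - b * c)"
proof -
  have "Determinant.det (Matrix.mat 0 0 f) = 1" for f :: "nat \<times> nat \<Rightarrow> real"
    by simp
  then show ?thesis
    unfolding resultant_def sylvester_mat_def sylvester_mat_sub_def
    by (simp add: numeral_eq_Suc det_mat_Suc lessThan_Suc coeff_pCons power2_eq_square algebra_simps del: One_nat_def split: nat.split)
qed

text \<open>The roots of the first polynomial are y + iz and its conjugate, and the second, being
  real, takes conjugate values there.\<close>

lemma resultant_monic_quadratics_nonreal:
  "resultant [:y\<^sup>2 + z\<^sup>2, -2 * y, 1:] [:n, c, 1:] = (cmod (ceval [:n, c, 1:] (Complex y z)))\<^sup>2"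
  unfolding resultant_monic_quadratics cmod_power2
  by (simp add: ceval_pCons power2_eq_square algebra_simps)

lemma quadratic_nonneg: "0 \<le> poly [:y\<^sup>2 + z\<^sup>2, -2 * y, 1:] (x :: real)"
proof -
  have eq: "poly [:y\<^sup>2 + z\<^sup>2, -2 * y, 1:] x = (x - y)\<^sup>2 + z\<^sup>2" by (simp add: power2_eq_square algebra_simps)
  show ?thesis unfolding eq by simp
qed

lemma cmod_ceval_linear: "(cmod (ceval [:-x, 1:] (Complex y z)))\<^sup>2 = poly [:y\<^sup>2 + z\<^sup>2, -2 * y, 1:] x"
  unfolding cmod_power2 by (simp add: ceval_pCons power2_eq_square algebra_simps)

text \<open>Both sides are the absolute value of the product of the four differences between a root
  of one factor and a root of the other.\<close>

lemma cmod_ceval_quadratic_swap: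
  "(cmod (ceval [:n\<^sup>2 + m\<^sup>2, -2 * n, 1:] (Complex y z)))\<^sup>2 = (cmod (ceval [:y\<^sup>2 + z\<^sup>2, -2 * y, 1:] (Complex n m)))\<^sup>2"
  unfolding cmod_power2 by (simp add: ceval_pCons power2_eq_square algebra_simps)

section \<open>Partial root vectors and their Jacobian weight\<close>

text \<open>r and s fix the layout of the coordinates; a and b count the real factors and the
  quadratic factors present so far.\<close>

definition root_poly :: "nat \<Rightarrow> nat \<Rightarrow> nat \<Rightarrow> nat \<Rightarrow> (nat \<Rightarrow> real) \<Rightarrow> real poly" where
  "root_poly r s a b v = (\<Prod>j<a. [:- v j, 1:]) * (\<Prod>j<b. Rpoly r s v j)"

text \<open>For a = r and b = s this is the integrand of the theorem.\<close>

definition jac_weight :: "nat \<Rightarrow> nat \<Rightarrow> nat \<Rightarrow> nat \<Rightarrow> (nat \<Rightarrow> real) \<Rightarrow> real" where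
  "jac_weight r s a b v = \<bar>\<Prod>k<a. \<Prod>j<k. v j - v k\<bar> * (\<Prod>k<b. \<Prod>j<k. resultant (Rpoly r s v j) (Rpoly r s v k)) *
     (\<Prod>j<a. \<Prod>k<b. poly (Rpoly r s v k) (v j)) * (\<Prod>j<b. \<bar>zc r s v j\<bar>)"

text \<open>The coordinates in use. They need not form an initial segment, hence product measures
  over other finite index sets.\<close>

definition root_index :: "nat \<Rightarrow> nat \<Rightarrow> nat \<Rightarrow> nat \<Rightarrow> nat set" where
  "root_index r s a b = {..<a} \<union> {r..<r + b} \<union> {r + s..<r + s + b}"

lemma Rpoly_nonneg: "0 \<le> poly (Rpoly r s v k) x"
  unfolding Rpoly_def by (rule quadratic_nonneg)

lemma jac_weight_nonneg: "0 \<le> jac_weight r s a b v"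
proof -
  have "0 \<le> resultant (Rpoly r s v j) (Rpoly r s v k)" for j k
    unfolding Rpoly_def resultant_monic_quadratics_nonreal by simp
  then show ?thesis
    unfolding jac_weight_def by (intro mult_nonneg_nonneg prod_nonneg abs_ge_zero Rpoly_nonneg ballI)
qed

lemma degree_root_poly: "degree (root_poly r s a b v) = a + 2 * b"
  and lead_coeff_root_poly: "lead_coeff (root_poly r s a b v) = 1"
proof -
  have "degree (\<Prod>j<a. [:- v j, 1:]) = a" "degree (\<Prod>j<b. Rpoly r s v j) = 2 * b"
    by (subst degree_prod_eq_sum_degree; simp add: Rpoly_def)+
  moreover have "(\<Prod>j<a. [:- v j, 1:]) \<noteq> 0" "(\<Prod>j<b. Rpoly r s v j) \<noteq> 0"
    by (auto simp: Rpoly_def)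
  ultimately show "degree (root_poly r s a b v) = a + 2 * b"
    unfolding root_poly_def by (subst degree_mult_eq) auto
  show "lead_coeff (root_poly r s a b v) = 1"
    unfolding root_poly_def lead_coeff_mult lead_coeff_prod by (simp add: Rpoly_def)
qed

lemma Rpoly_upd: "i \<noteq> r + j \<Longrightarrow> i \<noteq> r + s + j \<Longrightarrow> Rpoly r s (v(i := x)) j = Rpoly r s v j"
  by (simp add: Rpoly_def yc_def zc_def)

lemma root_poly_upd_real:
  assumes "a < r"
  shows "root_poly r s (Suc a) b (v(a := x)) = [:-x, 1:] * root_poly r s a b v"
proof -
  have "(\<Prod>j<a. [:- (v(a := x)) j, 1:]) = (\<Prod>j<a. [:- v j, 1:])" by (intro prod.cong) auto
  moreover have "Rpoly r s (v(a := x)) = Rpoly r s v" using assms by (simp add: Rpoly_upd fun_eq_iff)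
  ultimately show ?thesis unfolding root_poly_def by (simp only: prod.lessThan_Suc fun_upd_same mult_ac)
qed

text \<open>The new differences x_j - x and the new values R_k(x) multiply, in absolute value, to
  |Q(x)|, where Q is the product of the earlier factors.\<close>

lemma jac_weight_upd_real:
  assumes "a < r"
  shows "jac_weight r s (Suc a) b (v(a := x)) = jac_weight r s a b v * \<bar>poly (root_poly r s a b v) x\<bar>"
proof -
  have R: "Rpoly r s (v(a := x)) k = Rpoly r s v k" and z: "zc r s (v(a := x)) k = zc r s v k" for k
    using assms by (auto simp: Rpoly_upd zc_def)
  have "\<bar>poly (root_poly r s a b v) x\<bar> = \<bar>\<Prod>j<a. x - v j\<bar> * (\<Prod>k<b. poly (Rpoly r s v k) x)"
    unfolding root_poly_def poly_mult poly_prod abs_mult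
    by (simp add: abs_of_nonneg prod_nonneg Rpoly_nonneg)
  also have "\<bar>\<Prod>j<a. x - v j\<bar> = \<bar>\<Prod>j<a. v j - x\<bar>"
    unfolding abs_prod by (simp add: abs_minus_commute)
  finally show ?thesis
    unfolding jac_weight_def R z by (simp add: abs_mult mult_ac)
qed

lemma root_poly_upd_cplx:
  assumes "b < s" "a \<le> r"
  shows "root_poly r s a (Suc b) (v(r + s + b := z, r + b := y)) = [:y\<^sup>2 + z\<^sup>2, -2 * y, 1:] * root_poly r s a b v"
proof -
  have "(\<Prod>j<b. Rpoly r s (v(r + s + b := z, r + b := y)) j) = (\<Prod>j<b. Rpoly r s v j)"
    using assms by (intro prod.cong) (auto simp: Rpoly_upd)
  moreover have "(\<Prod>j<a. [:- (v(r + s + b := z, r + b := y)) j, 1:]) = (\<Prod>j<a. [:- v j, 1:])"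
    using assms by (intro prod.cong) auto
  moreover have "Rpoly r s (v(r + s + b := z, r + b := y)) b = [:y\<^sup>2 + z\<^sup>2, -2 * y, 1:]"
    using assms by (simp add: Rpoly_def yc_def zc_def)
  ultimately show ?thesis unfolding root_poly_def by (simp only: prod.lessThan_Suc mult_ac)
qed

lemma cmod_ceval_root_poly:
  "(cmod (ceval (root_poly r s a b v) (Complex y z)))\<^sup>2 =
     (\<Prod>j<a. poly [:y\<^sup>2 + z\<^sup>2, -2 * y, 1:] (v j)) * (\<Prod>j<b. resultant (Rpoly r s v j) [:y\<^sup>2 + z\<^sup>2, -2 * y, 1:])"
proof -
  have prod: "(cmod (ceval (\<Prod>j\<in>J. p j) w))\<^sup>2 = (\<Prod>j\<in>J. (cmod (ceval (p j) w))\<^sup>2)" for J :: "nat set" and p w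
    by (induction J rule: infinite_finite_induct) (auto simp: ceval_mult norm_mult power_mult_distrib)
  have "(cmod (ceval (Rpoly r s v j) (Complex y z)))\<^sup>2 = resultant (Rpoly r s v j) [:y\<^sup>2 + z\<^sup>2, -2 * y, 1:]" for j
    unfolding Rpoly_def resultant_monic_quadratics_nonreal by (rule cmod_ceval_quadratic_swap)
  then show ?thesis
    unfolding root_poly_def ceval_mult norm_mult power_mult_distrib prod cmod_ceval_linear by simp
qed

text \<open>The new resultants and the values of the new quadratic at the real roots multiply to
  |Q(y + iz)|^2; the new entry of the last product is |z|.\<close>

lemma jac_weight_upd_cplx:
  assumes "b < s" "a \<le> r"
  shows "jac_weight r s a (Suc b) (v(r + s + b := z, r + b := y)) =
     jac_weight r s a b v * ((cmod (ceval (root_poly r s a b v) (Complex y z)))\<^sup>2 * \<bar>z\<bar>)"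
proof -
  let ?v = "v(r + s + b := z, r + b := y)"
  have R: "Rpoly r s ?v j = Rpoly r s v j" "zc r s ?v j = zc r s v j" if "j < b" for j
    using assms that by (auto simp: Rpoly_upd zc_def)
  have Rb: "Rpoly r s ?v b = [:y\<^sup>2 + z\<^sup>2, -2 * y, 1:]" "zc r s ?v b = z"
    using assms by (auto simp: Rpoly_def yc_def zc_def)
  have x: "?v j = v j" if "j < a" for j using assms that by auto
  have "(\<Prod>k<a. \<Prod>j<k. ?v j - ?v k) = (\<Prod>k<a. \<Prod>j<k. v j - v k)"
    by (intro prod.cong refl arg_cong2[where f = minus] x) auto
  moreover have "(\<Prod>k<Suc b. \<Prod>j<k. resultant (Rpoly r s ?v j) (Rpoly r s ?v k)) =
      (\<Prod>k<b. \<Prod>j<k. resultant (Rpoly r s v j) (Rpoly r s v k)) * (\<Prod>j<b. resultant (Rpoly r s v j) [:y\<^sup>2 + z\<^sup>2, -2 * y, 1:])"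
    unfolding prod.lessThan_Suc Rb
    by (intro arg_cong2[where f = times] prod.cong refl arg_cong2[where f = resultant] R) auto
  moreover have "(\<Prod>j<a. \<Prod>k<Suc b. poly (Rpoly r s ?v k) (?v j)) =
      (\<Prod>j<a. \<Prod>k<b. poly (Rpoly r s v k) (v j)) * (\<Prod>j<a. poly [:y\<^sup>2 + z\<^sup>2, -2 * y, 1:] (v j))"
    unfolding prod.lessThan_Suc Rb prod.distrib
    by (intro arg_cong2[where f = times] prod.cong refl arg_cong2[where f = poly] R x) auto
  moreover have "(\<Prod>j<Suc b. \<bar>zc r s ?v j\<bar>) = (\<Prod>j<b. \<bar>zc r s v j\<bar>) * \<bar>z\<bar>"
    unfolding prod.lessThan_Suc Rb by (intro arg_cong2[where f = times] prod.cong refl arg_cong[where f = abs] R) auto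
  ultimately show ?thesis
    unfolding jac_weight_def cmod_ceval_root_poly by (simp only: mult_ac)
qed

lemma measurable_coeff_root_poly:
  assumes "a \<le> r" "b \<le> s" "root_index r s a b \<subseteq> I"
  shows "(\<lambda>v. coeff (root_poly r s a b v) j) \<in> borel_measurable (lborel_vec I)"
  unfolding root_poly_def Rpoly_def yc_def zc_def
  using assms(3) unfolding root_index_def
  by (intro measurable_coeff_mult measurable_coeff_prod measurable_coeff_pCons borel_measurable_add borel_measurable_power
      borel_measurable_times borel_measurable_uminus borel_measurable_const measurable_component_singleton[of _ I "\<lambda>_. lborel", simplified]) auto

lemma measurable_jac_weight:
  assumes "a \<le> r" "b \<le> s" "root_index r s a b \<subseteq> I"
  shows "jac_weight r s a b \<in> borel_measurable (lborel_vec I)"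
proof -
  have comp: "(\<lambda>v. v j) \<in> borel_measurable (lborel_vec I)" if "j \<in> root_index r s a b" for j
    using measurable_component_singleton[of j I "\<lambda>_. lborel :: real measure"] that assms(3) by auto
  show ?thesis
    unfolding jac_weight_def Rpoly_def yc_def zc_def resultant_monic_quadratics poly_pCons
    by (intro borel_measurable_times borel_measurable_abs borel_measurable_prod borel_measurable_diff borel_measurable_add
        borel_measurable_power borel_measurable_const measurable_const comp) (auto simp: root_index_def)
qed

lemma of_nat_times_ennreal:
  "x = ennreal c * y \<Longrightarrow> 0 \<le> c \<Longrightarrow> of_nat n * x = ennreal (real n * c) * y"
  by (simp add: ennreal_mult mult.assoc ennreal_of_nat_eq_real_of_nat)

lemma measurable_times_simple_sig:
  assumes "(\<lambda>v. f (monic_poly d v)) \<in> borel_measurable (lborel_vec {..<d})"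
  shows "(\<lambda>v. f (monic_poly d v) * of_bool (simple_sig a (monic_poly d v)) :: real) \<in> borel_measurable (lborel_vec {..<d})"
  unfolding of_bool_def
  by (intro borel_measurable_times assms measurable_If measurable_const predE measurable_simple_sig) auto

text \<open>Conjugate pairs are adjoined first, while there are no real roots, and real roots
  afterwards. \<open>f\<close> stays arbitrary so that the induction hypothesis can be applied to
  the weight \<open>g\<close> carrying the Jacobian of the new factor.\<close>

proposition nn_integral_roots_eq_coeffs:
  fixes f :: "real poly \<Rightarrow> real"
  assumes "\<And>p. 0 \<le> f p" "a \<le> r" "b \<le> s"
    and "(\<lambda>v. f (monic_poly (a + 2 * b) v)) \<in> borel_measurable (lborel_vec {..<a + 2 * b})"
  shows "(\<integral>\<^sup>+v. ennreal (f (root_poly r s a b v) * jac_weight r s a b v) \<partial>lborel_vec (root_index r s a b)) =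
    ennreal (fact a * fact b / 2 ^ b) *
      (\<integral>\<^sup>+v. ennreal (f (monic_poly (a + 2 * b) v) * of_bool (simple_sig a (monic_poly (a + 2 * b) v))) \<partial>lborel_vec {..<a + 2 * b})"
  using assms
proof (induction a arbitrary: f)
  case 0
  show ?case using 0(1,3,4)
  proof (induction b arbitrary: f)
    case 0
    have "root_poly r s 0 0 v = 1" "monic_poly 0 v = 1" "jac_weight r s 0 0 v = 1" for v
      by (auto simp: root_poly_def monic_poly_def jac_weight_def)
    moreover have "simple_sig 0 1" by (simp add: simple_sig_def simple_roots_def)
    ultimately show ?case by (simp add: root_index_def)
  next
    case (Suc b)
    let ?I = "root_index r s 0 b" and ?m = "2 * b"
    define c :: real where "c = fact b / 2 ^ b"
    \<comment> \<open>The 4 in the Jacobian 4 |z| |Q|^2 of the quadratic step does not occur in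
      \<open>jac_weight\<close>; it is divided out here.\<close>
    define f' where "f' p = c / 4 * (f p * of_bool (simple_sig 0 p))" for p
    have c: "c \<ge> 0" by (simp add: c_def)
    have f': "0 \<le> f' p" for p using Suc.prems(1)[of p] c by (simp add: f'_def)
    have bs: "b < s" using Suc.prems by simp
    have fm: "(\<lambda>v. f (monic_poly (Suc (Suc ?m)) v)) \<in> borel_measurable (lborel_vec {..<Suc (Suc ?m)})"
      using Suc.prems(3) by simp
    have f'm: "(\<lambda>v. f' (monic_poly (Suc (Suc ?m)) v)) \<in> borel_measurable (lborel_vec {..<Suc (Suc ?m)})"
      unfolding f'_def by (rule borel_measurable_times[OF borel_measurable_const measurable_times_simple_sig[OF fm]])
    have I: "root_index r s 0 (Suc b) = insert (r + b) (insert (r + s + b) ?I)"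
      by (auto simp: root_index_def)
    have notin: "r + b \<notin> insert (r + s + b) ?I" "r + s + b \<notin> ?I" "finite ?I"
      using bs by (auto simp: root_index_def)
    have rm: "(\<lambda>v. ennreal (f (root_poly r s 0 (Suc b) v) * jac_weight r s 0 (Suc b) v)) \<in>
        borel_measurable (lborel_vec (insert (r + b) (insert (r + s + b) ?I)))"
    proof -
      have "(\<lambda>v. f (root_poly r s 0 (Suc b) v)) \<in> borel_measurable (lborel_vec (insert (r + b) (insert (r + s + b) ?I)))"
        by (intro measurable_poly_fun[OF fm] lead_coeff_root_poly measurable_coeff_root_poly)
           (use bs I in \<open>auto simp: degree_root_poly\<close>)
      then show ?thesis
        using measurable_jac_weight[of 0 r "Suc b" s] bs I by (intro measurable_compose[OF _ measurable_ennreal] borel_measurable_times) auto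
    qed
    have quad: "(\<integral>\<^sup>+v. ennreal (f (root_poly r s 0 (Suc b) (v(r + s + b := z, r + b := y))) *
          jac_weight r s 0 (Suc b) (v(r + s + b := z, r + b := y))) \<partial>lborel_vec ?I) =
        (\<integral>\<^sup>+v. ennreal (4 * \<bar>z\<bar> * (cmod (ceval (monic_poly ?m v) (Complex y z)))\<^sup>2 *
        f' ([:y\<^sup>2 + z\<^sup>2, -2 * y, 1:] * monic_poly ?m v)) \<partial>lborel_vec {..<?m})" for y z
    proof -
      let ?R = "[:y\<^sup>2 + z\<^sup>2, -2 * y, 1:]"
      define g where "g q = f (?R * q) * ((cmod (ceval q (Complex y z)))\<^sup>2 * \<bar>z\<bar>)" for q
      have g: "0 \<le> g q" for q using Suc.prems(1) by (simp add: g_def)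
      have gm: "(\<lambda>v. g (monic_poly ?m v)) \<in> borel_measurable (lborel_vec {..<?m})"
      proof -
        have [measurable]: "(\<lambda>v. ceval (monic_poly ?m v) (Complex y z)) \<in> borel_measurable (lborel_vec {..<?m})"
          by (rule measurable_ceval_bounded[where d = ?m]) (auto intro: measurable_coeff_monic_poly)
        have "degree (?R * monic_poly ?m v) = Suc (Suc ?m)" "lead_coeff (?R * monic_poly ?m v) = 1" for v
          by (subst degree_mult_eq lead_coeff_mult; simp)+
        then have [measurable]: "(\<lambda>v. f (?R * monic_poly ?m v)) \<in> borel_measurable (lborel_vec {..<?m})"
          by (intro measurable_poly_fun[OF fm] measurable_coeff_mult measurable_coeff_monic_poly borel_measurable_const) auto
        show ?thesis unfolding g_def by measurable
      qed
      have "(\<integral>\<^sup>+v. ennreal (f (root_poly r s 0 (Suc b) (v(r + s + b := z, r + b := y))) *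
          jac_weight r s 0 (Suc b) (v(r + s + b := z, r + b := y))) \<partial>lborel_vec ?I) =
        (\<integral>\<^sup>+v. ennreal (g (root_poly r s 0 b v) * jac_weight r s 0 b v) \<partial>lborel_vec ?I)"
        unfolding root_poly_upd_cplx[OF bs le0] jac_weight_upd_cplx[OF bs le0] g_def
        by (simp add: mult_ac)
      also have "\<dots> = ennreal c * (\<integral>\<^sup>+v. ennreal (g (monic_poly ?m v) * of_bool (simple_sig 0 (monic_poly ?m v))) \<partial>lborel_vec {..<?m})"
        using Suc.IH[of g] g gm bs by (simp add: c_def)
      also have "\<dots> = (\<integral>\<^sup>+v. ennreal c * ennreal (g (monic_poly ?m v) * of_bool (simple_sig 0 (monic_poly ?m v))) \<partial>lborel_vec {..<?m})"
        by (rule nn_integral_cmult[symmetric, OF measurable_compose[OF measurable_times_simple_sig[OF gm] measurable_ennreal]])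
      also have "\<dots> = (\<integral>\<^sup>+v. ennreal (4 * \<bar>z\<bar> * (cmod (ceval (monic_poly ?m v) (Complex y z)))\<^sup>2 *
          f' (?R * monic_poly ?m v)) \<partial>lborel_vec {..<?m})"
      proof (rule nn_integral_cong)
        fix v
        let ?q = "monic_poly ?m v"
        have "c * (g ?q * of_bool (simple_sig 0 ?q)) = 4 * \<bar>z\<bar> * (cmod (ceval ?q (Complex y z)))\<^sup>2 * f' (?R * ?q)"
        \<comment> \<open>Where the Jacobian vanishes both sides are 0; elsewhere multiplication by
          R preserves \<open>simple_sig 0\<close> in both directions.\<close>
        proof (cases "z = 0 \<or> ceval ?q (Complex y z) = 0")
          case False
          then have sig: "simple_sig 0 (?R * ?q) \<longleftrightarrow> simple_sig 0 ?q"
            using simple_sig_quadratic_mult[of z 0 y ?q] by blast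
          show ?thesis unfolding g_def f'_def sig by (simp del: mult_pCons_left)
        qed (auto simp: g_def)
        then show "ennreal c * ennreal (g ?q * of_bool (simple_sig 0 ?q)) =
            ennreal (4 * \<bar>z\<bar> * (cmod (ceval ?q (Complex y z)))\<^sup>2 * f' (?R * ?q))"
          using c g by (simp add: ennreal_mult[symmetric])
      qed
      finally show ?thesis .
    qed
    have "(\<integral>\<^sup>+v. ennreal (f (root_poly r s 0 (Suc b) v) * jac_weight r s 0 (Suc b) v) \<partial>lborel_vec (root_index r s 0 (Suc b))) =
      (\<integral>\<^sup>+y. \<integral>\<^sup>+z. \<integral>\<^sup>+v. ennreal (f (root_poly r s 0 (Suc b) (v(r + s + b := z, r + b := y))) *
          jac_weight r s 0 (Suc b) (v(r + s + b := z, r + b := y))) \<partial>lborel_vec ?I \<partial>lborel \<partial>lborel)"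
      unfolding I using notin
    proof (subst nn_integral_lborel_vec_insert_rev[OF _ _ rm], simp, simp, intro nn_integral_cong)
      fix y
      have "(\<lambda>v. v(r + b := y)) \<in> lborel_vec (insert (r + s + b) ?I) \<rightarrow>\<^sub>M lborel_vec (insert (r + b) (insert (r + s + b) ?I))"
        by (intro measurable_fun_upd[where J = "insert (r + s + b) ?I"]) auto
      from measurable_compose[OF this rm]
      show "(\<integral>\<^sup>+v. ennreal (f (root_poly r s 0 (Suc b) (v(r + b := y))) * jac_weight r s 0 (Suc b) (v(r + b := y)))
          \<partial>lborel_vec (insert (r + s + b) ?I)) =
        (\<integral>\<^sup>+z. \<integral>\<^sup>+v. ennreal (f (root_poly r s 0 (Suc b) (v(r + s + b := z, r + b := y))) *
          jac_weight r s 0 (Suc b) (v(r + s + b := z, r + b := y))) \<partial>lborel_vec ?I \<partial>lborel)"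
        using notin by (intro nn_integral_lborel_vec_insert_rev) auto
    qed
    also have "\<dots> = of_nat (2 * Suc b) * (\<integral>\<^sup>+v. ennreal (f' (monic_poly (Suc (Suc ?m)) v)) \<partial>lborel_vec {..<Suc (Suc ?m)})"
      unfolding quad
    proof (rule nn_integral_quadratic_times_monic_poly[OF f' f'm])
      fix p :: "real poly" assume p: "degree p = Suc (Suc ?m)" "lead_coeff p = 1" "f' p \<noteq> 0"
      then have sig: "simple_sig 0 p" by (simp add: f'_def)
      then have "{w. Im w \<noteq> 0 \<and> ceval (pderiv p) w \<noteq> 0 \<and> ceval p w = 0} = {w. Im w \<noteq> 0 \<and> ceval p w = 0}"
        by (auto simp: simple_sig_def simple_roots_def)
      moreover have "p \<noteq> 0" using p by auto
      \<comment> \<open>Degree 2 b + 2 without real roots leaves 2 (b + 1) nonreal roots, each of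
        them a value y + iz with z of either sign.\<close>
      ultimately show "card {w. Im w \<noteq> 0 \<and> ceval (pderiv p) w \<noteq> 0 \<and> ceval p w = 0} = 2 * Suc b"
        using card_nonreal_roots[OF sig] p(1) by simp
    qed
    also have "\<dots> = ennreal (real (2 * Suc b) * (c / 4)) * (\<integral>\<^sup>+v. ennreal (f (monic_poly (Suc (Suc ?m)) v) *
        of_bool (simple_sig 0 (monic_poly (Suc (Suc ?m)) v))) \<partial>lborel_vec {..<Suc (Suc ?m)})"
    proof -
      have "(\<integral>\<^sup>+v. ennreal (f' (monic_poly (Suc (Suc ?m)) v)) \<partial>lborel_vec {..<Suc (Suc ?m)}) =
        (\<integral>\<^sup>+v. ennreal (c / 4) * ennreal (f (monic_poly (Suc (Suc ?m)) v) *
          of_bool (simple_sig 0 (monic_poly (Suc (Suc ?m)) v))) \<partial>lborel_vec {..<Suc (Suc ?m)})"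
        unfolding f'_def using c Suc.prems(1) by (intro nn_integral_cong ennreal_mult) auto
      also have "\<dots> = ennreal (c / 4) * (\<integral>\<^sup>+v. ennreal (f (monic_poly (Suc (Suc ?m)) v) *
          of_bool (simple_sig 0 (monic_poly (Suc (Suc ?m)) v))) \<partial>lborel_vec {..<Suc (Suc ?m)})"
        by (rule nn_integral_cmult[OF measurable_compose[OF measurable_times_simple_sig[OF fm] measurable_ennreal]])
      finally show ?thesis by (rule of_nat_times_ennreal) (use c in simp)
    qed
    also have "real (2 * Suc b) * (c / 4) = fact 0 * fact (Suc b) / 2 ^ Suc b"
      by (simp add: c_def field_simps)
    finally show ?case by simp
  qed
next
  case (Suc a)
  let ?I = "root_index r s a b" and ?m = "a + 2 * b"
  define c :: real where "c = fact a * fact b / 2 ^ b"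
  define f' where "f' p = c * (f p * of_bool (simple_sig (Suc a) p))" for p
  have c: "c \<ge> 0" by (simp add: c_def)
  have f': "0 \<le> f' p" for p using Suc.prems(1)[of p] c by (simp add: f'_def)
  have ar: "a < r" using Suc.prems by simp
  have fm: "(\<lambda>v. f (monic_poly (Suc ?m) v)) \<in> borel_measurable (lborel_vec {..<Suc ?m})"
    using Suc.prems(4) by simp
  have f'm: "(\<lambda>v. f' (monic_poly (Suc ?m) v)) \<in> borel_measurable (lborel_vec {..<Suc ?m})"
    unfolding f'_def by (rule borel_measurable_times[OF borel_measurable_const measurable_times_simple_sig[OF fm]])
  have I: "root_index r s (Suc a) b = insert a ?I"
    by (auto simp: root_index_def)
  have notin: "a \<notin> ?I" "finite ?I"
    using ar by (auto simp: root_index_def)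
  have rm: "(\<lambda>v. ennreal (f (root_poly r s (Suc a) b v) * jac_weight r s (Suc a) b v)) \<in>
      borel_measurable (lborel_vec (insert a ?I))"
  proof -
    have "(\<lambda>v. f (root_poly r s (Suc a) b v)) \<in> borel_measurable (lborel_vec (insert a ?I))"
      by (intro measurable_poly_fun[OF fm] lead_coeff_root_poly measurable_coeff_root_poly)
         (use ar Suc.prems(3) I in \<open>auto simp: degree_root_poly\<close>)
    then show ?thesis
      using measurable_jac_weight[of "Suc a" r b s] ar Suc.prems(3) I
      by (intro measurable_compose[OF _ measurable_ennreal] borel_measurable_times) auto
  qed
  have lin: "(\<integral>\<^sup>+v. ennreal (f (root_poly r s (Suc a) b (v(a := x))) * jac_weight r s (Suc a) b (v(a := x))) \<partial>lborel_vec ?I) =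
      (\<integral>\<^sup>+v. ennreal (\<bar>poly (monic_poly ?m v) x\<bar> * f' ([:-x, 1:] * monic_poly ?m v)) \<partial>lborel_vec {..<?m})" for x
  proof -
    define g where "g q = f ([:-x, 1:] * q) * \<bar>poly q x\<bar>" for q
    have g: "0 \<le> g q" for q using Suc.prems(1) by (simp add: g_def)
    have gm: "(\<lambda>v. g (monic_poly ?m v)) \<in> borel_measurable (lborel_vec {..<?m})"
    proof -
      have [measurable]: "(\<lambda>v. poly (monic_poly ?m v) x) \<in> borel_measurable (lborel_vec {..<?m})"
        by (rule measurable_poly_bounded[where d = ?m]) (auto intro: measurable_coeff_monic_poly)
      have "degree ([:-x, 1:] * monic_poly ?m v) = Suc ?m" "lead_coeff ([:-x, 1:] * monic_poly ?m v) = 1" for v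
        by (subst degree_mult_eq lead_coeff_mult; simp)+
      then have [measurable]: "(\<lambda>v. f ([:-x, 1:] * monic_poly ?m v)) \<in> borel_measurable (lborel_vec {..<?m})"
        by (intro measurable_poly_fun[OF fm] measurable_coeff_mult measurable_coeff_monic_poly borel_measurable_const) auto
      show ?thesis unfolding g_def by measurable
    qed
    have "(\<integral>\<^sup>+v. ennreal (f (root_poly r s (Suc a) b (v(a := x))) * jac_weight r s (Suc a) b (v(a := x))) \<partial>lborel_vec ?I) =
      (\<integral>\<^sup>+v. ennreal (g (root_poly r s a b v) * jac_weight r s a b v) \<partial>lborel_vec ?I)"
      unfolding root_poly_upd_real[OF ar] jac_weight_upd_real[OF ar] g_def by (simp add: mult_ac)
    also have "\<dots> = ennreal c * (\<integral>\<^sup>+v. ennreal (g (monic_poly ?m v) * of_bool (simple_sig a (monic_poly ?m v))) \<partial>lborel_vec {..<?m})"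
      using Suc.IH[of g] g gm ar Suc.prems(3) by (simp add: c_def)
    also have "\<dots> = (\<integral>\<^sup>+v. ennreal c * ennreal (g (monic_poly ?m v) * of_bool (simple_sig a (monic_poly ?m v))) \<partial>lborel_vec {..<?m})"
      by (rule nn_integral_cmult[symmetric, OF measurable_compose[OF measurable_times_simple_sig[OF gm] measurable_ennreal]])
    also have "\<dots> = (\<integral>\<^sup>+v. ennreal (\<bar>poly (monic_poly ?m v) x\<bar> * f' ([:-x, 1:] * monic_poly ?m v)) \<partial>lborel_vec {..<?m})"
    proof (rule nn_integral_cong)
      fix v
      let ?q = "monic_poly ?m v"
      have "c * (g ?q * of_bool (simple_sig a ?q)) = \<bar>poly ?q x\<bar> * f' ([:-x, 1:] * ?q)"
      proof (cases "poly ?q x = 0")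
        case False
        then show ?thesis
          unfolding g_def f'_def simple_sig_linear_mult[OF monic_poly_nonzero] by (simp del: mult_pCons_left)
      qed (auto simp: g_def)
      then show "ennreal c * ennreal (g ?q * of_bool (simple_sig a ?q)) = ennreal (\<bar>poly ?q x\<bar> * f' ([:-x, 1:] * ?q))"
        using c g by (simp add: ennreal_mult[symmetric])
    qed
    finally show ?thesis .
  qed
  have "(\<integral>\<^sup>+v. ennreal (f (root_poly r s (Suc a) b v) * jac_weight r s (Suc a) b v) \<partial>lborel_vec (root_index r s (Suc a) b)) =
    (\<integral>\<^sup>+x. \<integral>\<^sup>+v. ennreal (f (root_poly r s (Suc a) b (v(a := x))) * jac_weight r s (Suc a) b (v(a := x))) \<partial>lborel_vec ?I \<partial>lborel)"
    unfolding I using notin rm by (intro nn_integral_lborel_vec_insert_rev) auto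
  also have "\<dots> = of_nat (Suc a) * (\<integral>\<^sup>+v. ennreal (f' (monic_poly (Suc ?m) v)) \<partial>lborel_vec {..<Suc ?m})"
    unfolding lin
  proof (rule nn_integral_linear_times_monic_poly[OF f' f'm])
    fix p :: "real poly" assume p: "degree p = Suc ?m" "lead_coeff p = 1" "f' p \<noteq> 0"
    then have sig: "simple_sig (Suc a) p" by (simp add: f'_def)
    then have "{x. poly (pderiv p) x \<noteq> 0 \<and> poly p x = 0} = {x. poly p x = 0}"
      using simple_roots_real by (auto simp: simple_sig_def)
    then show "card {x. poly (pderiv p) x \<noteq> 0 \<and> poly p x = 0} = Suc a"
      using sig by (simp add: simple_sig_def)
  qed
  also have "\<dots> = ennreal (real (Suc a) * c) * (\<integral>\<^sup>+v. ennreal (f (monic_poly (Suc ?m) v) *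
      of_bool (simple_sig (Suc a) (monic_poly (Suc ?m) v))) \<partial>lborel_vec {..<Suc ?m})"
  proof -
    have "(\<integral>\<^sup>+v. ennreal (f' (monic_poly (Suc ?m) v)) \<partial>lborel_vec {..<Suc ?m}) =
      (\<integral>\<^sup>+v. ennreal c * ennreal (f (monic_poly (Suc ?m) v) *
        of_bool (simple_sig (Suc a) (monic_poly (Suc ?m) v))) \<partial>lborel_vec {..<Suc ?m})"
      unfolding f'_def using c Suc.prems(1) by (intro nn_integral_cong ennreal_mult) auto
    also have "\<dots> = ennreal c * (\<integral>\<^sup>+v. ennreal (f (monic_poly (Suc ?m) v) *
        of_bool (simple_sig (Suc a) (monic_poly (Suc ?m) v))) \<partial>lborel_vec {..<Suc ?m})"
      by (rule nn_integral_cmult[OF measurable_compose[OF measurable_times_simple_sig[OF fm] measurable_ennreal]])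
    finally show ?thesis by (rule of_nat_times_ennreal) (use c in simp)
  qed
  also have "real (Suc a) * c = fact (Suc a) * fact b / 2 ^ b"
    by (simp add: c_def field_simps)
  finally show ?case by simp
qed

section \<open>Regions of monic polynomials\<close>

text \<open>Translates between the order of the statement, constant coefficient first, and that of
  \<open>monic_poly\<close>, highest coefficient first.\<close>

definition reverse_vec :: "nat \<Rightarrow> (nat \<Rightarrow> real) \<Rightarrow> nat \<Rightarrow> real" where
  "reverse_vec d v = (\<lambda>i\<in>{..<d}. v (d - 1 - i))"

lemma measurable_reverse_vec: "reverse_vec d \<in> lborel_vec {..<d} \<rightarrow>\<^sub>M lborel_vec {..<d}"
  unfolding reverse_vec_def by (intro measurable_restrict measurable_component_singleton) auto

lemma distr_reverse_vec: "distr (lborel_vec {..<d}) (lborel_vec {..<d}) (reverse_vec d) = lborel_vec {..<d}"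
proof (rule product_sigma_finite.PiM_eqI[OF product_sigma_finite_lborel])
  fix A :: "nat \<Rightarrow> real set" assume A: "\<And>i. i \<in> {..<d} \<Longrightarrow> A i \<in> sets lborel"
  have emeasure_PiE: "emeasure (lborel_vec {..<d}) (Pi\<^sub>E {..<d} C) = (\<Prod>i<d. emeasure lborel (C i))"
    if "\<And>i. i \<in> {..<d} \<Longrightarrow> C i \<in> sets lborel" for C
    using that by (intro product_sigma_finite.emeasure_PiM[OF product_sigma_finite_lborel]) auto
  have "reverse_vec d -` Pi\<^sub>E {..<d} A \<inter> space (lborel_vec {..<d}) = (\<Pi>\<^sub>E i\<in>{..<d}. A (d - Suc i))"
  proof -
    have idx: "d - Suc i < d" "d - Suc (d - Suc i) = i" if "i < d" for i using that by auto
    show ?thesis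
    proof (rule Set.set_eqI)
      fix v
      have "v \<in> reverse_vec d -` Pi\<^sub>E {..<d} A \<inter> space (lborel_vec {..<d}) \<longleftrightarrow>
          v \<in> extensional {..<d} \<and> (\<forall>i<d. v (d - Suc i) \<in> A i)"
        by (auto simp: reverse_vec_def space_PiM PiE_iff)
      also have "(\<forall>i<d. v (d - Suc i) \<in> A i) \<longleftrightarrow> (\<forall>i<d. v i \<in> A (d - Suc i))"
        using idx by metis
      also have "v \<in> extensional {..<d} \<and> \<dots> \<longleftrightarrow> v \<in> (\<Pi>\<^sub>E i\<in>{..<d}. A (d - Suc i))"
        by (auto simp: PiE_iff)
      finally show "v \<in> reverse_vec d -` Pi\<^sub>E {..<d} A \<inter> space (lborel_vec {..<d}) \<longleftrightarrow>
          v \<in> (\<Pi>\<^sub>E i\<in>{..<d}. A (d - Suc i))" .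
    qed
  qed
  then have "emeasure (distr (lborel_vec {..<d}) (lborel_vec {..<d}) (reverse_vec d)) (Pi\<^sub>E {..<d} A)
      = emeasure (lborel_vec {..<d}) (\<Pi>\<^sub>E i\<in>{..<d}. A (d - Suc i))"
    using A by (subst emeasure_distr[OF measurable_reverse_vec]) (auto intro!: sets_PiM_I_finite)
  also have "\<dots> = (\<Prod>i<d. emeasure lborel (A (d - Suc i)))"
    using A by (intro emeasure_PiE) auto
  also have "\<dots> = (\<Prod>i<d. emeasure lborel (A i))" by (rule prod.nat_diff_reindex)
  finally show "emeasure (distr (lborel_vec {..<d}) (lborel_vec {..<d}) (reverse_vec d)) (Pi\<^sub>E {..<d} A) = (\<Prod>i<d. emeasure lborel (A i))" .
qed simp_all

lemma nn_integral_reverse_vec: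
  assumes "h \<in> borel_measurable (lborel_vec {..<d})"
  shows "(\<integral>\<^sup>+v. h (reverse_vec d v) \<partial>lborel_vec {..<d}) = integral\<^sup>N (lborel_vec {..<d}) h"
  using nn_integral_distr[OF measurable_reverse_vec, of h d] assms unfolding distr_reverse_vec by simp

section \<open>Scaling, null sets and Borel versions of the coefficient sets\<close>

lemma nn_integral_lborel_vec_scale:
  fixes c :: real
  assumes "c > 0" "h \<in> borel_measurable (lborel_vec {..<m})"
  shows "integral\<^sup>N (lborel_vec {..<m}) h = ennreal (c ^ m) * (\<integral>\<^sup>+v. h (\<lambda>i\<in>{..<m}. c * v i) \<partial>lborel_vec {..<m})"
  using assms(2)
proof (induction m arbitrary: h)
  case 0
  show ?case by (simp add: PiM_empty nn_integral_count_space_finite restrict_def)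
next
  case (Suc m)
  define T where "T k v = (\<lambda>i\<in>{..<k}. c * v i)" for k and v :: "nat \<Rightarrow> real"
  have T[measurable]: "T k \<in> lborel_vec {..<k} \<rightarrow>\<^sub>M lborel_vec {..<k}" for k
    unfolding T_def by measurable
  note hm = measurable_lborel_vec_upd[OF Suc.prems]
  have T_upd: "T (Suc m) (v(m := t)) = (T m v)(m := c * t)" for v t
    unfolding T_def by (auto simp: fun_eq_iff restrict_def)
  have hTm: "(\<lambda>v. h (T (Suc m) v)) \<in> borel_measurable (lborel_vec {..<Suc m})"
    using Suc.prems by (intro measurable_compose[OF T])
  have inner: "(\<lambda>v. \<integral>\<^sup>+t. h (v(m := t)) \<partial>lborel) \<in> borel_measurable (lborel_vec {..<m})"
    using hm by (intro lborel.borel_measurable_nn_integral)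
  have "integral\<^sup>N (lborel_vec {..<Suc m}) h = (\<integral>\<^sup>+v. \<integral>\<^sup>+t. h (v(m := t)) \<partial>lborel \<partial>lborel_vec {..<m})"
    using Suc.prems by (rule nn_integral_lborel_vec_lessThan_Suc)
  also have "\<dots> = ennreal (c ^ m) * (\<integral>\<^sup>+v. \<integral>\<^sup>+t. h ((T m v)(m := t)) \<partial>lborel \<partial>lborel_vec {..<m})"
    unfolding T_def by (rule Suc.IH[OF inner])
  also have "(\<integral>\<^sup>+v. \<integral>\<^sup>+t. h ((T m v)(m := t)) \<partial>lborel \<partial>lborel_vec {..<m}) =
      (\<integral>\<^sup>+v. ennreal c * (\<integral>\<^sup>+t. h ((T m v)(m := c * t)) \<partial>lborel) \<partial>lborel_vec {..<m})"
  proof (rule nn_integral_cong)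
    fix v assume "v \<in> space (lborel_vec {..<m})"
    then have "T m v \<in> space (lborel_vec {..<m})" by (rule measurable_space[OF T])
    then have "(\<lambda>t. h ((T m v)(m := t))) \<in> borel_measurable lborel"
      using measurable_Pair2[OF hm, of "T m v"] by (simp add: fun_upd_def)
    then show "(\<integral>\<^sup>+t. h ((T m v)(m := t)) \<partial>lborel) = ennreal c * (\<integral>\<^sup>+t. h ((T m v)(m := c * t)) \<partial>lborel)"
      using assms(1) nn_integral_real_affine[of "\<lambda>t. h ((T m v)(m := t))" c 0] by simp
  qed
  also have "\<dots> = ennreal c * (\<integral>\<^sup>+v. \<integral>\<^sup>+t. h ((T m v)(m := c * t)) \<partial>lborel \<partial>lborel_vec {..<m})"
    using measurable_lborel_vec_upd[OF hTm] unfolding T_upd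
    by (intro nn_integral_cmult lborel.borel_measurable_nn_integral)
  also have "(\<integral>\<^sup>+v. \<integral>\<^sup>+t. h ((T m v)(m := c * t)) \<partial>lborel \<partial>lborel_vec {..<m}) = (\<integral>\<^sup>+v. h (T (Suc m) v) \<partial>lborel_vec {..<Suc m})"
    unfolding nn_integral_lborel_vec_lessThan_Suc[OF hTm] T_upd ..
  finally have eq: "integral\<^sup>N (lborel_vec {..<Suc m}) h =
    ennreal (c ^ m) * (ennreal c * (\<integral>\<^sup>+v. h (T (Suc m) v) \<partial>lborel_vec {..<Suc m}))" .
  have "ennreal (c ^ Suc m) = ennreal (c ^ m) * ennreal c"
    using assms(1) by (simp add: ennreal_mult mult.commute)
  then show ?case using eq unfolding T_def by (simp only: mult.assoc)
qed

text \<open>H differs from X only inside a null set, which makes H measurable in the completion. A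
  set described by multisets of roots can thus be measured through a Borel one.\<close>

lemma measure_completion_AE:
  assumes X: "X \<in> sets M" and H: "H \<subseteq> space M" and ae: "AE x in M. x \<in> H \<longleftrightarrow> x \<in> X"
  shows "measure (completion M) H = measure M X"
proof -
  obtain N where N: "{x \<in> space M. \<not> (x \<in> H \<longleftrightarrow> x \<in> X)} \<subseteq> N" "N \<in> null_sets M"
    using ae by (auto elim!: AE_E intro: null_setsI)
  have "H = (X - N) \<union> (H \<inter> N)" using N(1) H sets.sets_into_space[OF X] by blast
  moreover have "X - N \<in> sets (completion M)" using X N(2) by auto
  moreover have "H \<inter> N \<in> sets (completion M)"
    using null_sets_completion_subset[of "H \<inter> N" N M] N(2) null_sets_completionI by blast
  ultimately have HS: "H \<in> sets (completion M)" by (metis sets.Un)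
  have "emeasure (completion M) H = emeasure (completion M) X"
    using AE_completion[OF ae] HS X by (intro emeasure_eq_AE) auto
  then show ?thesis using X by (simp add: measure_def)
qed

lemma coeff_poly_of_vec: "coeff (poly_of_vec d p) j = (if j \<le> d then p j else 0)"
proof -
  have "(\<Sum>i\<le>d. coeff (monom (p i) i) j) = (\<Sum>i\<le>d. if i = j then p i else 0)"
    by (rule sum.cong) auto
  then show ?thesis by (simp add: poly_of_vec_def coeff_sum)
qed

abbreviation monic_of_vec :: "nat \<Rightarrow> (nat \<Rightarrow> real) \<Rightarrow> real poly" where
  "monic_of_vec d p \<equiv> poly_of_vec d (p(d := 1))"

lemma monic_of_vec_eq: "monic_of_vec d p = monic_poly d (reverse_vec d p)"
  by (intro poly_eqI) (auto simp: coeff_poly_of_vec coeff_monic_poly reverse_vec_def)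

lemma monic_of_vec_reverse: "monic_of_vec d (reverse_vec d v) = monic_poly d v"
  by (intro poly_eqI) (auto simp: coeff_poly_of_vec coeff_monic_poly reverse_vec_def)

lemma measurable_pred_monic_of_vec:
  assumes "Measurable.pred (lborel_vec {..<d}) (\<lambda>v. Q (monic_poly d v))"
    and "\<And>i. i < d \<Longrightarrow> (\<lambda>\<omega>. p \<omega> i) \<in> borel_measurable M"
  shows "Measurable.pred M (\<lambda>\<omega>. Q (monic_of_vec d (p \<omega>)))"
proof (rule measurable_poly_fun[OF assms(1)])
  show "(\<lambda>\<omega>. coeff (monic_of_vec d (p \<omega>)) j) \<in> borel_measurable M" for j
    unfolding coeff_poly_of_vec using assms(2) by (cases "j < d"; cases "j = d") auto
qed (auto simp: monic_of_vec_eq)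

lemma measurable_coord: "i \<in> I \<Longrightarrow> (\<lambda>v. v i) \<in> borel_measurable (lborel_vec I)"
  using measurable_component_singleton[of i I "\<lambda>_. lborel :: real measure"] by simp

lemma measurable_coord_bound:
  assumes "{..<d} \<subseteq> I"
  shows "{p \<in> space (lborel_vec I). \<forall>i<d. \<bar>p i\<bar> \<le> B} \<in> sets (lborel_vec I)"
proof -
  have "Measurable.pred (lborel_vec I) (\<lambda>p. \<forall>i\<in>{..<d}. \<bar>p i\<bar> \<le> B)"
  proof (rule pred_intros_finite)
    fix i assume "i \<in> {..<d}"
    then have [measurable]: "(\<lambda>p. p i) \<in> borel_measurable (lborel_vec I)" using assms by (intro measurable_coord) auto
    show "Measurable.pred (lborel_vec I) (\<lambda>p. \<bar>p i\<bar> \<le> B)" by measurable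
  qed simp
  from predE[OF this] show ?thesis by (simp only: Ball_def lessThan_iff)
qed

lemma AE_simple_roots_monic_of_vec: "AE p in lborel_vec {..<d}. simple_roots (monic_of_vec d p)"
  unfolding monic_of_vec_eq
  by (rule AE_distrD[OF measurable_reverse_vec, of "\<lambda>v. simple_roots (monic_poly d v)"])
     (simp only: distr_reverse_vec AE_simple_roots)

text \<open>The Borel counterpart of \<open>Hcoeff_monic\<close>, with a the number of real roots:
  excluding multiple roots changes only a null set.\<close>

definition simple_region :: "nat \<Rightarrow> nat \<Rightarrow> real \<Rightarrow> (nat \<Rightarrow> real) set" where
  "simple_region d a B = {p \<in> space (lborel_vec {..<d}). (\<forall>i<d. \<bar>p i\<bar> \<le> B) \<and> simple_sig a (monic_of_vec d p)}"

lemma sets_simple_region: "simple_region d a B \<in> sets (lborel_vec {..<d})"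
  unfolding simple_region_def
  by (intro sets.sets_Collect_conj measurable_coord_bound order_refl
        predE[OF measurable_pred_monic_of_vec[OF measurable_simple_sig]] measurable_coord) auto

lemma emeasure_simple_region_finite: "emeasure (lborel_vec {..<d}) (simple_region d a B) < \<infinity>"
proof -
  have "simple_region d a B \<subseteq> (\<Pi>\<^sub>E i\<in>{..<d}. {-B..B})"
    by (auto simp: simple_region_def space_PiM PiE_iff abs_le_iff extensional_def)
  then have "emeasure (lborel_vec {..<d}) (simple_region d a B) \<le> emeasure (lborel_vec {..<d}) (\<Pi>\<^sub>E i\<in>{..<d}. {-B..B})"
    by (intro emeasure_mono) (auto intro!: sets_PiM_I_finite)
  also have "\<dots> = (\<Prod>i<d. emeasure lborel {-B..B})"
    by (intro product_sigma_finite.emeasure_PiM[OF product_sigma_finite_lborel]) auto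
  also have "\<dots> < \<infinity>" by (simp add: power_less_top_ennreal emeasure_lborel_Icc_eq)
  finally show ?thesis .
qed

lemma measure_Hcoeff_monic:
  assumes "d = r + 2 * s"
  shows "measure (lebesgue_vec d) (Hcoeff_monic d s B) = measure (lborel_vec {..<d}) (simple_region d r B)"
proof -
  have ae: "AE p in lborel_vec {..<d}. p \<in> Hcoeff_monic d s B \<longleftrightarrow> p \<in> simple_region d r B"
    using AE_simple_roots_monic_of_vec[of d] AE_space
  proof eventually_elim
    case (elim p)
    have "has_signature (monic_of_vec d p) s \<longleftrightarrow> simple_sig r (monic_of_vec d p)"
      using elim(1) assms by (intro has_signature_simple_roots) (auto simp: monic_of_vec_eq)
    then show ?case using elim(2) by (auto simp: Hcoeff_monic_def simple_region_def space_PiM PiE_def)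
  qed
  have sub: "Hcoeff_monic d s B \<subseteq> space (lborel_vec {..<d})"
    by (auto simp: Hcoeff_monic_def space_PiM PiE_def)
  show ?thesis
    unfolding lebesgue_vec_def by (rule measure_completion_AE[OF sets_simple_region sub ae])
qed

section \<open>The root side\<close>

text \<open>Vieta's formula, by expanding the product over the sets A of factors that contribute
  their constant term.\<close>

lemma coeff_prod_linear_factors:
  fixes xs :: "'a::comm_ring_1 list"
  assumes "j \<le> length xs"
  shows "coeff (\<Prod>x\<leftarrow>xs. [:- x, 1:]) (length xs - j) = (- 1) ^ j * elem_sym j xs"
proof -
  let ?n = "length xs"
  have "(\<Prod>x\<leftarrow>xs. [:- x, 1:]) = (\<Prod>i<?n. [:- (xs ! i):] + monom 1 1)"
    by (subst prod.list_conv_set_nth) (auto simp: atLeast0LessThan monom_altdef intro!: prod.cong)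
  also have "\<dots> = (\<Sum>A\<in>Pow {..<?n}. (\<Prod>i\<in>A. [:- (xs ! i):]) * (\<Prod>i\<in>{..<?n} - A. monom 1 1))"
    by (rule prod_add) simp
  also have "\<dots> = (\<Sum>A\<in>Pow {..<?n}. monom ((- 1) ^ card A * (\<Prod>i\<in>A. xs ! i)) (?n - card A))"
  proof (rule sum.cong)
    fix A assume A: "A \<in> Pow {..<?n}"
    then have fin: "finite A" using finite_subset by auto
    have "(\<Prod>i\<in>A. [:- (xs ! i):]) = [:(- 1) ^ card A * (\<Prod>i\<in>A. xs ! i):]"
      using fin by (induction A rule: finite_induct) (auto simp: mult_ac)
    moreover have "(\<Prod>i\<in>{..<?n} - A. monom 1 1 :: 'a poly) = monom 1 (?n - card A)"
      using A fin by (simp add: card_Diff_subset monom_power)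
    ultimately show "(\<Prod>i\<in>A. [:- (xs ! i):]) * (\<Prod>i\<in>{..<?n} - A. monom 1 1) =
        monom ((- 1) ^ card A * (\<Prod>i\<in>A. xs ! i)) (?n - card A)"
      by (simp add: smult_monom)
  qed simp
  finally have "coeff (\<Prod>x\<leftarrow>xs. [:- x, 1:]) (?n - j) =
      (\<Sum>A\<in>Pow {..<?n}. if ?n - card A = ?n - j then (- 1) ^ card A * (\<Prod>i\<in>A. xs ! i) else 0)"
    by (simp add: coeff_sum)
  also have "\<dots> = (\<Sum>A\<in>{A\<in>Pow {..<?n}. card A = j}. (- 1) ^ card A * (\<Prod>i\<in>A. xs ! i))"
  proof (subst sum.inter_filter, simp, rule sum.cong[OF refl])
    fix A assume "A \<in> Pow {..<?n}"
    then have "card A \<le> ?n" using card_mono[of "{..<?n}" A] by auto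
    \<comment> \<open>Both card A and j are at most \<open>?n\<close>, so truncated subtraction
      loses nothing.\<close>
    then have "?n - card A = ?n - j \<longleftrightarrow> card A = j" using assms by auto
    then show "(if ?n - card A = ?n - j then (- 1) ^ card A * (\<Prod>i\<in>A. xs ! i) else 0) =
        (if card A = j then (- 1) ^ card A * (\<Prod>i\<in>A. xs ! i) else 0)" by simp
  qed
  also have "\<dots> = (- 1) ^ j * elem_sym j xs"
    unfolding elem_sym_def sum_distrib_left by (intro sum.cong) auto
  finally show ?thesis .
qed

lemma length_root_list: "length (root_list r s v) = r + 2 * s"
proof -
  have "length (concat (map (\<lambda>j. [f j, g j]) [0..<n])) = 2 * n" for f g :: "nat \<Rightarrow> complex" and n
    by (induction n) auto
  then show ?thesis by (simp add: root_list_def)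
qed

lemma prod_root_list: "(\<Prod>x\<leftarrow>root_list r s v. [:- x, 1:]) = map_poly complex_of_real (root_poly r s r s v)"
proof -
  have hom: "map_poly complex_of_real (\<Prod>j\<in>J. p j) = (\<Prod>j\<in>J. map_poly complex_of_real (p j))" for J :: "nat set" and p
    by (induction J rule: infinite_finite_induct) (auto simp: map_poly_of_real_mult)
  have lin: "map_poly complex_of_real [:- x, 1:] = [:- of_real x, 1:]" for x by simp
  have quad: "map_poly complex_of_real (Rpoly r s v j) =
      [:- Complex (yc r v j) (zc r s v j), 1:] * [:- Complex (yc r v j) (- zc r s v j), 1:]" for j
    by (simp add: Rpoly_def complex_eq_iff power2_eq_square)
  have prod_upt: "(\<Prod>j\<leftarrow>[0..<n]. g j) = (\<Prod>j<n. g j)" for g :: "nat \<Rightarrow> complex poly" and n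
    by (induction n) auto
  have concat: "(\<Prod>x\<leftarrow>concat (map h js). g x) = (\<Prod>j\<leftarrow>js. \<Prod>x\<leftarrow>h j. g x)"
    for h :: "nat \<Rightarrow> complex list" and js and g :: "complex \<Rightarrow> complex poly"
    by (induction js) auto
  show ?thesis
    unfolding root_list_def root_poly_def map_poly_of_real_mult hom lin quad
    by (simp add: concat prod_upt o_def xc_def del: mult_pCons_left mult_pCons_right)
qed

lemma elem_sym_root_list:
  assumes "j \<le> r + 2 * s"
  shows "elem_sym j (root_list r s v) = of_real ((- 1) ^ j * coeff (root_poly r s r s v) (r + 2 * s - j))"
proof -
  have "complex_of_real (coeff (root_poly r s r s v) (r + 2 * s - j)) = (- 1) ^ j * elem_sym j (root_list r s v)"
    using coeff_prod_linear_factors[of j "root_list r s v"] assms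
    unfolding prod_root_list length_root_list by simp
  then have "complex_of_real ((- 1) ^ j * coeff (root_poly r s r s v) (r + 2 * s - j)) =
      ((- 1) ^ j * (- 1) ^ j) * elem_sym j (root_list r s v)" by simp
  then show ?thesis by (simp add: power_mult_distrib[symmetric])
qed

text \<open>The weight to which \<open>nn_integral_roots_eq_coeffs\<close> is applied.\<close>

definition coeff_box :: "nat \<Rightarrow> real \<Rightarrow> real poly \<Rightarrow> real" where
  "coeff_box d B p = of_bool (\<forall>i<d. \<bar>coeff p i\<bar> \<le> B)"

text \<open>By Vieta, S_j is up to the sign (-1)^j the coefficient of X^(d - j), and the interval
  [-B, B] is symmetric.\<close>

lemma Hroots_iff:
  assumes "d = r + 2 * s" "v \<in> space (lborel_vec {..<d})"
  shows "v \<in> Hroots d s B \<longleftrightarrow> (\<forall>j<s. zc r s v j \<noteq> 0) \<and> (\<forall>i<d. \<bar>coeff (root_poly r s r s v) i\<bar> \<le> B)"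
proof -
  have r: "d - 2 * s = r" using assms(1) by simp
  have "elem_sym j (root_list r s v) \<in> complex_of_real ` {-B..B} \<longleftrightarrow> \<bar>coeff (root_poly r s r s v) (d - j)\<bar> \<le> B"
    if "j \<in> {1..d}" for j
  proof -
    have "elem_sym j (root_list r s v) = of_real ((- 1) ^ j * coeff (root_poly r s r s v) (d - j))"
      using elem_sym_root_list[of j r s v] that assms(1) by simp
    then have "elem_sym j (root_list r s v) \<in> complex_of_real ` {-B..B} \<longleftrightarrow>
        (- 1) ^ j * coeff (root_poly r s r s v) (d - j) \<in> {-B..B}"
      by (simp only: inj_image_mem_iff[OF inj_of_real])
    also have "\<dots> \<longleftrightarrow> \<bar>(- 1) ^ j * coeff (root_poly r s r s v) (d - j)\<bar> \<le> B"
      by (auto simp: abs_le_iff)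
    also have "\<bar>(- 1) ^ j * coeff (root_poly r s r s v) (d - j)\<bar> = \<bar>coeff (root_poly r s r s v) (d - j)\<bar>"
      by (simp add: abs_mult power_abs)
    finally show ?thesis .
  qed
  then have "(\<forall>j\<in>{1..d}. elem_sym j (root_list r s v) \<in> complex_of_real ` {-B..B}) \<longleftrightarrow>
      (\<forall>j\<in>{1..d}. \<bar>coeff (root_poly r s r s v) (d - j)\<bar> \<le> B)" by blast
  also have "\<dots> \<longleftrightarrow> (\<forall>i<d. \<bar>coeff (root_poly r s r s v) i\<bar> \<le> B)"
  proof (safe)
    fix i assume h: "\<forall>j\<in>{1..d}. \<bar>coeff (root_poly r s r s v) (d - j)\<bar> \<le> B" and i: "i < d"
    have "d - (d - i) = i" "d - i \<in> {1..d}" using i by auto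
    then show "\<bar>coeff (root_poly r s r s v) i\<bar> \<le> B" using h by metis
  next
    fix j assume h: "\<forall>i<d. \<bar>coeff (root_poly r s r s v) i\<bar> \<le> B" and j: "j \<in> {1..d}"
    then have "d - j < d" by auto
    then show "\<bar>coeff (root_poly r s r s v) (d - j)\<bar> \<le> B" using h by blast
  qed
  finally show ?thesis
    using assms(2) unfolding Hroots_def r by (auto simp: space_PiM PiE_def)
qed

lemma coeff_box_measurable:
  assumes "\<And>i. i < d \<Longrightarrow> (\<lambda>\<omega>. coeff (p \<omega>) i) \<in> borel_measurable M"
  shows "(\<lambda>\<omega>. coeff_box d B (p \<omega>)) \<in> borel_measurable M"
proof -
  have "Measurable.pred M (\<lambda>\<omega>. \<forall>i\<in>{..<d}. \<bar>coeff (p \<omega>) i\<bar> \<le> B)"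
  proof (rule pred_intros_finite)
    fix i assume "i \<in> {..<d}"
    then have [measurable]: "(\<lambda>\<omega>. coeff (p \<omega>) i) \<in> borel_measurable M" using assms by auto
    show "Measurable.pred M (\<lambda>\<omega>. \<bar>coeff (p \<omega>) i\<bar> \<le> B)" by measurable
  qed simp
  from predE[OF this] have "{\<omega> \<in> space M. \<forall>i<d. \<bar>coeff (p \<omega>) i\<bar> \<le> B} \<in> sets M"
    by (simp only: lessThan_iff Ball_def)
  then have "(indicator {\<omega> \<in> space M. \<forall>i<d. \<bar>coeff (p \<omega>) i\<bar> \<le> B} :: _ \<Rightarrow> real) \<in> borel_measurable M"
    by (rule borel_measurable_indicator)
  then show ?thesis
    by (rule measurable_cong[THEN iffD1, rotated]) (simp add: coeff_box_def indicator_def)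
qed

lemma emeasure_simple_region:
  "emeasure (lborel_vec {..<d}) (simple_region d a B) =
    (\<integral>\<^sup>+v. ennreal (coeff_box d B (monic_poly d v) * of_bool (simple_sig a (monic_poly d v))) \<partial>lborel_vec {..<d})"
proof -
  have "emeasure (lborel_vec {..<d}) (simple_region d a B) =
      (\<integral>\<^sup>+p. indicator (simple_region d a B) p \<partial>lborel_vec {..<d})"
    by (simp add: sets_simple_region)
  also have "\<dots> = (\<integral>\<^sup>+v. indicator (simple_region d a B) (reverse_vec d v) \<partial>lborel_vec {..<d})"
    by (rule nn_integral_reverse_vec[OF borel_measurable_indicator[OF sets_simple_region], symmetric])
  also have "\<dots> = (\<integral>\<^sup>+v. ennreal (coeff_box d B (monic_poly d v) * of_bool (simple_sig a (monic_poly d v))) \<partial>lborel_vec {..<d})"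
  proof (rule nn_integral_cong)
    fix v assume "v \<in> space (lborel_vec {..<d})"
    then have sp: "reverse_vec d v \<in> space (lborel_vec {..<d})" by (rule measurable_space[OF measurable_reverse_vec])
    have "(\<forall>i<d. \<bar>reverse_vec d v i\<bar> \<le> B) \<longleftrightarrow> (\<forall>i<d. \<bar>coeff (monic_poly d v) i\<bar> \<le> B)"
      by (simp add: coeff_monic_poly reverse_vec_def)
    then have "reverse_vec d v \<in> simple_region d a B \<longleftrightarrow>
        (\<forall>i<d. \<bar>coeff (monic_poly d v) i\<bar> \<le> B) \<and> simple_sig a (monic_poly d v)"
      using sp unfolding simple_region_def mem_Collect_eq monic_of_vec_reverse by blast
    then show "indicator (simple_region d a B) (reverse_vec d v) =
        ennreal (coeff_box d B (monic_poly d v) * of_bool (simple_sig a (monic_poly d v)))"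
      unfolding coeff_box_def indicator_def by simp
  qed
  finally show ?thesis .
qed

proposition measure_simple_region_eq_integral:
  assumes "d = r + 2 * s"
  shows "measure (lborel_vec {..<d}) (simple_region d r B) = 2 ^ s / (fact r * fact s) *
    (LINT v:Hroots d s B|lebesgue_vec d.
       \<bar>Delta_real r v\<bar> * Delta_cplx r s v * Delta_mixed r s v * (\<Prod>j<s. \<bar>zc r s v j\<bar>))"
proof -
  define F where "F v = \<bar>Delta_real r v\<bar> * Delta_cplx r s v * Delta_mixed r s v * (\<Prod>j<s. \<bar>zc r s v j\<bar>)" for v
  define G where "G v = coeff_box d B (root_poly r s r s v) * jac_weight r s r s v" for v
  have F: "F v = jac_weight r s r s v" for v
    by (simp add: F_def jac_weight_def Delta_real_def Delta_cplx_def Delta_mixed_def xc_def)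
  have idx: "root_index r s r s = {..<d}" using assms by (auto simp: root_index_def)
  have G0: "0 \<le> G v" for v by (simp add: G_def coeff_box_def jac_weight_nonneg)
  have Gm: "G \<in> borel_measurable (lborel_vec {..<d})"
    unfolding G_def
    by (intro borel_measurable_times coeff_box_measurable measurable_coeff_root_poly measurable_jac_weight) (auto simp: idx)
  have "(LINT v:Hroots d s B|lebesgue_vec d. F v) = (LINT v|lebesgue_vec d. G v)"
    unfolding set_lebesgue_integral_def lebesgue_vec_def
  proof (rule Bochner_Integration.integral_cong[OF refl])
    fix v assume "v \<in> space (completion (lborel_vec {..<d}))"
    then have v: "v \<in> space (lborel_vec {..<d})" by simp
    show "indicator (Hroots d s B) v *\<^sub>R F v = G v"
    proof (cases "\<forall>j<s. zc r s v j \<noteq> 0")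
      case True
      then show ?thesis
        using Hroots_iff[OF assms v, of B] by (simp add: F G_def coeff_box_def indicator_def)
    next
      case False
      \<comment> \<open>The vectors with some z_j = 0, which \<open>Hroots\<close> excludes, have
        weight 0, so G agrees with the restricted integrand there too.\<close>
      then have "jac_weight r s r s v = 0" by (auto simp: jac_weight_def)
      then show ?thesis by (simp add: F G_def)
    qed
  qed
  also have "\<dots> = (LINT v|lborel_vec {..<d}. G v)"
    unfolding lebesgue_vec_def by (rule integral_completion[OF Gm])
  also have "\<dots> = enn2real (\<integral>\<^sup>+v. ennreal (G v) \<partial>lborel_vec {..<d})"
    using G0 by (intro integral_eq_nn_integral[OF Gm]) auto
  also have "(\<integral>\<^sup>+v. ennreal (G v) \<partial>lborel_vec {..<d}) =
      ennreal (fact r * fact s / 2 ^ s) * emeasure (lborel_vec {..<d}) (simple_region d r B)"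
  proof -
    have "(\<lambda>v. coeff_box d B (monic_poly (r + 2 * s) v)) \<in> borel_measurable (lborel_vec {..<r + 2 * s})"
      by (intro coeff_box_measurable measurable_coeff_monic_poly)
    then have "(\<integral>\<^sup>+v. ennreal (coeff_box d B (root_poly r s r s v) * jac_weight r s r s v) \<partial>lborel_vec (root_index r s r s)) =
      ennreal (fact r * fact s / 2 ^ s) * (\<integral>\<^sup>+v. ennreal (coeff_box d B (monic_poly (r + 2 * s) v) *
        of_bool (simple_sig r (monic_poly (r + 2 * s) v))) \<partial>lborel_vec {..<r + 2 * s})"
      by (intro nn_integral_roots_eq_coeffs) (auto simp: coeff_box_def)
    then show ?thesis unfolding emeasure_simple_region G_def idx assms[symmetric] .
  qed
  finally have "(LINT v:Hroots d s B|lebesgue_vec d. F v) =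
      (fact r * fact s / 2 ^ s) * measure (lborel_vec {..<d}) (simple_region d r B)"
    by (simp add: enn2real_mult measure_def)
  then show ?thesis unfolding F_def by simp
qed

section \<open>The cone over the monic polynomials\<close>

text \<open>Dividing by the leading coefficient \<open>t\<close> maps the slice of height \<open>t\<close> onto a monic region of height \<open>B / t\<close>.\<close>

lemma emeasure_simple_region_scale:
  assumes "t > 0"
  shows "(\<integral>\<^sup>+v. of_bool ((\<forall>i<d. \<bar>v i\<bar> \<le> B) \<and> simple_sig a (monic_of_vec d (\<lambda>i. v i / t))) \<partial>lborel_vec {..<d}) =
    ennreal (t ^ d) * emeasure (lborel_vec {..<d}) (simple_region d a (B / t))"
proof -
  let ?h = "\<lambda>v. of_bool ((\<forall>i<d. \<bar>v i\<bar> \<le> B) \<and> simple_sig a (monic_of_vec d (\<lambda>i. v i / t))) :: ennreal"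
  have "{v \<in> space (lborel_vec {..<d}). (\<forall>i<d. \<bar>v i\<bar> \<le> B) \<and> simple_sig a (monic_of_vec d (\<lambda>i. v i / t))} \<in> sets (lborel_vec {..<d})"
    by (intro sets.sets_Collect_conj measurable_coord_bound borel_measurable_divide borel_measurable_const
        predE[OF measurable_pred_monic_of_vec[OF measurable_simple_sig]] measurable_coord) auto
  then have "(indicator {v \<in> space (lborel_vec {..<d}).
      (\<forall>i<d. \<bar>v i\<bar> \<le> B) \<and> simple_sig a (monic_of_vec d (\<lambda>i. v i / t))} :: _ \<Rightarrow> ennreal) \<in> borel_measurable (lborel_vec {..<d})"
    by (rule borel_measurable_indicator)
  then have "?h \<in> borel_measurable (lborel_vec {..<d})"
    by (rule measurable_cong[THEN iffD1, rotated]) (simp add: indicator_def)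
  from nn_integral_lborel_vec_scale[OF assms this]
  have "integral\<^sup>N (lborel_vec {..<d}) ?h = ennreal (t ^ d) * (\<integral>\<^sup>+v. ?h (\<lambda>i\<in>{..<d}. t * v i) \<partial>lborel_vec {..<d})" .
  also have "(\<integral>\<^sup>+v. ?h (\<lambda>i\<in>{..<d}. t * v i) \<partial>lborel_vec {..<d}) =
      (\<integral>\<^sup>+v. indicator (simple_region d a (B / t)) v \<partial>lborel_vec {..<d})"
  proof (rule nn_integral_cong)
    fix v assume v: "v \<in> space (lborel_vec {..<d})"
    have "monic_of_vec d (\<lambda>i. (\<lambda>i\<in>{..<d}. t * v i) i / t) = monic_of_vec d v"
      using assms by (intro poly_eqI) (auto simp: coeff_poly_of_vec)
    moreover have "(\<forall>i<d. \<bar>(\<lambda>i\<in>{..<d}. t * v i) i\<bar> \<le> B) \<longleftrightarrow> (\<forall>i<d. \<bar>v i\<bar> \<le> B / t)"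
      using assms by (simp add: abs_mult pos_le_divide_eq mult.commute)
    ultimately show "?h (\<lambda>i\<in>{..<d}. t * v i) = indicator (simple_region d a (B / t)) v"
      using v by (simp add: simple_region_def indicator_def)
  qed
  also have "\<dots> = emeasure (lborel_vec {..<d}) (simple_region d a (B / t))"
    by (simp add: sets_simple_region)
  finally show ?thesis .
qed

lemma nn_integral_lborel_vec_lessThan_Suc_rev:
  assumes "f \<in> borel_measurable (lborel_vec {..<Suc m})"
  shows "integral\<^sup>N (lborel_vec {..<Suc m}) f = (\<integral>\<^sup>+t. \<integral>\<^sup>+v. f (v(m := t)) \<partial>lborel_vec {..<m} \<partial>lborel)"
  using assms unfolding lessThan_Suc by (intro nn_integral_lborel_vec_insert_rev) auto

lemma poly_of_vec_scale:
  assumes "p d \<noteq> 0"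
  shows "poly_of_vec d p = Polynomial.smult (p d) (monic_of_vec d (\<lambda>i. p i / p d))"
  using assms by (intro poly_eqI) (auto simp: coeff_poly_of_vec)

lemma has_signature_smult: "c \<noteq> 0 \<Longrightarrow> has_signature (Polynomial.smult c p) s \<longleftrightarrow> has_signature p s"
  by (simp add: has_signature_def of_real_hom.map_poly_hom_smult)

lemma monic_of_vec_cong: "(\<And>i. i < d \<Longrightarrow> p i = q i) \<Longrightarrow> monic_of_vec d p = monic_of_vec d q"
  by (intro poly_eqI) (auto simp: coeff_poly_of_vec)

text \<open>The Borel counterpart of \<open>Hcoeff_plus\<close>, with the signature read off the
  monic multiple of the polynomial.\<close>

definition cone_region :: "nat \<Rightarrow> nat \<Rightarrow> real \<Rightarrow> (nat \<Rightarrow> real) set" where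
  "cone_region d a B = {p \<in> space (lborel_vec {..<Suc d}). 0 < p d \<and> p d \<le> B \<and> (\<forall>i<d. \<bar>p i\<bar> \<le> B) \<and>
     simple_sig a (monic_of_vec d (\<lambda>i. p i / p d))}"

lemma sets_cone_region: "cone_region d a B \<in> sets (lborel_vec {..<Suc d})"
proof -
  have [measurable]: "(\<lambda>p. p d) \<in> borel_measurable (lborel_vec {..<Suc d})" by (rule measurable_coord) simp
  have "{p \<in> space (lborel_vec {..<Suc d}). 0 < p d} \<in> sets (lborel_vec {..<Suc d})"
    "{p \<in> space (lborel_vec {..<Suc d}). p d \<le> B} \<in> sets (lborel_vec {..<Suc d})" by measurable
  then show ?thesis unfolding cone_region_def
    by (intro sets.sets_Collect_conj measurable_coord_bound borel_measurable_divide
        predE[OF measurable_pred_monic_of_vec[OF measurable_simple_sig]] measurable_coord) auto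
qed

text \<open>Slice by the leading coefficient t > 0: each slice is a scaled copy of the null set of
  monic polynomials with a multiple root.\<close>

lemma AE_simple_roots_cone:
  "AE p in lborel_vec {..<Suc d}. 0 < p d \<longrightarrow> simple_roots (monic_of_vec d (\<lambda>i. p i / p d))"
proof -
  define N where "N = {p \<in> space (lborel_vec {..<Suc d}). 0 < p d \<and> \<not> simple_roots (monic_of_vec d (\<lambda>i. p i / p d))}"
  have [measurable]: "(\<lambda>p. p d) \<in> borel_measurable (lborel_vec {..<Suc d})" by (rule measurable_coord) simp
  have [measurable]: "Measurable.pred (lborel_vec {..<Suc d}) (\<lambda>p. simple_roots (monic_of_vec d (\<lambda>i. p i / p d)))"
    by (intro measurable_pred_monic_of_vec[OF measurable_simple_roots] borel_measurable_divide measurable_coord) auto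
  have N: "N \<in> sets (lborel_vec {..<Suc d})" unfolding N_def by measurable
  have zero: "(\<integral>\<^sup>+v. indicator N (v(d := t)) \<partial>lborel_vec {..<d}) = 0" for t
  proof (cases "t > 0")
    case True
    let ?h = "\<lambda>v. of_bool (\<not> simple_roots (monic_of_vec d (\<lambda>i. v i / t))) :: ennreal"
    have "Measurable.pred (lborel_vec {..<d}) (\<lambda>v. simple_roots (monic_of_vec d (\<lambda>i. v i / t)))"
      by (intro measurable_pred_monic_of_vec[OF measurable_simple_roots] borel_measurable_divide
          borel_measurable_const measurable_coord) auto
    then have "Measurable.pred (lborel_vec {..<d}) (\<lambda>v. \<not> simple_roots (monic_of_vec d (\<lambda>i. v i / t)))"
      by measurable
    from predE[OF this] have "(indicator {v \<in> space (lborel_vec {..<d}). \<not> simple_roots (monic_of_vec d (\<lambda>i. v i / t))} :: _ \<Rightarrow> ennreal)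
        \<in> borel_measurable (lborel_vec {..<d})" by (rule borel_measurable_indicator)
    then have "?h \<in> borel_measurable (lborel_vec {..<d})"
      by (rule measurable_cong[THEN iffD1, rotated]) (simp add: indicator_def)
    from nn_integral_lborel_vec_scale[OF True this]
    have "integral\<^sup>N (lborel_vec {..<d}) ?h = ennreal (t ^ d) * (\<integral>\<^sup>+v. ?h (\<lambda>i\<in>{..<d}. t * v i) \<partial>lborel_vec {..<d})" .
    also have "(\<lambda>v. ?h (\<lambda>i\<in>{..<d}. t * v i)) = (\<lambda>v. of_bool (\<not> simple_roots (monic_of_vec d v)))"
    proof
      fix v
      have "monic_of_vec d (\<lambda>i. (\<lambda>i\<in>{..<d}. t * v i) i / t) = monic_of_vec d v"
        using True by (intro monic_of_vec_cong) auto
      then show "?h (\<lambda>i\<in>{..<d}. t * v i) = of_bool (\<not> simple_roots (monic_of_vec d v))" by simp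
    qed
    also have "(\<integral>\<^sup>+v. of_bool (\<not> simple_roots (monic_of_vec d v)) \<partial>lborel_vec {..<d}) = (0 :: ennreal)"
      using AE_simple_roots_monic_of_vec[of d]
      by (subst nn_integral_cong_AE[where v = "\<lambda>_. 0"]) (auto elim!: eventually_mono)
    finally have int0: "integral\<^sup>N (lborel_vec {..<d}) ?h = 0" unfolding mult_zero_right .
    have "indicator N (v(d := t)) \<le> ?h v" for v
    proof -
      have "monic_of_vec d (\<lambda>i. (v(d := t)) i / (v(d := t)) d) = monic_of_vec d (\<lambda>i. v i / t)"
        by (intro monic_of_vec_cong) auto
      then show ?thesis by (auto simp: N_def indicator_def)
    qed
    then have "(\<integral>\<^sup>+v. indicator N (v(d := t)) \<partial>lborel_vec {..<d}) \<le> integral\<^sup>N (lborel_vec {..<d}) ?h"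
      by (intro nn_integral_mono)
    then show ?thesis unfolding int0 by (rule antisym) simp
  qed (simp add: N_def)
  have "emeasure (lborel_vec {..<Suc d}) N = integral\<^sup>N (lborel_vec {..<Suc d}) (indicator N)"
    using N by simp
  also have "\<dots> = 0"
    using N by (subst nn_integral_lborel_vec_lessThan_Suc_rev) (auto simp: zero)
  finally have "N \<in> null_sets (lborel_vec {..<Suc d})" using N by auto
  then show ?thesis by (rule AE_I') (auto simp: N_def)
qed

lemma measure_Hcoeff_plus:
  assumes "d = r + 2 * s"
  shows "measure (lebesgue_vec (Suc d)) (Hcoeff_plus d s B) = measure (lborel_vec {..<Suc d}) (cone_region d r B)"
  unfolding lebesgue_vec_def
proof (rule measure_completion_AE[OF sets_cone_region])
  show "Hcoeff_plus d s B \<subseteq> space (lborel_vec {..<Suc d})"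
    by (auto simp: Hcoeff_plus_def Hcoeff_def space_PiM PiE_def)
  show "AE p in lborel_vec {..<Suc d}. p \<in> Hcoeff_plus d s B \<longleftrightarrow> p \<in> cone_region d r B"
    using AE_simple_roots_cone[of d] AE_space
  proof eventually_elim
    case (elim p)
    show ?case
    proof (cases "0 < p d")
      case True
      have "has_signature (poly_of_vec d p) s \<longleftrightarrow> has_signature (monic_of_vec d (\<lambda>i. p i / p d)) s"
        using True by (subst poly_of_vec_scale) (auto simp: has_signature_smult)
      also have "\<dots> \<longleftrightarrow> simple_sig r (monic_of_vec d (\<lambda>i. p i / p d))"
        using elim(1) True assms by (intro has_signature_simple_roots) (auto simp: monic_of_vec_eq)
      finally have "has_signature (poly_of_vec d p) s \<longleftrightarrow> simple_sig r (monic_of_vec d (\<lambda>i. p i / p d))" .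
      moreover have "(\<forall>i\<le>d. \<bar>p i\<bar> \<le> B) \<longleftrightarrow> p d \<le> B \<and> (\<forall>i<d. \<bar>p i\<bar> \<le> B)"
        using True by (auto simp: le_less)
      moreover have "p \<in> extensional {..<d + 1}" using elim(2) by (simp add: space_PiM PiE_def)
      ultimately show ?thesis
        using True elim(2) unfolding Hcoeff_plus_def Hcoeff_def cone_region_def by auto
    qed (auto simp: Hcoeff_plus_def cone_region_def)
  qed
qed

text \<open>The pairs (b, p) with p in the region of height b form a measurable set, and the measure
  of its sections depends measurably on b.\<close>

lemma measurable_emeasure_simple_region:
  "(\<lambda>b. emeasure (lborel_vec {..<d}) (simple_region d a b)) \<in> borel_measurable borel"
proof -
  let ?M = "borel \<Otimes>\<^sub>M lborel_vec {..<d} :: (real \<times> (nat \<Rightarrow> real)) measure"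
  have coord: "(\<lambda>x. snd x i) \<in> borel_measurable ?M" if "i < d" for i
    by (rule measurable_compose[OF measurable_snd measurable_coord]) (use that in simp)
  have bound: "Measurable.pred ?M (\<lambda>x. \<forall>i\<in>{..<d}. \<bar>snd x i\<bar> \<le> fst x)"
  proof (rule pred_intros_finite)
    fix i assume "i \<in> {..<d}"
    then have [measurable]: "(\<lambda>x. snd x i) \<in> borel_measurable ?M" using coord by simp
    show "Measurable.pred ?M (\<lambda>x. \<bar>snd x i\<bar> \<le> fst x)" by measurable
  qed simp
  have bound': "{x \<in> space ?M. \<forall>i<d. \<bar>snd x i\<bar> \<le> fst x} \<in> sets ?M"
    using predE[OF bound] by (simp only: Ball_def lessThan_iff)
  have sig: "{x \<in> space ?M. simple_sig a (monic_of_vec d (snd x))} \<in> sets ?M"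
    by (rule predE[OF measurable_pred_monic_of_vec[OF measurable_simple_sig coord]])
  have "{x \<in> space ?M. (\<forall>i<d. \<bar>snd x i\<bar> \<le> fst x) \<and> simple_sig a (monic_of_vec d (snd x))} \<in> sets ?M"
    by (intro sets.sets_Collect_conj bound' sig)
  then have "(\<lambda>b. emeasure (lborel_vec {..<d}) (Pair b -` {x \<in> space ?M. (\<forall>i<d. \<bar>snd x i\<bar> \<le> fst x) \<and>
      simple_sig a (monic_of_vec d (snd x))})) \<in> borel_measurable borel"
    by (rule sigma_finite_measure.measurable_emeasure_Pair[OF sigma_finite_lborel_vec, rotated]) simp
  moreover have "Pair b -` {x \<in> space ?M. (\<forall>i<d. \<bar>snd x i\<bar> \<le> fst x) \<and> simple_sig a (monic_of_vec d (snd x))} =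
      simple_region d a b" for b
    by (auto simp: simple_region_def space_pair_measure)
  ultimately show ?thesis by simp
qed

text \<open>Slice by the leading coefficient t and substitute t = B u: dt gives B, t^d gives B^d
  u^d, and the height B / t becomes 1 / u.\<close>

lemma emeasure_cone_region:
  assumes "B > 0"
  shows "emeasure (lborel_vec {..<Suc d}) (cone_region d a B) = ennreal (B ^ (d + 1)) *
    (\<integral>\<^sup>+u. indicator {0<..1} u * (ennreal (u ^ d) * emeasure (lborel_vec {..<d}) (simple_region d a (1 / u))) \<partial>lborel)"
proof -
  define E where "E b = emeasure (lborel_vec {..<d}) (simple_region d a b)" for b
  have [measurable]: "(\<lambda>u. E (c / u)) \<in> borel_measurable borel" for c
    unfolding E_def by (rule measurable_compose[OF _ measurable_emeasure_simple_region]) measurable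
  have "emeasure (lborel_vec {..<Suc d}) (cone_region d a B) = integral\<^sup>N (lborel_vec {..<Suc d}) (indicator (cone_region d a B))"
    by (simp add: sets_cone_region)
  also have "\<dots> = (\<integral>\<^sup>+t. \<integral>\<^sup>+v. indicator (cone_region d a B) (v(d := t)) \<partial>lborel_vec {..<d} \<partial>lborel)"
    by (rule nn_integral_lborel_vec_lessThan_Suc_rev[OF borel_measurable_indicator[OF sets_cone_region]])
  also have "\<dots> = (\<integral>\<^sup>+t. indicator {0<..B} t * (ennreal (t ^ d) * E (B / t)) \<partial>lborel)"
  proof (rule nn_integral_cong)
    fix t :: real
    show "(\<integral>\<^sup>+v. indicator (cone_region d a B) (v(d := t)) \<partial>lborel_vec {..<d}) =
        indicator {0<..B} t * (ennreal (t ^ d) * E (B / t))"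
    proof (cases "t \<in> {0<..B}")
      case True
      have "indicator (cone_region d a B) (v(d := t)) =
          (of_bool ((\<forall>i<d. \<bar>v i\<bar> \<le> B) \<and> simple_sig a (monic_of_vec d (\<lambda>i. v i / t))) :: ennreal)"
        if v: "v \<in> space (lborel_vec {..<d})" for v
      proof -
        have "monic_of_vec d (\<lambda>i. (v(d := t)) i / (v(d := t)) d) = monic_of_vec d (\<lambda>i. v i / t)"
          by (intro monic_of_vec_cong) auto
        moreover have "v(d := t) \<in> space (lborel_vec {..<Suc d})"
          using v by (auto simp: space_PiM PiE_def extensional_def)
        ultimately show ?thesis using True by (auto simp: cone_region_def indicator_def)
      qed
      then have "(\<integral>\<^sup>+v. indicator (cone_region d a B) (v(d := t)) \<partial>lborel_vec {..<d}) =
          (\<integral>\<^sup>+v. of_bool ((\<forall>i<d. \<bar>v i\<bar> \<le> B) \<and> simple_sig a (monic_of_vec d (\<lambda>i. v i / t))) \<partial>lborel_vec {..<d})"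
        by (rule nn_integral_cong)
      then show ?thesis
        using True emeasure_simple_region_scale[of t d B a] by (simp add: E_def)
    next
      case False
      then have "indicator (cone_region d a B) (v(d := t)) = (0 :: ennreal)" for v
        by (auto simp: cone_region_def indicator_def)
      then show ?thesis using False by simp
    qed
  qed
  also have "\<dots> = ennreal \<bar>B\<bar> * (\<integral>\<^sup>+u. indicator {0<..B} (0 + B * u) * (ennreal ((0 + B * u) ^ d) * E (B / (0 + B * u))) \<partial>lborel)"
  proof (rule nn_integral_real_affine)
    show "(\<lambda>t. indicator {0<..B} t * (ennreal (t ^ d) * E (B / t))) \<in> borel_measurable borel"
      by measurable
  qed (use assms in simp)
  also have "\<dots> = ennreal \<bar>B\<bar> * (\<integral>\<^sup>+u. ennreal (B ^ d) * (indicator {0<..1} u * (ennreal (u ^ d) * E (1 / u))) \<partial>lborel)"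
  proof -
    have "indicator {0<..B} (0 + B * u) * (ennreal ((0 + B * u) ^ d) * E (B / (0 + B * u))) =
        ennreal (B ^ d) * (indicator {0<..1} u * (ennreal (u ^ d) * E (1 / u)))" for u
      using assms by (auto simp: indicator_def power_mult_distrib ennreal_mult mult_ac zero_less_mult_iff mult_le_cancel_left1)
    then show ?thesis by simp
  qed
  also have "\<dots> = ennreal \<bar>B\<bar> * (ennreal (B ^ d) * (\<integral>\<^sup>+u. indicator {0<..1} u * (ennreal (u ^ d) * E (1 / u)) \<partial>lborel))"
    by (rule arg_cong[where f = "times _"], rule nn_integral_cmult) measurable
  also have "\<dots> = ennreal (B ^ (d + 1)) * (\<integral>\<^sup>+u. indicator {0<..1} u * (ennreal (u ^ d) * E (1 / u)) \<partial>lborel)"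
    using assms by (simp add: ennreal_mult mult.assoc)
  finally show ?thesis by (simp add: E_def)
qed

section \<open>The two volume formulas\<close>

theorem theorem2p2:
  fixes d s r :: nat and B I :: real
  assumes "1 \<le> d" and "s \<le> d div 2" and "r = d - 2 * s" and "0 < B"
    and "I = 2 ^ s / (fact r * fact s) *
          (LINT v:Hroots d s B|lebesgue_vec d.
             \<bar>Delta_real r v\<bar> * Delta_cplx r s v * Delta_mixed r s v * (\<Prod>j<s. \<bar>zc r s v j\<bar>))"
  shows "(1 \<le> B \<longrightarrow> measure (lebesgue_vec d) (Hcoeff_star d s B) = I) \<and>
         measure (lebesgue_vec d) (Hcoeff_monic d s B) = I \<and>
         measure (lebesgue_vec (d + 1)) (Hcoeff_plus d s B) =
           B ^ (d + 1) *
             (LINT u:{0..1}|lebesgue. u ^ d * measure (lebesgue_vec d) (Hcoeff_star d s (1 / u)))"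

proof (intro conjI impI)
  have d: "d = r + 2 * s" using assms(2,3) by auto
  show monic: "measure (lebesgue_vec d) (Hcoeff_monic d s B) = I"
    unfolding measure_Hcoeff_monic[OF d] measure_simple_region_eq_integral[OF d] assms(5) ..
  show "measure (lebesgue_vec d) (Hcoeff_star d s B) = I" if "1 \<le> B"
    using monic Hcoeff_star_eq_monic[OF that] by simp
  define E where "E b = emeasure (lborel_vec {..<d}) (simple_region d r b)" for b
  \<comment> \<open>The half-open interval avoids the value 1 / 0; on it 1 / u \<ge> 1, where
    \<open>Hcoeff_star\<close> and \<open>Hcoeff_monic\<close> agree.\<close>
  define G where "G u = indicator {0<..1} u * (u ^ d * enn2real (E (1 / u)))" for u :: real
  have G: "ennreal (G u) = indicator {0<..1} u * (ennreal (u ^ d) * E (1 / u))" for u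
  proof -
    \<comment> \<open>The region lies in a bounded box, so its measure is finite and
      \<open>enn2real\<close> loses nothing.\<close>
    have "ennreal (enn2real (E (1 / u))) = E (1 / u)"
      using emeasure_simple_region_finite by (simp add: E_def)
    then show ?thesis by (auto simp: G_def indicator_def ennreal_mult)
  qed
  have Gm: "G \<in> borel_measurable lborel"
    using measurable_emeasure_simple_region unfolding G_def E_def by measurable
  \<comment> \<open>At u = 0 the factor u^d is 0 because d \<ge> 1, which matches the value of G
    there.\<close>
  have star: "indicator {0..1} u *\<^sub>R (u ^ d * measure (lebesgue_vec d) (Hcoeff_star d s (1 / u))) = G u" for u :: real
  proof -
    have "u = 0 \<or> u \<in> {0<..1} \<or> u \<notin> {0..1}" by auto
    moreover have "measure (lebesgue_vec d) (Hcoeff_star d s (1 / u)) = enn2real (E (1 / u))" if "u \<in> {0<..1}"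
      using that Hcoeff_star_eq_monic[of "1 / u" d s] measure_Hcoeff_monic[OF d, of "1 / u"]
      by (simp add: E_def measure_def)
    ultimately show ?thesis using assms(1) by (auto simp: G_def indicator_def)
  qed
  have "(LINT u:{0..1}|lebesgue. u ^ d * measure (lebesgue_vec d) (Hcoeff_star d s (1 / u))) = (LINT u|lebesgue. G u)"
    unfolding set_lebesgue_integral_def star ..
  also have "\<dots> = (LINT u|lborel. G u)" by (rule integral_completion[OF Gm])
  also have "\<dots> = enn2real (\<integral>\<^sup>+u. ennreal (G u) \<partial>lborel)"
    by (intro integral_eq_nn_integral[OF Gm]) (auto simp: G_def indicator_def)
  finally have "B ^ (d + 1) * (LINT u:{0..1}|lebesgue. u ^ d * measure (lebesgue_vec d) (Hcoeff_star d s (1 / u))) =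
      enn2real (ennreal (B ^ (d + 1)) * (\<integral>\<^sup>+u. ennreal (G u) \<partial>lborel))"
    using assms(4) by (simp add: enn2real_mult)
  also have "ennreal (B ^ (d + 1)) * (\<integral>\<^sup>+u. ennreal (G u) \<partial>lborel) = emeasure (lborel_vec {..<Suc d}) (cone_region d r B)"
    unfolding G E_def by (rule emeasure_cone_region[OF assms(4), symmetric])
  finally show "measure (lebesgue_vec (d + 1)) (Hcoeff_plus d s B) =
      B ^ (d + 1) * (LINT u:{0..1}|lebesgue. u ^ d * measure (lebesgue_vec d) (Hcoeff_star d s (1 / u)))"
    using measure_Hcoeff_plus[OF d, of B] by (simp add: measure_def)
qed

end
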